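(* Let $k>22$ and let $H$ be a finite group with a normal subgroup $M\ne 1$ such that $H/M\cong A_k$, the extension $1\to M\to H\to A_k\to 1$ is nonsplit, and $\gcd(2k,|M|)=1$. Then $P(H)\ge \frac12 k(k-1)(k-2)$.
   Context: For a finite group $H$, $P(H)$ denotes the minimal degree of a faithful permutation representation of $H$. An extension is nonsplit if $M$ has no complement in $H$. *)

theory Defs
  imports "HOL-Algebra.Algebra"
begin

definition min_perm_degree :: "('a, 'b) monoid_scheme \<Rightarrow> nat" where
  "min_perm_degree H =
     (LEAST n. \<exists>h. h \<in> hom H (sym_group n) \<and> inj_on h (carrier H))"

text \<open>The extension of M by H/M splits iff M has a complement in H.\<close>
definition has_complement :: "('a, 'b) monoid_scheme \<Rightarrow> 'a set \<Rightarrow> bool" where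
  "has_complement H M =
     (\<exists>K. subgroup K H \<and> K \<inter> M = {\<one>\<^bsub>H\<^esub>} \<and> K <#>\<^bsub>H\<^esub> M = carrier H)"

end

theory Submission
  imports Defs
begin

text \<open>The bound is \<open>3 * (k choose 3)\<close>. The 3 is the least odd index above 1. The
  binomial is the threshold below which a subgroup of the alternating group contains all even
  permutations that fix some two points; \<open>small_index_alt\<close> proves this from 21 points
  on and is applied to k and to k - 2 points, hence k > 22.

  Passing from the stabilizer to cocycles on the whole group is Shapiro's lemma. Coprimality enters
  twice: for odd p, functions on ordered pairs split into symmetric and antisymmetric ones, and k
  being invertible modulo p separates the constants from the functions of sum zero.

  The obstacle is the symmetric part. If p divides k - 2, the functions m_i + m_j with m of sum zero
  have vanishing row sums, so row sums alone cannot exclude them as values on \<open>M\<close>. Such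
  values instead yield a homomorphism on \<open>M\<close> that is invariant under the stabilizer of
  a point; \<open>hom_extends\<close> extends it to that stabilizer in two steps, and there the
  one-point case \<open>point_hom_vanishes\<close> applies.\<close>

text \<open>Shrinking \<open>H\<close> to a minimal supplement of \<open>M\<close>, we may assume that \<open>M\<close> is contained in the Frattini
  subgroup, so that its Sylow subgroups are normal in \<open>H\<close>. Nonsplitness keeps \<open>M\<close> nontrivial, hence a faithful
  action of degree \<open>n\<close> has a point whose stabilizer \<open>Y\<close> does not contain \<open>M\<close>. As \<open>card M\<close> is odd, the image
  of \<open>Y\<close> in \<open>A\<^sub>k\<close> has index at most \<open>n / 3\<close>; if \<open>n\<close> is below the bound, Bochert's argument shows that this
  image contains the pointwise stabilizer of two points \<open>a\<close>, \<open>b\<close>.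

  Let \<open>B\<close> be the preimage of that stabilizer. By the bound on \<open>n\<close> the intersection \<open>Y \<inter> B\<close>, and with it any
  maximal supplement \<open>V\<close> of \<open>M\<close> in \<open>B\<close> above it, has small index in \<open>B\<close>. A chief factor of order below
  \<open>(k - 2) choose 3\<close> is central, so \<open>V\<close> is normal and \<open>B\<close> has a homomorphism of odd prime order \<open>p\<close>, with
  \<open>p\<close> not dividing \<open>k\<close>, that is nontrivial on \<open>M\<close>. Inducing this homomorphism to \<open>H\<close> yields a cocycle with
  values in the functions on ordered pairs of points. Its values on \<open>M\<close> form a submodule. Up to a coboundary
  all values of the cocycle lie in this submodule, so its zero set is a supplement of \<open>M\<close>, hence all of \<open>H\<close>,
  and the homomorphism vanishes on \<open>M\<close> after all.\<close>

section \<open>Alternating groups\<close>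

definition Alt :: "'a set \<Rightarrow> ('a \<Rightarrow> 'a) set" where
  "Alt S = {p. p permutes S \<and> evenperm p}"

definition cyc3 :: "'a \<Rightarrow> 'a \<Rightarrow> 'a \<Rightarrow> 'a \<Rightarrow> 'a" where
  "cyc3 a b c = transpose a b \<circ> transpose b c"

lemma cyc3_apply:
  assumes "distinct [a, b, c]"
  shows "cyc3 a b c x = (if x = a then b else if x = b then c else if x = c then a else x)"
  using assms by (auto simp: cyc3_def transpose_def)

lemma cyc3_rotate: "distinct [a, b, c] \<Longrightarrow> cyc3 a b c = cyc3 b c a"
  by (rule ext) (auto simp: cyc3_apply)

lemma cyc3_inverse: "distinct [a, b, c] \<Longrightarrow> cyc3 a b c \<circ> cyc3 c b a = id"
  by (rule ext) (auto simp: cyc3_apply split: if_splits)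

lemma inv_cyc3: "distinct [a, b, c] \<Longrightarrow> inv' (cyc3 a b c) = cyc3 c b a"
  by (rule inv_unique_comp) (auto intro!: cyc3_inverse simp: cyc3_inverse)

lemma cyc3_in_Alt:
  assumes "a \<in> S" "b \<in> S" "c \<in> S" "distinct [a, b, c]"
  shows "cyc3 a b c \<in> Alt S"
  using assms unfolding Alt_def cyc3_def
  by (auto intro!: permutes_compose permutes_swap_id
      simp: evenperm_comp evenperm_swap permutation_swap_id)

lemma Alt_permutes: "p \<in> Alt S \<Longrightarrow> p permutes S"
  by (simp add: Alt_def)

lemma Alt_bij: "p \<in> Alt S \<Longrightarrow> bij p"
  by (auto simp: Alt_def permutes_bij)

lemma Alt_mono: "S \<subseteq> T \<Longrightarrow> Alt S \<subseteq> Alt T"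
  by (auto simp: Alt_def intro: permutes_subset)

lemma Alt_id [simp]: "id \<in> Alt S"
  by (simp add: Alt_def)

lemma finite_Alt: "finite S \<Longrightarrow> finite (Alt S)"
  by (rule finite_subset[OF _ finite_permutations[of S]]) (auto simp: Alt_def)

lemma Alt_permutation: "finite S \<Longrightarrow> p \<in> Alt S \<Longrightarrow> permutation p"
  by (auto simp: Alt_def permutation_permutes)

lemma Alt_comp: "finite S \<Longrightarrow> p \<in> Alt S \<Longrightarrow> q \<in> Alt S \<Longrightarrow> p \<circ> q \<in> Alt S"
  using Alt_permutation[of S p] Alt_permutation[of S q]
  by (auto simp: Alt_def permutes_compose evenperm_comp)

lemma Alt_inv: "finite S \<Longrightarrow> p \<in> Alt S \<Longrightarrow> inv' p \<in> Alt S"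
  using Alt_permutation[of S p] by (auto simp: Alt_def permutes_inv evenperm_inv)

lemma Alt_Diff_iff: "T \<subseteq> S \<Longrightarrow> p \<in> Alt (S - T) \<longleftrightarrow> p \<in> Alt S \<and> (\<forall>x\<in>T. p x = x)"
  unfolding Alt_def
  by (auto intro: permutes_subset permutes_superset simp: permutes_not_in)

lemma Alt_in_image: "p \<in> Alt S \<Longrightarrow> p x \<in> S \<longleftrightarrow> x \<in> S"
  by (simp add: Alt_def permutes_in_image)

lemma Alt_outside: "p \<in> Alt S \<Longrightarrow> x \<notin> S \<Longrightarrow> p x = x"
  by (auto simp: Alt_def permutes_not_in)

lemma Alt_inj: "p \<in> Alt S \<Longrightarrow> p x = p y \<longleftrightarrow> x = y"
  by (metis Alt_bij bij_pointE)

lemma Alt_support: "p \<in> Alt S \<Longrightarrow> p \<in> Alt {x. p x \<noteq> x}"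
  by (auto simp: Alt_def intro: permutes_superset)

text \<open>Groups of even permutations are bare sets of functions, so that images under
  \<open>\<pi>\<close> and stabilizers of cosets qualify without a group record.\<close>

definition alt_subgroup :: "'a set \<Rightarrow> ('a \<Rightarrow> 'a) set \<Rightarrow> bool" where
  "alt_subgroup \<Omega> L \<longleftrightarrow> L \<subseteq> Alt \<Omega> \<and> id \<in> L \<and> (\<forall>p\<in>L. \<forall>q\<in>L. p \<circ> q \<in> L) \<and> (\<forall>p\<in>L. inv' p \<in> L)"

lemma alt_subgroupD:
  assumes "alt_subgroup \<Omega> L"
  shows "L \<subseteq> Alt \<Omega>" "id \<in> L" "p \<in> L \<Longrightarrow> q \<in> L \<Longrightarrow> p \<circ> q \<in> L" "p \<in> L \<Longrightarrow> inv' p \<in> L"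
  using assms by (auto simp: alt_subgroup_def)

lemma conj_cyc3:
  assumes "bij p" "distinct [a, b, c]"
  shows "p \<circ> cyc3 a b c \<circ> inv' p = cyc3 (p a) (p b) (p c)"
proof (rule ext)
  fix x
  have inj: "p u = p v \<longleftrightarrow> u = v" for u v using assms(1) by (metis bij_pointE)
  have d: "distinct [p a, p b, p c]" using assms(2) by (simp add: inj)
  obtain y where y: "x = p y" using assms(1) by (metis bij_pointE)
  have iy: "inv' p (p y) = y" using assms(1) by (simp add: bij_is_inj)
  show "(p \<circ> cyc3 a b c \<circ> inv' p) x = cyc3 (p a) (p b) (p c) x"
    unfolding y using assms(2) d by (simp add: cyc3_apply iy inj)
qed

lemma Alt_transpose_odd: "x \<noteq> y \<Longrightarrow> transpose x y \<notin> Alt S"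
  by (auto simp: Alt_def evenperm_swap)

lemma permutes_two_points:
  assumes "p permutes {x, y}" shows "p = id \<or> p = transpose x y"
  using assms permutes_doubleton_iff by metis

text \<open>Induction on the number of moved points. An even permutation other than the identity
  moves some \<open>z\<close> besides \<open>x\<close> and \<open>p x\<close>; the 3-cycle
  \<open>c\<close> on these three points brings \<open>p x\<close> back to \<open>x\<close> and
  touches no fixed point of \<open>p\<close>.\<close>

lemma Alt_generated_by_cyc3:
  assumes "finite S" "id \<in> L" "\<And>p q. p \<in> L \<Longrightarrow> q \<in> L \<Longrightarrow> p \<circ> q \<in> L"
    and cyc: "\<And>a b c. a \<in> S \<Longrightarrow> b \<in> S \<Longrightarrow> c \<in> S \<Longrightarrow> distinct [a, b, c] \<Longrightarrow> cyc3 a b c \<in> L"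
  shows "Alt S \<subseteq> L"
proof
  fix p assume "p \<in> Alt S"
  then show "p \<in> L"
  proof (induction "card {x. p x \<noteq> x}" arbitrary: p rule: less_induct)
    case less
    have sub: "{x. p x \<noteq> x} \<subseteq> S" using less.prems Alt_outside by fastforce
    then have fin: "finite {x. p x \<noteq> x}" using \<open>finite S\<close> finite_subset by blast
    show ?case
    proof (cases "p = id")
      case False
      then obtain x where x: "p x \<noteq> x" by (auto simp: fun_eq_iff)
      define y where "y = p x"
      have py: "p y \<noteq> y" using x Alt_inj[OF less.prems] by (simp add: y_def)
      have "\<exists>z. p z \<noteq> z \<and> z \<noteq> x \<and> z \<noteq> y"
      proof (rule ccontr)
        assume "\<not> ?thesis"
        then have "p permutes {x, y}"
          using Alt_support[OF less.prems] unfolding Alt_def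
          by (auto intro: permutes_subset)
        then have "p = transpose x y" using permutes_two_points[of p x y] False by simp
        then show False using less.prems Alt_transpose_odd[of x y S] x y_def by metis
      qed
      then obtain z where z: "p z \<noteq> z" "z \<noteq> x" "z \<noteq> y" by blast
      have d: "distinct [x, z, y]" using x z by (auto simp: y_def)
      have d': "distinct [y, x, z]" "distinct [z, x, y]" using d by auto
      define c where "c = cyc3 y x z"
      have S: "x \<in> S" "y \<in> S" "z \<in> S" using sub x py z by auto
      have cS: "c \<in> Alt S" unfolding c_def using S d by (intro cyc3_in_Alt) auto
      define q where "q = c \<circ> p"
      have qS: "q \<in> Alt S" unfolding q_def using Alt_comp[OF \<open>finite S\<close> cS less.prems] .
      have "{t. q t \<noteq> t} \<subseteq> {t. p t \<noteq> t} - {x}"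
      proof safe
        fix t assume "q t \<noteq> t" "p t = t"
        then show False using x py z d' by (auto simp: q_def c_def cyc3_apply split: if_splits)
      next
        assume "q x \<noteq> x" then show False using d' by (simp add: q_def c_def cyc3_apply y_def[symmetric])
      qed
      then have "card {t. q t \<noteq> t} < card {t. p t \<noteq> t}"
        using x fin by (intro psubset_card_mono) auto
      then have qL: "q \<in> L" using less.hyps qS by blast
      have "p = cyc3 z x y \<circ> q"
        unfolding q_def c_def using cyc3_inverse[OF d'(2)] by (simp add: o_assoc)
      then show ?thesis using assms(3)[OF cyc qL] S d' by auto
    qed (use assms(2) in simp)
  qed
qed

text \<open>Up to reflexivity this is an equivalence relation. \<open>L\<close> permutes its classes
  and contains all even permutations of each class.\<close>

definition cyc3_rel :: "('a \<Rightarrow> 'a) set \<Rightarrow> 'a \<Rightarrow> 'a \<Rightarrow> bool" where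
  "cyc3_rel L a b \<longleftrightarrow> (\<exists>c. distinct [a, b, c] \<and> cyc3 a b c \<in> L)"

context
  fixes \<Omega> :: "'a set" and L
  assumes fin: "finite \<Omega>" and L: "alt_subgroup \<Omega> L"
begin

lemma cyc3_conj_closed:
  assumes "p \<in> L" "cyc3 a b c \<in> L" "distinct [a, b, c]"
  shows "cyc3 (p a) (p b) (p c) \<in> L"
proof -
  have "bij p" using assms(1) alt_subgroupD(1)[OF L] Alt_bij by blast
  then show ?thesis
    using conj_cyc3[OF _ assms(3), of p] alt_subgroupD(3,4)[OF L] assms by metis
qed

lemma cyc3_inv_closed: "distinct [a, b, c] \<Longrightarrow> cyc3 a b c \<in> L \<Longrightarrow> cyc3 c b a \<in> L"
  using inv_cyc3 alt_subgroupD(4)[OF L] by metis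

lemma cyc3_perm_closed:
  assumes "distinct [a, b, c]" "cyc3 a b c \<in> L"
  shows "cyc3 b c a \<in> L" "cyc3 c a b \<in> L" "cyc3 c b a \<in> L" "cyc3 b a c \<in> L" "cyc3 a c b \<in> L"
proof -
  have d: "distinct [b, c, a]" "distinct [c, a, b]" using assms(1) by auto
  show 1: "cyc3 b c a \<in> L" using assms(2) cyc3_rotate[OF assms(1)] by metis
  show 2: "cyc3 c a b \<in> L" using 1 cyc3_rotate[OF d(1)] by metis
  show "cyc3 c b a \<in> L" using assms cyc3_inv_closed by blast
  show "cyc3 b a c \<in> L" using cyc3_inv_closed[OF d(2) 2] .
  show "cyc3 a c b \<in> L" using cyc3_inv_closed[OF d(1) 1] .
qed

lemma cyc3_rel_sym: "cyc3_rel L a b \<Longrightarrow> cyc3_rel L b a"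
  unfolding cyc3_rel_def using cyc3_perm_closed(4) by auto

text \<open>Stronger than transitivity: the 3-cycle on the three given points itself lies in
  \<open>L\<close>. It arises by conjugating one of the two given 3-cycles by the other, twice if
  their third points differ.\<close>

lemma cyc3_rel_join:
  assumes "cyc3_rel L a b" "cyc3_rel L b c" "a \<noteq> c"
  shows "cyc3 a b c \<in> L"
proof -
  obtain x where x: "distinct [a, b, x]" "cyc3 a b x \<in> L"
    using assms(1) by (auto simp: cyc3_rel_def)
  obtain y where y: "distinct [b, c, y]" "cyc3 b c y \<in> L"
    using assms(2) by (auto simp: cyc3_rel_def)
  show ?thesis
  proof (cases "x = c \<or> y = a")
    case True
    then show ?thesis using x y cyc3_perm_closed[of b c a] by auto
  next
    case False
    show ?thesis
    proof (cases "x = y")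
      case True
      have "cyc3 (cyc3 b c x a) (cyc3 b c x b) (cyc3 b c x x) \<in> L"
        using cyc3_conj_closed x y True by blast
      then have "cyc3 a c b \<in> L" using x y True False assms(3) by (auto simp: cyc3_apply)
      then show ?thesis using cyc3_perm_closed(5)[of a c b] x y assms(3) by auto
    next
      case xy: False
      have "cyc3 (cyc3 b c y a) (cyc3 b c y b) (cyc3 b c y x) \<in> L"
        using cyc3_conj_closed x y by blast
      then have 1: "cyc3 a c x \<in> L" using x y xy False assms(3) by (auto simp: cyc3_apply split: if_splits)
      have d: "distinct [a, c, x]" using x False assms by auto
      have "cyc3 (cyc3 a b x a) (cyc3 a b x c) (cyc3 a b x x) \<in> L"
        using cyc3_conj_closed x 1 d by blast
      then have "cyc3 b c a \<in> L" using x y d by (auto simp: cyc3_apply split: if_splits)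
      then show ?thesis using cyc3_perm_closed(2)[of b c a] x y assms by auto
    qed
  qed
qed

lemma cyc3_rel_trans:
  assumes "cyc3_rel L a b" "cyc3_rel L b c" "a \<noteq> c" shows "cyc3_rel L a c"
proof -
  have "distinct [a, b, c]" using assms by (auto simp: cyc3_rel_def)
  then show ?thesis
    using cyc3_perm_closed(5)[OF _ cyc3_rel_join[OF assms]] unfolding cyc3_rel_def by auto
qed

lemma cyc3_rel_in: "cyc3_rel L a b \<Longrightarrow> a \<in> \<Omega> \<and> b \<in> \<Omega>"
proof -
  assume "cyc3_rel L a b"
  then obtain c where c: "distinct [a, b, c]" "cyc3 a b c \<in> Alt \<Omega>"
    using alt_subgroupD(1)[OF L] by (auto simp: cyc3_rel_def)
  have "cyc3 a b c a \<noteq> a" "cyc3 a b c b \<noteq> b" using c(1) by (auto simp: cyc3_apply)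
  then show ?thesis using Alt_outside[OF c(2)] by auto
qed

lemma cyc3_rel_conj: "p \<in> L \<Longrightarrow> cyc3_rel L a b \<Longrightarrow> cyc3_rel L (p a) (p b)"
proof -
  assume p: "p \<in> L" and "cyc3_rel L a b"
  then obtain c where c: "distinct [a, b, c]" "cyc3 a b c \<in> L" by (auto simp: cyc3_rel_def)
  have "distinct [p a, p b, p c]" using c(1) alt_subgroupD(1)[OF L] p Alt_inj by (metis (no_types, lifting) distinct_length_2_or_more distinct_singleton subsetD)
  then show ?thesis unfolding cyc3_rel_def using cyc3_conj_closed[OF p c(2,1)] by blast
qed

definition cyc3_class :: "'a \<Rightarrow> 'a set" where
  "cyc3_class a = insert a {b. cyc3_rel L a b}"

lemma Alt_cyc3_class: "Alt (cyc3_class a) \<subseteq> L"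
proof (cases "a \<in> \<Omega>")
  case True
  then have "cyc3_class a \<subseteq> \<Omega>" using cyc3_rel_in by (auto simp: cyc3_class_def)
  then have "finite (cyc3_class a)" using fin finite_subset by blast
  then show ?thesis
  proof (rule Alt_generated_by_cyc3)
    have rel: "cyc3_rel L x y" if "x \<in> cyc3_class a" "y \<in> cyc3_class a" "x \<noteq> y" for x y
      using that cyc3_rel_sym cyc3_rel_trans unfolding cyc3_class_def by blast
    fix x y z assume "x \<in> cyc3_class a" "y \<in> cyc3_class a" "z \<in> cyc3_class a" "distinct [x, y, z]"
    then show "cyc3 x y z \<in> L" using rel cyc3_rel_join by auto
  qed (use alt_subgroupD[OF L] in auto)
next
  case False
  then have "cyc3_class a = {a}" using cyc3_rel_in by (auto simp: cyc3_class_def)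
  then show ?thesis using alt_subgroupD(2)[OF L] by (auto simp: Alt_def)
qed

lemma cyc3_class_image: "p \<in> L \<Longrightarrow> p ` cyc3_class a = cyc3_class (p a)"
proof -
  have sub: "p ` cyc3_class a \<subseteq> cyc3_class (p a)" if "p \<in> L" for p a
    using cyc3_rel_conj[OF that] by (auto simp: cyc3_class_def)
  assume p: "p \<in> L"
  have b: "bij p" using p alt_subgroupD(1)[OF L] Alt_bij by blast
  have "inv' p ` cyc3_class (p a) \<subseteq> cyc3_class a"
    using sub[OF alt_subgroupD(4)[OF L p], of "p a"] b by (simp add: bij_is_inj)
  then have "p ` inv' p ` cyc3_class (p a) \<subseteq> p ` cyc3_class a" by (rule image_mono)
  then show ?thesis using sub[OF p] b by (metis bij_is_surj image_f_inv_f subset_antisym)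
qed

lemma cyc3_class_disjoint: "cyc3_class a \<inter> cyc3_class b \<noteq> {} \<Longrightarrow> cyc3_class a = cyc3_class b"
proof -
  have *: "cyc3_class x \<subseteq> cyc3_class y" if z: "z \<in> cyc3_class x" "z \<in> cyc3_class y" for x y z
  proof
    fix t assume t: "t \<in> cyc3_class x"
    have 1: "t = z \<or> cyc3_rel L z t"
      using z(1) t cyc3_rel_sym cyc3_rel_trans unfolding cyc3_class_def by blast
    show "t \<in> cyc3_class y"
      using 1 z(2) cyc3_rel_trans unfolding cyc3_class_def by blast
  qed
  assume "cyc3_class a \<inter> cyc3_class b \<noteq> {}"
  then show ?thesis using * by blast
qed

lemma cyc3_class_subset: "a \<in> \<Omega> \<Longrightarrow> cyc3_class a \<subseteq> \<Omega>"
  using cyc3_rel_in by (auto simp: cyc3_class_def)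

lemma cyc3_class_card:
  assumes "cyc3_class a \<noteq> {a}" "a \<in> \<Omega>" shows "card (cyc3_class a) \<ge> 3"
proof -
  obtain b where b: "cyc3_rel L a b" using assms by (auto simp: cyc3_class_def)
  then obtain c where c: "distinct [a, b, c]" "cyc3 a b c \<in> L" by (auto simp: cyc3_rel_def)
  have "cyc3_rel L a c" unfolding cyc3_rel_def using cyc3_perm_closed(5)[OF c] c(1) by auto
  then have "{a, b, c} \<subseteq> cyc3_class a" using b by (auto simp: cyc3_class_def)
  moreover have "card {a, b, c} = 3" using c by auto
  ultimately show ?thesis
    using card_mono[of "cyc3_class a" "{a, b, c}"] cyc3_class_subset[OF assms(2)] fin finite_subset
    by metis
qed

end

text \<open>Both sets lie in the \<open>cyc3_class\<close> of a common point: with three points in a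
  set, any two of them are joined by a 3-cycle on that set.\<close>

lemma Alt_Un_subset:
  assumes "finite \<Omega>" "alt_subgroup \<Omega> L" "Alt S \<subseteq> L" "Alt T \<subseteq> L" "S \<inter> T \<noteq> {}"
    "card S \<ge> 3" "card T \<ge> 3"
  shows "Alt (S \<union> T) \<subseteq> L"
proof -
  obtain a where a: "a \<in> S" "a \<in> T" using assms(5) by blast
  have *: "R \<subseteq> cyc3_class L a" if R: "a \<in> R" "card R \<ge> 3" "Alt R \<subseteq> L" for R
  proof
    fix b assume b: "b \<in> R"
    show "b \<in> cyc3_class L a"
    proof (cases "b = a")
      case False
      have "finite R" using R(2) card.infinite by force
      then have "\<not> R \<subseteq> {a, b}" using R(2) card_mono[of "{a, b}" R] card_insert_le_m1[of 2 "{b}" a] by force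
      then obtain c where "c \<in> R" "c \<noteq> a" "c \<noteq> b" by blast
      then have "cyc3 a b c \<in> L" "distinct [a, b, c]" using cyc3_in_Alt[of a R b c] R b False by auto
      then show ?thesis using assms(1,2) by (auto simp: cyc3_class_def cyc3_rel_def)
    qed (use assms(1,2) in \<open>simp add: cyc3_class_def\<close>)
  qed
  have "S \<union> T \<subseteq> cyc3_class L a" using * a assms by auto
  then show ?thesis using Alt_mono Alt_cyc3_class[OF assms(1,2)] by blast
qed

section \<open>Subgroups of small index\<close>

text \<open>Any extension of \<open>f\<close> to a permutation of \<open>D\<close> can be made even
  by composing it with a transposition of two points outside \<open>S\<close>, hence the two spare
  points.\<close>

lemma Alt_extend:
  assumes "finite D" "S \<subseteq> D" "inj_on f S" "f ` S \<subseteq> D" "card S + 2 \<le> card D"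
  shows "\<exists>g\<in>Alt D. \<forall>x\<in>S. g x = f x"
proof -
  have finS: "finite S" using assms(1,2) finite_subset by blast
  have "card (D - S) = card (D - f ` S)"
    using assms finS by (simp add: card_Diff_subset card_image)
  then obtain k where k: "bij_betw k (D - S) (D - f ` S)"
    using assms(1) finite_same_card_bij[of "D - S" "D - f ` S"] by auto
  have "bij_betw (\<lambda>x. if x \<in> S then f x else k x) (S \<union> (D - S)) (f ` S \<union> (D - f ` S))"
  proof (rule bij_betw_combine)
    show "bij_betw (\<lambda>x. if x \<in> S then f x else k x) S (f ` S)"
      using inj_on_imp_bij_betw[OF assms(3)] by (subst bij_betw_cong[of S _ f]) auto
    show "bij_betw (\<lambda>x. if x \<in> S then f x else k x) (D - S) (D - f ` S)"
      using k by (subst bij_betw_cong[of "D - S" _ k]) auto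
  qed auto
  moreover have "S \<union> (D - S) = D" "f ` S \<union> (D - f ` S) = D" using assms by auto
  ultimately have b: "bij_betw (\<lambda>x. if x \<in> S then f x else k x) D D" by simp
  define g where "g = (\<lambda>x. if x \<in> D then if x \<in> S then f x else k x else x)"
  have "bij_betw g D D" using b by (subst bij_betw_cong[of D g]) (auto simp: g_def)
  then have gp: "g permutes D" by (rule bij_imp_permutes) (simp add: g_def)
  have gf: "g x = f x" if "x \<in> S" for x using that assms(2) by (auto simp: g_def)
  have "card (D - S) \<ge> 2" using assms finS by (simp add: card_Diff_subset)
  then obtain T where "T \<subseteq> D - S" "card T = 2" using obtain_subset_with_card_n by metis
  then obtain u v where uv: "u \<noteq> v" "u \<in> D - S" "v \<in> D - S" by (auto simp: card_2_iff)
  have pg: "permutation g" using gp assms(1) permutation_permutes by blast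
  show ?thesis
  proof (cases "evenperm g")
    case True
    then show ?thesis using gp gf by (auto simp: Alt_def)
  next
    case False
    have "g \<circ> transpose u v permutes D"
      using gp uv by (intro permutes_compose permutes_swap_id) auto
    moreover have "evenperm (g \<circ> transpose u v)"
      using False uv by (simp add: evenperm_comp pg permutation_swap_id evenperm_swap)
    moreover have "(g \<circ> transpose u v) x = f x" if "x \<in> S" for x
      using that uv gf by (auto simp: transpose_def)
    ultimately show ?thesis by (auto simp: Alt_def)
  qed
qed

text \<open>If fewer than two points lie outside \<open>S\<close>, the complements, which have at
  most one point, are moved onto each other instead.\<close>

lemma Alt_homogeneous:
  assumes "finite D" "card D \<ge> 3" "S \<subseteq> D" "S' \<subseteq> D" "card S = card S'"
  shows "\<exists>g\<in>Alt D. g ` S = S'"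
proof -
  have *: "\<exists>g\<in>Alt D. g ` S = S'" if "S \<subseteq> D" "S' \<subseteq> D" "card S = card S'" "card S + 2 \<le> card D" for S S'
  proof -
    note S = that
    have "finite S" "finite S'" using that assms(1) finite_subset by blast+
    then obtain h where h: "bij_betw h S S'" using finite_same_card_bij[of S S'] \<open>card S = card S'\<close> by auto
    then obtain g where "g \<in> Alt D" "\<forall>x\<in>S. g x = h x"
      using Alt_extend[of D S h] assms(1) S by (metis bij_betw_def)
    then show ?thesis using h by (metis bij_betw_imp_surj_on image_cong)
  qed
  show ?thesis
  proof (cases "card S + 2 \<le> card D")
    case False
    have fin: "finite S" "finite S'" using assms finite_subset by auto
    have "card (D - S) = card (D - S')" "card (D - S) + 2 \<le> card D"
      using False assms fin by (auto simp: card_Diff_subset)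
    then obtain g where g: "g \<in> Alt D" "g ` (D - S) = D - S'" using *[of "D - S" "D - S'"] by auto
    have "g ` D = D" using g(1) by (simp add: Alt_def permutes_image)
    then have "g ` (D - (D - S)) = D - (D - S')"
      using g inj_on_image_set_diff[of g UNIV D "D - S"] Alt_bij[of g D] by (simp add: bij_def)
    then show ?thesis using g(1) assms by (auto simp: double_diff)
  qed (use * assms in auto)
qed

text \<open>The elements of \<open>R\<close> lie in distinct left cosets of
  \<open>L\<close>.\<close>

lemma transversal_card:
  assumes "finite \<Omega>" "alt_subgroup \<Omega> L" "R \<subseteq> Alt \<Omega>"
    and inj: "\<And>r s. r \<in> R \<Longrightarrow> s \<in> R \<Longrightarrow> inv' s \<circ> r \<in> L \<Longrightarrow> r = s"
  shows "card R * card L \<le> card (Alt \<Omega>)"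
proof -
  have LA: "L \<subseteq> Alt \<Omega>" using alt_subgroupD[OF assms(2)] by simp
  have "inj_on (\<lambda>(r, l). r \<circ> l) (R \<times> L)"
  proof (rule inj_onI, clarify)
    fix r l s m assume *: "r \<in> R" "l \<in> L" "s \<in> R" "m \<in> L" "r \<circ> l = s \<circ> m"
    have b: "bij r" "bij s" "bij l" using * assms(3) LA Alt_bij by blast+
    have "inv' s \<circ> r = inv' s \<circ> (r \<circ> l) \<circ> inv' l"
      using b by (auto simp: fun_eq_iff bij_is_surj surj_f_inv_f)
    also have "\<dots> = m \<circ> inv' l"
      unfolding *(5) using b by (auto simp: fun_eq_iff bij_is_inj)
    finally have "inv' s \<circ> r \<in> L" using alt_subgroupD[OF assms(2)] * by metis
    then have rs: "r = s" using inj * by blast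
    have "l = m"
    proof (rule ext)
      fix x show "l x = m x" using fun_cong[OF *(5), of x] b by (simp add: rs bij_is_inj inj_eq)
    qed
    then show "r = s \<and> l = m" using rs by simp
  qed
  then have "card R * card L = card ((\<lambda>(r, l). r \<circ> l) ` (R \<times> L))"
    by (simp add: card_image card_cartesian_product)
  also have "\<dots> \<le> card (Alt \<Omega>)"
    using Alt_comp[OF assms(1)] assms LA finite_Alt[OF assms(1)]
    by (intro card_mono) (auto simp: subset_iff)
  finally show ?thesis .
qed

text \<open>For each subset of \<open>D\<close> of the size of \<open>S\<close>, pick an element of
  \<open>Alt D\<close> taking \<open>S\<close> there. Two of these in one coset of \<open>L\<close>
  differ by an element of \<open>L\<close> in \<open>Alt D\<close>, which preserves
  \<open>S\<close>. Only such elements are tested, so that \<open>D\<close> may later omit one or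
  two points of \<Omega>.\<close>

lemma invariant_set_card:
  assumes "finite \<Omega>" "alt_subgroup \<Omega> L" "D \<subseteq> \<Omega>" "S \<subseteq> D" "card D \<ge> 3"
    and stable: "\<And>p. p \<in> L \<Longrightarrow> p \<in> Alt D \<Longrightarrow> p ` S = S"
  shows "(card D choose card S) * card L \<le> card (Alt \<Omega>)"
proof -
  have finD: "finite D" using assms finite_subset by blast
  define Sets where "Sets = {T \<in> Pow D. card T = card S}"
  have "\<exists>g. g \<in> Alt D \<and> g ` S = S'" if "S' \<in> Sets" for S'
    using Alt_homogeneous[OF finD assms(5,4), of S'] that by (auto simp: Sets_def)
  then obtain g where g: "\<And>S'. S' \<in> Sets \<Longrightarrow> g S' \<in> Alt D \<and> g S' ` S = S'" by metis
  have "inj_on g Sets" by (rule inj_onI) (metis g)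
  then have "card (g ` Sets) = card D choose card S"
    using n_subsets[OF finD, of "card S"] by (simp add: card_image Sets_def Pow_def)
  moreover have "card (g ` Sets) * card L \<le> card (Alt \<Omega>)"
  proof (rule transversal_card[OF assms(1,2)])
    show "g ` Sets \<subseteq> Alt \<Omega>" using g Alt_mono[OF assms(3)] by auto
    fix r s assume "r \<in> g ` Sets" "s \<in> g ` Sets" and L: "inv' s \<circ> r \<in> L"
    then obtain A B where AB: "A \<in> Sets" "r = g A" "B \<in> Sets" "s = g B" by auto
    have b: "bij s" "s \<in> Alt D" "r \<in> Alt D" using AB g Alt_bij by blast+
    have "(inv' s \<circ> r) ` S = S"
      using stable[OF L] Alt_comp[OF finD Alt_inv[OF finD b(2)] b(3)] by simp
    then have "s ` S = s ` (inv' s \<circ> r) ` S" by simp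
    also have "\<dots> = r ` S" using b by (auto simp: image_iff bij_is_surj surj_f_inv_f)
    finally show "r = s" using g AB by metis
  qed
  ultimately show ?thesis by simp
qed

text \<open>Composition with a fixed transposition injects the odd permutations into the even
  ones.\<close>

lemma fact_le_card_Alt:
  assumes "finite E" shows "fact (card E) \<le> 2 * card (Alt E)"
proof (cases "\<exists>u\<in>E. \<exists>v\<in>E. u \<noteq> v")
  case True
  then obtain u v where uv: "u \<in> E" "v \<in> E" "u \<noteq> v" by blast
  let ?O = "{p. p permutes E \<and> \<not> evenperm p}"
  have "card ?O \<le> card (Alt E)"
  proof (rule card_inj_on_le[where f = "\<lambda>p. p \<circ> transpose u v"])
    show "inj_on (\<lambda>p. p \<circ> transpose u v) ?O"
      by (rule inj_onI) (metis comp_assoc comp_id transpose_comp_involutory)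
    show "(\<lambda>p. p \<circ> transpose u v) ` ?O \<subseteq> Alt E"
    proof clarify
      fix p assume p: "p permutes E" "\<not> evenperm p"
      have "permutation p" using p assms permutation_permutes by blast
      then show "p \<circ> transpose u v \<in> Alt E"
        using p uv by (auto simp: Alt_def evenperm_comp permutation_swap_id evenperm_swap
            intro!: permutes_compose permutes_swap_id)
    qed
  qed (use assms finite_Alt in auto)
  moreover have "{p. p permutes E} = ?O \<union> Alt E" by (auto simp: Alt_def)
  then have "fact (card E) = card (?O \<union> Alt E)" using card_permutations[OF refl assms] by simp
  then have "fact (card E) \<le> card ?O + card (Alt E)" using card_Un_le by metis
  ultimately show ?thesis by simp
next
  case False
  then have "card E \<le> 1" using card_le_Suc0_iff_eq[OF assms] by auto
  then have "fact (card E) = (1::nat)" by (auto simp: le_Suc_eq)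
  moreover have "card (Alt E) \<ge> 1" using finite_Alt[OF assms] Alt_id by (metis One_nat_def Suc_leI card_gt_0_iff empty_iff)
  ultimately show ?thesis by simp
qed

text \<open>The supports meet in \<open>d\<close> alone. Conjugation by \<open>x\<close> therefore
  only renames \<open>d\<close> to \<open>x d\<close> in the cycles of \<open>y\<close>, and
  multiplying by the inverse of \<open>y\<close> leaves just \<open>d\<close>, \<open>x d\<close>
  and \<open>y d\<close> moved.\<close>

lemma commutator_cyc3:
  assumes x: "x \<in> Alt D" and y: "y \<in> Alt (insert d E)" and "d \<in> D" "D \<inter> E = {}"
    and "x d \<noteq> d" "y d \<noteq> d"
  shows "x \<circ> y \<circ> inv' x \<circ> inv' y = cyc3 d (x d) (y d)" "distinct [d, x d, y d]"
proof -
  have dE: "d \<notin> E" using assms by auto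
  have xD: "x d \<in> D" using Alt_in_image[OF x] assms by simp
  have "y d \<in> insert d E" using Alt_in_image[OF y] by simp
  then have yE: "y d \<in> E" using assms by simp
  show dd: "distinct [d, x d, y d]" using xD yE dE assms by auto
  have bx: "bij x" and b: "bij y" using x y Alt_bij by auto
  have ix: "inv' x u = w \<longleftrightarrow> u = x w" for u w using bx by (metis bij_inv_eq_iff)
  have iy: "inv' y u = w \<longleftrightarrow> u = y w" for u w using b by (metis bij_inv_eq_iff)
  have fx: "x u = u" if "u \<notin> D" for u using Alt_outside[OF x that] .
  have fy: "y u = u" if "u \<notin> E" "u \<noteq> d" for u using Alt_outside[OF y] that by simp
  have ox: "inv' x u = u" if "u \<notin> D" for u using ix fx that by metis
  have oy: "inv' y u = u" if "u \<notin> E" "u \<noteq> d" for u using iy fy that by metis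
  have xin: "inv' x u \<in> D \<longleftrightarrow> u \<in> D" for u using Alt_in_image[OF x] ix by metis
  have yin: "inv' y u \<in> insert d E \<longleftrightarrow> u \<in> insert d E" for u using Alt_in_image[OF y] iy by metis
  have xx: "x (inv' x u) = u" "inv' x (x u) = u" for u using ix by metis+
  have yy: "y (inv' y u) = u" "inv' y (y u) = u" for u using iy by metis+
  show "x \<circ> y \<circ> inv' x \<circ> inv' y = cyc3 d (x d) (y d)"
  proof (rule ext)
    fix z
    have "x (y (inv' x (inv' y z))) = cyc3 d (x d) (y d) z"
    proof (cases "z = d")
      case True
      have "inv' y d \<noteq> d" using iy assms by metis
      then have "inv' y d \<in> E" using yin[of d] by auto
      then have "inv' x (inv' y d) = inv' y d" using ox assms by auto
      then show ?thesis using True dd yy by (simp add: cyc3_apply)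
    next
      case zd: False
      show ?thesis
      proof (cases "z = x d")
        case True
        then have "inv' y z = z" using oy[of z] xD assms zd by auto
        then have "inv' x (inv' y z) = d" using True xx by simp
        moreover have "x (y d) = y d" using fx yE assms by auto
        ultimately show ?thesis using True dd by (auto simp: cyc3_apply)
      next
        case zx: False
        show ?thesis
        proof (cases "z = y d")
          case True
          have 1: "inv' x d \<noteq> d" "inv' x d \<in> D" using ix xin assms by metis+
          then have "y (inv' x d) = inv' x d" using fy assms by auto
          then show ?thesis using True yy(2)[of d] xx(1)[of d] dd by (auto simp: cyc3_apply)
        next
          case zy: False
          show ?thesis
          proof (cases "z \<in> E")
            case True
            then have "inv' y z \<in> insert d E" "inv' y z \<noteq> d" using yin[of z] iy[of z d] zy by auto
            then have "inv' x (inv' y z) = inv' y z" using ox assms by auto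
            moreover have "x z = z" using fx True assms by auto
            ultimately show ?thesis using zd zx zy dd yy by (simp add: cyc3_apply)
          next
            case False
            then have 1: "inv' y z = z" using oy zd by simp
            have "inv' x z \<noteq> d" using ix zx by metis
            moreover have "inv' x z \<notin> E"
            proof
              assume "inv' x z \<in> E"
              then have "x (inv' x z) = inv' x z" using fx assms by auto
              then show False using xx False \<open>inv' x z \<in> E\<close> by simp
            qed
            ultimately have "y (inv' x z) = inv' x z" using fy by simp
            then show ?thesis using 1 zd zx zy dd xx by (simp add: cyc3_apply)
          qed
        qed
      qed
    qed
    then show "(x \<circ> y \<circ> inv' x \<circ> inv' y) z = cyc3 d (x d) (y d) z" by simp
  qed
qed

text \<open>Sized for the next lemma: of two complementary sets in at least 21 points the larger has
  q \<ge> 11 elements, and twice the binomial there is at most (2q)^3.\<close>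

lemma cube_le_fact: "(11::nat) \<le> q \<Longrightarrow> 8 * q ^ 3 \<le> fact q"
proof (induction q rule: dec_induct)
  case base
  show ?case by (simp add: fact_numeral)
next
  case (step q)
  have "8 * Suc q ^ 3 \<le> Suc q * (8 * q ^ 3)"
  proof -
    have "Suc q ^ 2 \<le> q ^ 3"
    proof -
      have "Suc q ^ 2 \<le> (2 * q) ^ 2" using step by (intro power_mono) auto
      also have "\<dots> = 4 * q ^ 2" by (simp add: power2_eq_square)
      also have "\<dots> \<le> q * q ^ 2" using step by (intro mult_right_mono) auto
      also have "\<dots> = q ^ 3" by (simp add: power3_eq_cube power2_eq_square)
      finally show ?thesis .
    qed
    then have "Suc q * (8 * Suc q ^ 2) \<le> Suc q * (8 * q ^ 3)" by (intro mult_left_mono) auto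
    moreover have "8 * Suc q ^ 3 = Suc q * (8 * Suc q ^ 2)"
      by (simp only: power3_eq_cube power2_eq_square mult_ac)
    ultimately show ?thesis by linarith
  qed
  also have "\<dots> \<le> Suc q * fact q" using step by (intro mult_left_mono) auto
  finally show ?case by simp
qed

text \<open>Bochert's argument: a maximal set \<open>E\<close> with \<open>L \<inter> Alt E\<close> trivial cannot be too large, so its
  complement supports a nontrivial element of \<open>L\<close>. Adding a point \<open>d\<close> moved by that element to \<open>E\<close>
  yields two elements of \<open>L\<close> whose supports meet in \<open>d\<close> only.\<close>

lemma small_index_cyc3:
  assumes fin: "finite \<Omega>" and L: "alt_subgroup \<Omega> L" and k: "card \<Omega> \<ge> 21"
    and idx: "card (Alt \<Omega>) < (card \<Omega> choose 3) * card L"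
  shows "\<exists>a b c. distinct [a, b, c] \<and> cyc3 a b c \<in> L"
proof -
  define triv where "triv E \<longleftrightarrow> (\<forall>p\<in>L. p \<in> Alt E \<longrightarrow> p = id)" for E
  have triv_fact: "fact (card E) < 2 * (card \<Omega> choose 3)" if E: "E \<subseteq> \<Omega>" "triv E" for E
  proof -
    have finE: "finite E" using E fin finite_subset by blast
    \<comment> \<open>\<open>Alt E\<close> meets \<open>L\<close> trivially, so its elements
      represent distinct cosets of \<open>L\<close>.\<close>
    have "card (Alt E) * card L \<le> card (Alt \<Omega>)"
    proof (rule transversal_card[OF fin L Alt_mono[OF E(1)]])
      fix r s assume rs: "r \<in> Alt E" "s \<in> Alt E" "inv' s \<circ> r \<in> L"
      then have "inv' s \<circ> r = id" using E(2) Alt_comp[OF finE Alt_inv[OF finE]] by (auto simp: triv_def)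
      then have "s \<circ> (inv' s \<circ> r) = s" by simp
      then show "r = s" using Alt_bij[OF rs(2)] by (simp add: o_assoc bij_is_surj surj_iff[THEN iffD1])
    qed
    then have "card (Alt E) < card \<Omega> choose 3" using idx
      by (metis le_less_trans mult_less_cancel2)
    then show ?thesis using fact_le_card_Alt[OF finE] by linarith
  qed
  have "triv {}" by (simp add: triv_def Alt_def)
  then have "\<exists>E. (E \<subseteq> \<Omega> \<and> triv E) \<and> (\<forall>F. F \<subseteq> \<Omega> \<and> triv F \<longrightarrow> card F \<le> card E)"
    by (intro ex_has_greatest_nat[where k = "{}" and b = "Suc (card \<Omega>)"]) (auto simp: card_mono fin less_Suc_eq_le)
  then obtain E where E: "E \<subseteq> \<Omega>" "triv E" and max: "\<And>F. F \<subseteq> \<Omega> \<Longrightarrow> triv F \<Longrightarrow> card F \<le> card E" by blast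
  have finE: "finite E" using E fin finite_subset by blast
  have "\<not> triv (\<Omega> - E)"
  proof
    assume t: "triv (\<Omega> - E)"
    have sum: "card E + card (\<Omega> - E) = card \<Omega>"
      using card_Diff_subset[OF finE E(1)] card_mono[OF fin E(1)] by simp
    define q where "q = max (card E) (card (\<Omega> - E))"
    have q: "card \<Omega> \<le> 2 * q" "q \<ge> 11" using sum k by (auto simp: q_def)
    have "(fact q::nat) < 2 * (card \<Omega> choose 3)"
      using triv_fact[OF E] triv_fact[of "\<Omega> - E"] t by (auto simp: q_def max_def)
    moreover have "2 * (card \<Omega> choose 3) \<le> 8 * q ^ 3"
    proof -
      have "fact 3 * (card \<Omega> choose 3) \<le> card \<Omega> ^ 3" using binomial_fact_pow[of "card \<Omega>" 3] by (simp add: mult.commute)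
      also have "\<dots> \<le> (2 * q) ^ 3" using q by (intro power_mono) auto
      finally show ?thesis by (simp add: fact_numeral power_mult_distrib)
    qed
    ultimately show False using cube_le_fact[OF q(2)] by linarith
  qed
  then obtain x where x: "x \<in> L" "x \<in> Alt (\<Omega> - E)" "x \<noteq> id" by (auto simp: triv_def)
  then obtain d where d: "x d \<noteq> d" by (auto simp: fun_eq_iff)
  then have dD: "d \<in> \<Omega> - E" using Alt_outside[OF x(2)] by blast
  have "\<not> triv (insert d E)" using max[of "insert d E"] dD E finE by auto
  then obtain y where y: "y \<in> L" "y \<in> Alt (insert d E)" "y \<noteq> id" by (auto simp: triv_def)
  have yd: "y d \<noteq> d"
  proof
    assume "y d = d"
    then have "y \<in> Alt (insert d E - {d})" using y by (subst Alt_Diff_iff) auto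
    then have "y \<in> Alt E" using dD by simp
    then show False using E y by (auto simp: triv_def)
  qed
  have "x \<circ> y \<circ> inv' x \<circ> inv' y \<in> L" using alt_subgroupD[OF L] x y by metis
  moreover have "(\<Omega> - E) \<inter> E = {}" by blast
  ultimately show ?thesis using commutator_cyc3[OF x(2) y(2) dD _ d yd] by metis
qed

text \<open>Unimodality of the binomial coefficients, after reflecting \<open>s\<close> into the
  lower half.\<close>

lemma binomial_ge:
  assumes "m \<le> s" "s + m \<le> n" shows "n choose m \<le> n choose (s::nat)"
proof (cases "2 * s \<le> n")
  case True
  then show ?thesis using binomial_mono[of m s n] assms by simp
next
  case False
  have "n choose s = n choose (n - s)" using assms by (intro binomial_symmetric) auto
  then show ?thesis using binomial_mono[of m "n - s" n] assms False by simp
qed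

text \<open>By Pascal's rule each inequality at the successor is the sum of itself and the one
  before it, so the three are proved in one induction. The start 19 is 21 - 2.\<close>

lemma binomial_shift_le:
  "(19::nat) \<le> j \<Longrightarrow> j + 2 \<le> j choose 2 \<and> j + 2 choose 2 \<le> j choose 3 \<and> j + 2 choose 3 \<le> j choose 4"
proof (induction j rule: dec_induct)
  case base
  show ?case by (simp add: eval_nat_numeral)
next
  case (step j)
  then show ?case by (simp add: eval_nat_numeral)
qed

lemma binomial_4_ge_3: "21 \<le> k \<Longrightarrow> k choose 3 \<le> k - 2 choose 4"
  using binomial_shift_le[of "k - 2"] by (simp add: le_diff_conv2 del: add_2_eq_Suc')

text \<open>\<open>C\<close> is the class of a point moved by a 3-cycle of \<open>L\<close>. If it
  missed more than two points, some set of intermediate size would be preserved by \<open>L\<close>,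
  or by the elements of \<open>L\<close> fixing one or two given points, and counting its translates
  would make the index of \<open>L\<close> too large.\<close>

theorem small_index_alt:
  assumes fin: "finite \<Omega>" and L: "alt_subgroup \<Omega> L" and k: "card \<Omega> \<ge> 21"
    and idx: "card (Alt \<Omega>) < (card \<Omega> choose 3) * card L"
  obtains C where "C \<subseteq> \<Omega>" "card \<Omega> \<le> card C + 2" "Alt C \<subseteq> L" "\<And>p. p \<in> L \<Longrightarrow> p ` C = C"
proof -
  let ?k = "card \<Omega>"
  let ?cl = "cyc3_class L"
  have image: "p ` ?cl x = ?cl (p x)" if "p \<in> L" for p x using cyc3_class_image[OF fin L that] .
  have cl_in: "x \<in> ?cl x" for x using fin L by (simp add: cyc3_class_def)
  have fincl: "finite (?cl x)" if "x \<in> \<Omega>" for x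
    using cyc3_class_subset[OF fin L that] fin finite_subset by blast
  \<comment> \<open>A set preserved by \<open>L\<close> has fewer than three points or misses fewer
    than three.\<close>
  have inv3: "card S < 3 \<or> card S + 3 > ?k" if "S \<subseteq> \<Omega>" "\<And>p. p \<in> L \<Longrightarrow> p ` S = S" for S
  proof (rule ccontr)
    assume "\<not> ?thesis"
    then have "?k choose 3 \<le> ?k choose card S" by (intro binomial_ge) auto
    then have "(?k choose 3) * card L \<le> (?k choose card S) * card L" by (rule mult_right_mono) simp
    also have "\<dots> \<le> card (Alt \<Omega>)" using that k by (intro invariant_set_card[OF fin L]) auto
    finally show False using idx by simp
  qed
  \<comment> \<open>The same for sets preserved by those elements of \<open>L\<close> that fix
    \<open>T\<close> pointwise. Up to two points are lost to \<open>T\<close>, which subsets of size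
    four make up for by \<open>binomial_4_ge_3\<close>.\<close>
  have inv4: "card S < 4 \<or> card S + 4 + card T > ?k"
    if "T \<subseteq> \<Omega>" "card T \<le> 2" "S \<subseteq> \<Omega> - T" "\<And>p. p \<in> L \<Longrightarrow> \<forall>x\<in>T. p x = x \<Longrightarrow> p ` S = S" for S T
  proof (rule ccontr)
    assume n: "\<not> ?thesis"
    have cT: "card (\<Omega> - T) = ?k - card T"
      using that(1) fin by (simp add: card_Diff_subset finite_subset)
    have "?k choose 3 \<le> ?k - 2 choose 4" using binomial_4_ge_3[OF k] .
    also have "\<dots> \<le> ?k - card T choose 4" using that(2) by (intro binomial_right_mono) auto
    also have "\<dots> \<le> ?k - card T choose card S" using n by (intro binomial_ge) auto
    finally have "(?k choose 3) * card L \<le> (card (\<Omega> - T) choose card S) * card L"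
      unfolding cT by (rule mult_right_mono) simp
    also have "\<dots> \<le> card (Alt \<Omega>)"
    proof (rule invariant_set_card[OF fin L _ that(3)])
      show "3 \<le> card (\<Omega> - T)" using cT k that(2) by linarith
      fix p assume "p \<in> L" "p \<in> Alt (\<Omega> - T)"
      then show "p ` S = S" using that(4)[of p] Alt_Diff_iff[OF that(1)] by blast
    qed auto
    finally show False using idx by simp
  qed
  obtain a b c where abc: "distinct [a, b, c]" "cyc3 a b c \<in> L"
    using small_index_cyc3[OF fin L k idx] by blast
  have rel: "cyc3_rel L a b" using abc by (auto simp: cyc3_rel_def)
  then have a: "a \<in> \<Omega>" using cyc3_rel_in[OF fin L] by blast
  have sub: "?cl x \<subseteq> \<Omega>" if "x \<in> \<Omega>" for x using cyc3_class_subset[OF fin L that] .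
  have stab: "p ` (?cl x - {x}) = ?cl x - {x}" if "p \<in> L" "p x = x" for p x
  proof -
    have "inj p" using that(1) alt_subgroupD(1)[OF L] Alt_bij bij_is_inj by blast
    then show ?thesis using image[OF that(1), of x] that(2) by (simp add: image_set_diff)
  qed
  have c3: "card (?cl a) \<ge> 3"
  proof (rule cyc3_class_card[OF fin L _ a])
    show "?cl a \<noteq> {a}" using rel abc fin L by (auto simp: cyc3_class_def)
  qed
  have invC: "p ` ?cl a = ?cl a"
    if p: "p \<in> L" and un: "\<And>b. b \<in> \<Omega> \<Longrightarrow> ?cl b \<noteq> ?cl a \<Longrightarrow> card (?cl b) \<noteq> card (?cl a)" for p
  proof -
    have pA: "p \<in> Alt \<Omega>" using p alt_subgroupD(1)[OF L] by blast
    have "card (p ` ?cl a) = card (?cl a)" "p a \<in> \<Omega>"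
      using a Alt_in_image[OF pA] Alt_inj[OF pA] by (simp_all add: card_image inj_on_def)
    then show ?thesis using un[of "p a"] image[OF p] by metis
  qed
  have big: "card (?cl b) \<noteq> card (?cl a)" if "b \<in> \<Omega>" "?cl b \<noteq> ?cl a" "2 * card (?cl a) > ?k" for b
  proof
    assume eq: "card (?cl b) = card (?cl a)"
    have "?cl a \<inter> ?cl b = {}" using cyc3_class_disjoint[OF fin L] that(2) by metis
    then have "card (?cl a) + card (?cl b) = card (?cl a \<union> ?cl b)"
      using card_Un_disjoint fincl a that(1) by metis
    also have "\<dots> \<le> ?k" using sub a that(1) fin by (intro card_mono) auto
    finally show False using eq that(3) by simp
  qed
  have "?k \<le> card (?cl a) + 2"
  proof (rule ccontr)
    assume small: "\<not> ?thesis"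
    consider "card (?cl a) \<le> 4" | "card (?cl a) \<ge> 5" "card (?cl a) + 4 \<le> ?k" | "card (?cl a) + 3 = ?k"
      using small by linarith
    then show False
    proof cases
      \<comment> \<open>The class is too small to be preserved, so there is a second one of the same
        size. Fixing a point in each preserves both, and together they have at least four further
        points.\<close>
      case 1
      have "\<exists>b\<in>\<Omega>. ?cl b \<noteq> ?cl a \<and> card (?cl b) = card (?cl a)"
      proof (rule ccontr)
        assume n: "\<not> ?thesis"
        have "p ` ?cl a = ?cl a" if "p \<in> L" for p using invC[OF that] n by blast
        then have "card (?cl a) < 3 \<or> card (?cl a) + 3 > ?k"
          using sub[OF a] by (intro inv3)
        then show False using 1 c3 k by linarith
      qed
      then obtain b where b: "b \<in> \<Omega>" "?cl b \<noteq> ?cl a" "card (?cl b) = card (?cl a)" by blast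
      have dis: "?cl a \<inter> ?cl b = {}" using cyc3_class_disjoint[OF fin L] b(2) by metis
      let ?S = "(?cl a - {a}) \<union> (?cl b - {b})"
      have "card ?S = card (?cl a - {a}) + card (?cl b - {b})"
        using dis fincl a b(1) by (intro card_Un_disjoint) auto
      then have cS: "card ?S = 2 * (card (?cl a) - 1)"
        using cl_in b(3) by (simp add: card_Diff_singleton)
      have "card ?S < 4 \<or> card ?S + 4 + card {a, b} > ?k"
      proof (rule inv4)
        show "{a, b} \<subseteq> \<Omega>" "card {a, b} \<le> 2" using a b by (auto simp: card_insert_if)
        show "?S \<subseteq> \<Omega> - {a, b}" using sub a b dis cl_in by blast
        fix p assume "p \<in> L" "\<forall>x\<in>{a, b}. p x = x"
        then show "p ` ?S = ?S" using stab[of p a] stab[of p b] by (simp add: image_Un)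
      qed
      moreover have "card {a, b} \<le> 2" by (simp add: card_insert_if)
      ultimately show False using cS 1 c3 k by linarith
    next
      \<comment> \<open>Fixing \<open>a\<close> preserves the rest of its class, which has at least
        four points.\<close>
      case 2
      have "card (?cl a - {a}) < 4 \<or> card (?cl a - {a}) + 4 + card {a} > ?k"
        using a sub[OF a] stab by (intro inv4) auto
      moreover have "card (?cl a - {a}) = card (?cl a) - 1" using cl_in by (simp add: card_Diff_singleton)
      moreover have "card {a} = 1" by simp
      ultimately show False using 2 by linarith
    next
      \<comment> \<open>A class with more than half of the points is the only one of its size and
        hence preserved.\<close>
      case 3
      then have "2 * card (?cl a) > ?k" using k by linarith
      then have "p ` ?cl a = ?cl a" if "p \<in> L" for p using invC[OF that] big by blast
      then have "card (?cl a) < 3 \<or> card (?cl a) + 3 > ?k"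
        using sub[OF a] by (intro inv3)
      then show False using 3 c3 k by linarith
    qed
  qed
  moreover from this have "2 * card (?cl a) > ?k" using k by linarith
  then have "p ` ?cl a = ?cl a" if "p \<in> L" for p using invC[OF that] big by blast
  ultimately show thesis using that[of "?cl a"] sub[OF a] Alt_cyc3_class[OF fin L] by auto
qed

section \<open>Cocycles with values in a permutation module\<close>

lemma (in group) inv_cancel:
  assumes "x \<in> carrier G" "y \<in> carrier G"
  shows "inv x \<otimes> (x \<otimes> y) = y" "x \<otimes> (inv x \<otimes> y) = y"
  using assms by (simp_all add: m_assoc[symmetric])

text \<open>Rewrites group words to right-nested form and cancels adjacent inverses, so that
  \<open>simp\<close> settles the many word identities below.\<close>

lemmas (in group) group_word = m_assoc inv_mult_group inv_cancel

section \<open>Multiples in an additive group and the coefficient group of prime order\<close>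

primrec nsm :: "nat \<Rightarrow> 'a::ab_group_add \<Rightarrow> 'a" where
  "nsm 0 x = 0"
| "nsm (Suc n) x = x + nsm n x"

lemma nsm_add: "nsm (m + n) x = nsm m x + nsm n x"
  by (induction m) (auto simp: add.assoc)

lemma nsm_mult: "nsm (m * n) x = nsm m (nsm n x)"
  by (induction m) (auto simp: nsm_add)

lemma nsm_zero [simp]: "nsm n 0 = 0"
  by (induction n) auto

lemma nsm_distrib: "nsm n (x + y) = nsm n x + nsm n y"
  by (induction n) (auto simp: algebra_simps)

lemma nsm_minus: "nsm n (- x) = - nsm n x"
  by (induction n) auto

lemma nsm_1 [simp]: "nsm (Suc 0) x = x"
  by simp

lemma sum_const_nsm: "finite S \<Longrightarrow> (\<Sum>i\<in>S. x) = nsm (card S) x"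
  by (induction S rule: finite_induct) auto

lemma nsm_coprime:
  assumes "nsm p x = 0" "nsm q x = 0" "coprime p q" shows "x = 0"
proof (cases "p = 0")
  case True
  then show ?thesis using assms by simp
next
  case False
  then obtain u v where "p * u = q * v + gcd p q" using bezout_nat by blast
  then have "nsm (u * p) x = nsm (v * q) x + x"
    using assms(3) by (simp add: mult.commute nsm_add)
  then show ?thesis using assms by (simp add: nsm_mult)
qed

text \<open>Plays the part of the field with p elements. A subset of an additive group lets p vary
  while the type of the values stays fixed.\<close>

locale prime_order_subgroup =
  fixes p :: nat and A :: "'c::ab_group_add set"
  assumes prime_p: "Factorial_Ring.prime p"
    and A_zero: "0 \<in> A"
    and A_diff: "x \<in> A \<Longrightarrow> y \<in> A \<Longrightarrow> x - y \<in> A"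
    and A_torsion: "x \<in> A \<Longrightarrow> nsm p x = 0"
    and A_cyclic: "x \<in> A \<Longrightarrow> x \<noteq> 0 \<Longrightarrow> y \<in> A \<Longrightarrow> \<exists>n. y = nsm n x"
begin

lemma A_uminus: "x \<in> A \<Longrightarrow> - x \<in> A"
  using A_diff[OF A_zero, of x] by simp

lemma A_add: "x \<in> A \<Longrightarrow> y \<in> A \<Longrightarrow> x + y \<in> A"
  using A_diff[of x "- y"] A_uminus by simp

lemma A_sum: "(\<And>i. i \<in> S \<Longrightarrow> f i \<in> A) \<Longrightarrow> sum f S \<in> A"
  by (induction S rule: infinite_finite_induct) (auto simp: A_zero A_add)

lemma A_nsm: "x \<in> A \<Longrightarrow> nsm n x \<in> A"
  by (induction n) (auto simp: A_zero A_add)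

lemma A_divisible:
  assumes "\<not> p dvd n" "x \<in> A" shows "\<exists>y\<in>A. nsm n y = x"
proof (cases "n = 0")
  case False
  have "coprime n p" using prime_imp_coprime[OF prime_p assms(1)] by (simp add: coprime_commute)
  then obtain u v where "n * u = p * v + 1" using bezout_nat[OF False, of p] by auto
  then have "nsm n (nsm u x) = nsm v (nsm p x) + x"
    by (metis nsm_mult nsm_add nsm_1 One_nat_def mult.commute)
  then show ?thesis using A_torsion[OF assms(2)] A_nsm[OF assms(2)] by auto
qed (use assms in auto)

lemma A_nsm_eq_0: "\<not> p dvd n \<Longrightarrow> x \<in> A \<Longrightarrow> nsm n x = 0 \<Longrightarrow> x = 0"
  using nsm_coprime[OF A_torsion] prime_imp_coprime[OF prime_p] by blast

end

text \<open>An extension of the alternating group on \<Omega>, given by the projection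
  \<open>\<pi>\<close>. Assumption \<open>frattini\<close> says that the kernel has no proper
  supplement, that is, lies in the Frattini subgroup; it is the engine of most proofs below.\<close>

locale alt_ext = group G for G (structure) +
  fixes \<Omega> :: "'i set" and \<pi> :: "'a \<Rightarrow> 'i \<Rightarrow> 'i"
  assumes finG: "finite (carrier G)" and fin\<Omega>: "finite \<Omega>" and card_\<Omega>: "card \<Omega> \<ge> 23"
    and \<pi>_mult: "x \<in> carrier G \<Longrightarrow> y \<in> carrier G \<Longrightarrow> \<pi> (x \<otimes> y) = \<pi> x \<circ> \<pi> y"
    and \<pi>_image: "\<pi> ` carrier G = Alt \<Omega>"
    and frattini: "subgroup K G \<Longrightarrow> \<pi> ` K = Alt \<Omega> \<Longrightarrow> K = carrier G"
begin

definition M where "M = {x \<in> carrier G. \<pi> x = id}"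

definition B where "B T = {x \<in> carrier G. \<forall>i\<in>T. \<pi> x i = i}"

lemma \<pi>_Alt: "x \<in> carrier G \<Longrightarrow> \<pi> x \<in> Alt \<Omega>"
  using \<pi>_image by blast

lemma \<pi>_lift: "g \<in> Alt \<Omega> \<Longrightarrow> \<exists>x\<in>carrier G. \<pi> x = g"
  using \<pi>_image by (metis imageE)

lemma \<pi>_one: "\<pi> \<one> = id"
proof -
  have "\<pi> \<one> \<circ> \<pi> \<one> = \<pi> \<one>" using \<pi>_mult[of \<one> \<one>] by simp
  moreover have "inj (\<pi> \<one>)" using Alt_bij[OF \<pi>_Alt[OF one_closed]] bij_is_inj by blast
  ultimately show ?thesis by (metis comp_apply eq_id_iff injD)
qed

lemma \<pi>_inv_left: "x \<in> carrier G \<Longrightarrow> \<pi> (inv x) (\<pi> x i) = i"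
  using \<pi>_mult[of "inv x" x] \<pi>_one by (metis comp_apply id_apply inv_closed l_inv)

lemma \<pi>_inv_right: "x \<in> carrier G \<Longrightarrow> \<pi> x (\<pi> (inv x) i) = i"
  using \<pi>_mult[of x "inv x"] \<pi>_one by (metis comp_apply id_apply inv_closed r_inv)

lemma \<pi>_inv: "x \<in> carrier G \<Longrightarrow> \<pi> (inv x) = inv' (\<pi> x)"
  by (rule ext) (metis Alt_bij \<pi>_Alt \<pi>_inv_right bij_inv_eq_iff)

lemma \<pi>_mult_apply: "x \<in> carrier G \<Longrightarrow> y \<in> carrier G \<Longrightarrow> \<pi> (x \<otimes> y) i = \<pi> x (\<pi> y i)"
  by (simp add: \<pi>_mult)

lemma \<pi>_in: "x \<in> carrier G \<Longrightarrow> \<pi> x i \<in> \<Omega> \<longleftrightarrow> i \<in> \<Omega>"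
  using Alt_in_image[OF \<pi>_Alt] .

lemma \<pi>_inj: "x \<in> carrier G \<Longrightarrow> \<pi> x i = \<pi> x j \<longleftrightarrow> i = j"
  using Alt_inj[OF \<pi>_Alt] .

lemma B_carrier: "x \<in> B T \<Longrightarrow> x \<in> carrier G" by (simp add: B_def)
lemma B_fix: "x \<in> B T \<Longrightarrow> i \<in> T \<Longrightarrow> \<pi> x i = i" by (simp add: B_def)
lemma M_carrier: "x \<in> M \<Longrightarrow> x \<in> carrier G" by (simp add: M_def)
lemma M_B: "x \<in> M \<Longrightarrow> x \<in> B T" by (simp add: M_def B_def)
lemma \<pi>_M: "x \<in> M \<Longrightarrow> \<pi> x = id" by (simp add: M_def)
lemma B_mono: "T \<subseteq> T' \<Longrightarrow> B T' \<subseteq> B T" by (auto simp: B_def)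
lemma B_empty: "B {} = carrier G" by (simp add: B_def)

lemma B_subgroup: "subgroup (B T) G"
  by (rule subgroupI) (auto simp: B_def \<pi>_mult \<pi>_one intro!: exI[of _ \<one>], metis \<pi>_inv_left)

lemma M_subgroup: "subgroup M G"
  by (rule subgroupI) (auto simp: M_def \<pi>_mult \<pi>_one \<pi>_inv intro!: exI[of _ \<one>])

lemma M_conj: "x \<in> carrier G \<Longrightarrow> m \<in> M \<Longrightarrow> x \<otimes> m \<otimes> inv x \<in> M"
  by (auto simp: M_def \<pi>_mult \<pi>_inv_right fun_eq_iff)

lemma M_conj': "x \<in> carrier G \<Longrightarrow> m \<in> M \<Longrightarrow> inv x \<otimes> m \<otimes> x \<in> M"
  using M_conj[of "inv x" m] by simp

lemma M_mult: "x \<in> M \<Longrightarrow> y \<in> M \<Longrightarrow> x \<otimes> y \<in> M" and M_inv: "x \<in> M \<Longrightarrow> inv x \<in> M" and M_one: "\<one> \<in> M"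
  using M_subgroup by (auto simp: subgroup.m_closed subgroup.m_inv_closed subgroup.one_closed)

lemma B_mult: "x \<in> B T \<Longrightarrow> y \<in> B T \<Longrightarrow> x \<otimes> y \<in> B T" and B_inv: "x \<in> B T \<Longrightarrow> inv x \<in> B T" and B_one: "\<one> \<in> B T"
  using B_subgroup by (auto simp: subgroup.m_closed subgroup.m_inv_closed subgroup.one_closed)

lemma \<pi>_eq_M: "x \<in> carrier G \<Longrightarrow> y \<in> carrier G \<Longrightarrow> \<pi> x = \<pi> y \<Longrightarrow> x \<otimes> inv y \<in> M"
  by (auto simp: M_def \<pi>_mult \<pi>_inv_right fun_eq_iff)

lemma \<pi>_eq_M': "x \<in> carrier G \<Longrightarrow> y \<in> carrier G \<Longrightarrow> \<pi> x = \<pi> y \<Longrightarrow> inv y \<otimes> x \<in> M"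
  by (auto simp: M_def \<pi>_mult \<pi>_inv_left fun_eq_iff)

lemma \<pi>_B: "T \<subseteq> \<Omega> \<Longrightarrow> \<pi> ` B T = Alt (\<Omega> - T)"
  using \<pi>_Alt \<pi>_lift by (auto simp: B_def Alt_Diff_iff image_iff) metis

lemma B_lift: "T \<subseteq> \<Omega> \<Longrightarrow> g \<in> Alt (\<Omega> - T) \<Longrightarrow> \<exists>x\<in>B T. \<pi> x = g"
  using \<pi>_B by (metis imageE)

lemma transitive_lift:
  assumes "S \<subseteq> \<Omega>" "inj_on f S" "f ` S \<subseteq> \<Omega>" "card S + 2 \<le> card \<Omega>"
  shows "\<exists>x\<in>carrier G. \<forall>i\<in>S. \<pi> x i = f i"
  using Alt_extend[OF fin\<Omega> assms] \<pi>_lift by metis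

text \<open>Perfectness of the alternating group: every 3-cycle is the commutator of two 3-cycles
  that share one point, for which five points are enough.\<close>

lemma commutators_cover:
  assumes T: "T \<subseteq> \<Omega>" "card (\<Omega> - T) \<ge> 5"
    and K: "K \<subseteq> B T" "\<one> \<in> K" "\<And>x y. x \<in> K \<Longrightarrow> y \<in> K \<Longrightarrow> x \<otimes> y \<in> K"
    and comm: "\<And>x y. x \<in> B T \<Longrightarrow> y \<in> B T \<Longrightarrow> x \<otimes> y \<otimes> inv x \<otimes> inv y \<in> K"
  shows "\<pi> ` K = Alt (\<Omega> - T)"
proof
  show "\<pi> ` K \<subseteq> Alt (\<Omega> - T)" using K(1) \<pi>_B[OF T(1)] by blast
  show "Alt (\<Omega> - T) \<subseteq> \<pi> ` K"
  proof (rule Alt_generated_by_cyc3)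
    show "finite (\<Omega> - T)" using fin\<Omega> by simp
    show "id \<in> \<pi> ` K" using K(2) \<pi>_one by (metis imageI)
    fix p q assume "p \<in> \<pi> ` K" "q \<in> \<pi> ` K"
    then show "p \<circ> q \<in> \<pi> ` K" using K(1,3) B_carrier \<pi>_mult
      by (smt (verit) imageE imageI subsetD)
  next
    fix a b c assume abc: "a \<in> \<Omega> - T" "b \<in> \<Omega> - T" "c \<in> \<Omega> - T" "distinct [a, b, c]"
    have "card (\<Omega> - T - {a, b, c}) \<ge> 2"
      using abc T(2) fin\<Omega> by (subst card_Diff_subset) auto
    then obtain W where "W \<subseteq> \<Omega> - T - {a, b, c}" "card W = 2"
      using obtain_subset_with_card_n by metis
    then obtain u v where uv: "u \<in> \<Omega> - T - {a, b, c}" "v \<in> \<Omega> - T - {a, b, c}" "u \<noteq> v"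
      by (auto simp: card_2_iff)
    obtain x where x: "x \<in> B T" "\<pi> x = cyc3 a b u"
      using B_lift[OF T(1) cyc3_in_Alt[of a "\<Omega> - T" b u]] abc uv by auto
    obtain y where y: "y \<in> B T" "\<pi> y = cyc3 a c v"
      using B_lift[OF T(1) cyc3_in_Alt[of a "\<Omega> - T" c v]] abc uv by auto
    have "cyc3 a b u \<in> Alt {a, b, u}" "cyc3 a c v \<in> Alt (insert a {c, v})"
      using abc uv by (auto intro!: cyc3_in_Alt)
    then have "cyc3 a b u \<circ> cyc3 a c v \<circ> inv' (cyc3 a b u) \<circ> inv' (cyc3 a c v)
       = cyc3 a (cyc3 a b u a) (cyc3 a c v a)"
      using abc uv by (intro commutator_cyc3(1)) (auto simp: cyc3_apply)
    moreover have "cyc3 a b u a = b" "cyc3 a c v a = c" using abc uv by (auto simp: cyc3_apply)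
    ultimately have "\<pi> (x \<otimes> y \<otimes> inv x \<otimes> inv y) = cyc3 a b c"
      using x y B_carrier by (simp add: \<pi>_mult \<pi>_inv)
    then show "cyc3 a b c \<in> \<pi> ` K" using comm[OF x(1) y(1)] by (metis imageI)
  qed
qed

definition is_hom where "is_hom S \<phi> \<longleftrightarrow> (\<forall>x\<in>S. \<forall>y\<in>S. \<phi> (x \<otimes> y) = \<phi> x + \<phi> y)"

lemma is_homD: "is_hom S \<phi> \<Longrightarrow> x \<in> S \<Longrightarrow> y \<in> S \<Longrightarrow> \<phi> (x \<otimes> y) = \<phi> x + \<phi> y"
  by (simp add: is_hom_def)

lemma hom_one:
  fixes \<phi> :: "'a \<Rightarrow> 'c::ab_group_add"
  assumes "is_hom S \<phi>" "subgroup S G" shows "\<phi> \<one> = 0"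
  using is_homD[OF assms(1), of \<one> \<one>] subgroup.one_closed[OF assms(2)] by simp

lemma hom_inv:
  fixes \<phi> :: "'a \<Rightarrow> 'c::ab_group_add"
  assumes "is_hom S \<phi>" "subgroup S G" "x \<in> S" shows "\<phi> (inv x) = - \<phi> x"
  using is_homD[OF assms(1), of x "inv x"] subgroup.m_inv_closed[OF assms(2,3)] assms
    hom_one[OF assms(1,2)] subgroup.mem_carrier[OF assms(2,3)]
  by (simp add: eq_neg_iff_add_eq_0 add.commute)

lemma hom_kernel_subgroup:
  fixes \<phi> :: "'a \<Rightarrow> 'c::ab_group_add"
  assumes "is_hom S \<phi>" "subgroup S G"
  shows "subgroup {x \<in> S. \<phi> x = 0} G"
proof (rule subgroupI)
  show "{x \<in> S. \<phi> x = 0} \<subseteq> carrier G" using assms(2) subgroup.subset by blast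
  show "{x \<in> S. \<phi> x = 0} \<noteq> {}" using hom_one[OF assms] subgroup.one_closed[OF assms(2)] by blast
qed (use assms hom_inv is_homD subgroup.m_closed subgroup.m_inv_closed in \<open>fastforce+\<close>)

lemma hom_commutator:
  fixes \<phi> :: "'a \<Rightarrow> 'c::ab_group_add"
  assumes "is_hom S \<phi>" "subgroup S G" "x \<in> S" "y \<in> S"
  shows "x \<otimes> y \<otimes> inv x \<otimes> inv y \<in> {x \<in> S. \<phi> x = 0}"
  using assms hom_inv[OF assms(1,2)]
  by (simp add: is_homD subgroup.m_closed subgroup.m_inv_closed)

lemma hom_cover:
  fixes \<phi> :: "'a \<Rightarrow> 'c::ab_group_add"
  assumes "is_hom (B T) \<phi>" "T \<subseteq> \<Omega>" "card (\<Omega> - T) \<ge> 5"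
  shows "\<pi> ` {x \<in> B T. \<phi> x = 0} = Alt (\<Omega> - T)"
proof (rule commutators_cover[OF assms(2,3)])
  have s: "subgroup {x \<in> B T. \<phi> x = 0} G" using hom_kernel_subgroup[OF assms(1) B_subgroup] .
  show "\<one> \<in> {x \<in> B T. \<phi> x = 0}" using subgroup.one_closed[OF s] .
  show "x \<otimes> y \<in> {x \<in> B T. \<phi> x = 0}" if "x \<in> {x \<in> B T. \<phi> x = 0}" "y \<in> {x \<in> B T. \<phi> x = 0}" for x y
    using subgroup.m_closed[OF s that] .
qed (use hom_commutator[OF assms(1) B_subgroup] in auto)

text \<open>The kernel contains all commutators, so by perfectness it covers
  \<open>Alt (\<Omega> - T)\<close>; if it also contains \<open>M\<close>, it is everything.\<close>

lemma hom_trivial: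
  fixes \<phi> :: "'a \<Rightarrow> 'c::ab_group_add"
  assumes "is_hom (B T) \<phi>" "T \<subseteq> \<Omega>" "card (\<Omega> - T) \<ge> 5" "\<And>m. m \<in> M \<Longrightarrow> \<phi> m = 0" "x \<in> B T"
  shows "\<phi> x = 0"
proof -
  have "\<pi> x \<in> Alt (\<Omega> - T)" using \<pi>_B[OF assms(2)] assms(5) by blast
  then obtain y where y: "y \<in> B T" "\<phi> y = 0" "\<pi> x = \<pi> y" using hom_cover[OF assms(1-3)] by (auto simp: set_eq_iff image_iff)
  have m: "x \<otimes> inv y \<in> M" using \<pi>_eq_M y assms(5) B_carrier by blast
  have "\<phi> (x \<otimes> inv y) + \<phi> y = \<phi> x"
    using is_homD[OF assms(1) M_B[OF m] y(1)] y(1) assms(5) B_carrier by (simp add: inv_solve_right m_assoc)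
  then show ?thesis using y assms(4)[OF m] by simp
qed

text \<open>On the whole group the kernel is a supplement of \<open>M\<close>, and
  \<open>frattini\<close> applies.\<close>

lemma hom_carrier_trivial:
  fixes \<phi> :: "'a \<Rightarrow> 'c::ab_group_add"
  assumes "is_hom (carrier G) \<phi>" "x \<in> carrier G"
  shows "\<phi> x = 0"
proof -
  have "\<pi> ` {x \<in> carrier G. \<phi> x = 0} = Alt \<Omega>"
    using hom_cover[of "{}" \<phi>] assms(1) card_\<Omega> by (simp add: B_empty)
  then have "{x \<in> carrier G. \<phi> x = 0} = carrier G"
    using frattini hom_kernel_subgroup[OF assms(1) subgroup_self] by blast
  then show ?thesis using assms(2) by blast
qed

section \<open>Cocycles with values in the functions on a set\<close>

definition acts where
  "acts act I \<longleftrightarrow> (\<forall>x\<in>carrier G. \<forall>i\<in>I. act x i \<in> I) \<and> (\<forall>i\<in>I. \<forall>m\<in>M. act m i = i) \<and>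
    (\<forall>x\<in>carrier G. \<forall>y\<in>carrier G. \<forall>i\<in>I. act (x \<otimes> y) i = act x (act y i))"

text \<open>The value at \<open>x\<close> is the function \<open>\<lambda>i. v i x\<close>; group
  elements act on functions by precomposition with \<open>act\<close>, which is an action from the
  right.\<close>

definition cocycle where
  "cocycle act I v \<longleftrightarrow> (\<forall>x\<in>carrier G. \<forall>y\<in>carrier G. \<forall>i\<in>I. v i (x \<otimes> y) = v (act y i) x + v i y)"

lemma cocycleD: "cocycle act I v \<Longrightarrow> x \<in> carrier G \<Longrightarrow> y \<in> carrier G \<Longrightarrow> i \<in> I \<Longrightarrow>
    v i (x \<otimes> y) = v (act y i) x + v i y"
  by (simp add: cocycle_def)

lemma actsD:
  assumes "acts act I" "i \<in> I"
  shows "x \<in> carrier G \<Longrightarrow> act x i \<in> I" "m \<in> M \<Longrightarrow> act m i = i" "act \<one> i = i"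
    "x \<in> carrier G \<Longrightarrow> y \<in> carrier G \<Longrightarrow> act (x \<otimes> y) i = act x (act y i)"
    "x \<in> carrier G \<Longrightarrow> act (inv x) (act x i) = i" "x \<in> carrier G \<Longrightarrow> act x (act (inv x) i) = i"
proof -
  show *: "x \<in> carrier G \<Longrightarrow> act x i \<in> I" "m \<in> M \<Longrightarrow> act m i = i"
    "x \<in> carrier G \<Longrightarrow> y \<in> carrier G \<Longrightarrow> act (x \<otimes> y) i = act x (act y i)" for x y m
    using assms by (auto simp: acts_def)
  show o: "act \<one> i = i" using *(2) M_one by blast
  show "x \<in> carrier G \<Longrightarrow> act (inv x) (act x i) = i" using *(3)[of "inv x" x] o by simp
  show "x \<in> carrier G \<Longrightarrow> act x (act (inv x) i) = i" using *(3)[of x "inv x"] o by simp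
qed

text \<open>Shapiro's lemma. With \<open>t i\<close> taking \<open>i0\<close> to \<open>i\<close>,
  the element \<open>s i x\<close> of the stabilizer measures by how much
  \<open>x \<otimes> t i\<close> differs from the representative of its coset. All values are values
  of \<open>\<phi>\<close>, so they stay in any set that contains those.\<close>

lemma cocycle_induced:
  fixes \<phi> :: "'a \<Rightarrow> 'c::ab_group_add"
  assumes act: "acts act I" and i0: "i0 \<in> I" and trans: "\<And>i. i \<in> I \<Longrightarrow> \<exists>t\<in>carrier G. act t i0 = i"
    and hom: "is_hom {x \<in> carrier G. act x i0 = i0} \<phi>"
  obtains v where "cocycle act I v" "\<And>x. x \<in> carrier G \<Longrightarrow> act x i0 = i0 \<Longrightarrow> v i0 x = \<phi> x"
    "\<And>i x. i \<in> I \<Longrightarrow> x \<in> carrier G \<Longrightarrow> \<exists>y\<in>carrier G. act y i0 = i0 \<and> v i x = \<phi> y"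
proof -
  \<comment> \<open>The representative of \<open>i0\<close> itself is the unit, so that the cocycle
    extends \<open>\<phi>\<close> exactly and not just up to conjugation.\<close>
  have "\<forall>i\<in>I. \<exists>t. t \<in> carrier G \<and> act t i0 = i \<and> (i = i0 \<longrightarrow> t = \<one>)"
    using trans actsD(3)[OF act i0] by (metis one_closed)
  then obtain t where t: "\<And>i. i \<in> I \<Longrightarrow> t i \<in> carrier G \<and> act (t i) i0 = i" "t i0 = \<one>"
    using i0 by metis
  define s where "s i x = inv (t (act x i)) \<otimes> x \<otimes> t i" for i x
  define v where "v i x = \<phi> (s i x)" for i x
  have sc: "s i x \<in> carrier G" "act (s i x) i0 = i0" if "i \<in> I" "x \<in> carrier G" for i x
  proof -
    have ax: "act x i \<in> I" using actsD(1)[OF act] that by blast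
    show "s i x \<in> carrier G" using t that ax by (simp add: s_def)
    have "act (s i x) i0 = act (inv (t (act x i))) (act x (act (t i) i0))"
      using t that ax actsD(4)[OF act] i0 by (simp add: s_def)
    also have "\<dots> = act (inv (t (act x i))) (act (t (act x i)) i0)"
      using t(1)[OF that(1)] t(1)[OF ax] by simp
    also have "\<dots> = i0" using actsD(5)[OF act i0, of "t (act x i)"] t(1)[OF ax] by blast
    finally show "act (s i x) i0 = i0" .
  qed
  have mult: "s i (x \<otimes> y) = s (act y i) x \<otimes> s i y" if "x \<in> carrier G" "y \<in> carrier G" "i \<in> I" for i x y
  proof -
    have ay: "act y i \<in> I" using actsD(1)[OF act] that by blast
    have ax: "act x (act y i) \<in> I" using actsD(1)[OF act ay] that by blast
    have "t (act y i) \<otimes> (inv (t (act y i)) \<otimes> (y \<otimes> t i)) = y \<otimes> t i"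
      using t ay that by (simp add: m_assoc[symmetric])
    then show ?thesis
      using t ax ay that actsD(4)[OF act that(3)] by (simp add: s_def m_assoc)
  qed
  show thesis
  proof (rule that[of v])
    show "cocycle act I v"
      unfolding cocycle_def v_def using mult sc is_homD[OF hom] actsD(1)[OF act] by auto
    show "v i0 x = \<phi> x" if "x \<in> carrier G" "act x i0 = i0" for x
      using that t by (simp add: v_def s_def)
    show "\<exists>y\<in>carrier G. act y i0 = i0 \<and> v i x = \<phi> y" if "i \<in> I" "x \<in> carrier G" for i x
      using sc[OF that] by (auto simp: v_def)
  qed
qed

lemma cocycle_one:
  fixes v :: "'j \<Rightarrow> 'a \<Rightarrow> 'c::ab_group_add"
  assumes "acts act I" "cocycle act I v" "i \<in> I" shows "v i \<one> = 0"
  using cocycleD[OF assms(2) one_closed one_closed assms(3)] actsD(3)[OF assms(1,3)] by simp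

lemma cocycle_inv:
  fixes v :: "'j \<Rightarrow> 'a \<Rightarrow> 'c::ab_group_add"
  assumes "acts act I" "cocycle act I v" "i \<in> I" "x \<in> carrier G" shows "v (act x i) (inv x) = - v i x"
  using cocycleD[OF assms(2) inv_closed[OF assms(4)] assms(4,3)] cocycle_one[OF assms(1-3)] assms(4)
  by (simp add: eq_neg_iff_add_eq_0)

text \<open>\<open>M\<close> acts trivially, so on \<open>M\<close> the cocycle is a homomorphism;
  this equivariance makes its values there a submodule.\<close>

lemma cocycle_conj:
  fixes v :: "'j \<Rightarrow> 'a \<Rightarrow> 'c::ab_group_add"
  assumes "acts act I" "cocycle act I v" "i \<in> I" "x \<in> carrier G" "m \<in> M"
  shows "v (act x i) (x \<otimes> m \<otimes> inv x) = v i m"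
proof -
  have "v (act x i) (x \<otimes> m \<otimes> inv x) = v i (x \<otimes> m) + v (act x i) (inv x)"
    using cocycleD[OF assms(2), of "x \<otimes> m" "inv x" "act x i"] assms M_carrier
      actsD(1,5)[OF assms(1,3)] by simp
  also have "v i (x \<otimes> m) = v i x + v i m"
    using cocycleD[OF assms(2), of x m i] assms M_carrier actsD(2)[OF assms(1,3)] by simp
  finally show ?thesis using cocycle_inv[OF assms(1-4)] by simp
qed

text \<open>Membership in the submodule of values on \<open>M\<close>. Functions are compared on
  \<open>I\<close> only, as their values elsewhere carry no meaning.\<close>

definition spanM where "spanM I v u \<longleftrightarrow> (\<exists>m\<in>M. \<forall>i\<in>I. u i = v i m)"

lemma spanM_add:
  fixes v :: "'j \<Rightarrow> 'a \<Rightarrow> 'c::ab_group_add"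
  assumes "acts act I" "cocycle act I v" "spanM I v u" "spanM I v w" shows "spanM I v (\<lambda>i. u i + w i)"
proof -
  obtain m n where *: "m \<in> M" "\<forall>i\<in>I. u i = v i m" "n \<in> M" "\<forall>i\<in>I. w i = v i n"
    using assms by (auto simp: spanM_def)
  have "v i (m \<otimes> n) = v i m + v i n" if "i \<in> I" for i
    using cocycleD[OF assms(2), of m n i] that * M_carrier actsD(2)[OF assms(1) that] by simp
  then show ?thesis unfolding spanM_def using * by (intro bexI[of _ "m \<otimes> n"]) (auto simp: M_mult)
qed

lemma spanM_uminus:
  fixes v :: "'j \<Rightarrow> 'a \<Rightarrow> 'c::ab_group_add"
  assumes "acts act I" "cocycle act I v" "spanM I v u" shows "spanM I v (\<lambda>i. - u i)"
proof -
  obtain m where *: "m \<in> M" "\<forall>i\<in>I. u i = v i m" using assms by (auto simp: spanM_def)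
  have "v i (inv m) = - v i m" if "i \<in> I" for i
    using cocycle_inv[OF assms(1,2) that, of m] * M_carrier actsD(2)[OF assms(1) that] by simp
  then show ?thesis unfolding spanM_def using * by (intro bexI[of _ "inv m"]) (auto simp: M_inv)
qed

lemma spanM_diff:
  fixes v :: "'j \<Rightarrow> 'a \<Rightarrow> 'c::ab_group_add"
  assumes "acts act I" "cocycle act I v" "spanM I v u" "spanM I v w" shows "spanM I v (\<lambda>i. u i - w i)"
  using spanM_add[OF assms(1-3) spanM_uminus[OF assms(1,2,4)]] by simp

lemma spanM_zero:
  fixes v :: "'j \<Rightarrow> 'a \<Rightarrow> 'c::ab_group_add"
  assumes "acts act I" "cocycle act I v" shows "spanM I v (\<lambda>i. 0)"
  unfolding spanM_def using cocycle_one[OF assms] M_one by force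

lemma spanM_nsm:
  fixes v :: "'j \<Rightarrow> 'a \<Rightarrow> 'c::ab_group_add"
  assumes "acts act I" "cocycle act I v" "spanM I v u" shows "spanM I v (\<lambda>i. nsm n (u i))"
  by (induction n) (use spanM_zero[OF assms(1,2)] spanM_add[OF assms] in auto)

lemma spanM_sum:
  fixes v :: "'j \<Rightarrow> 'a \<Rightarrow> 'c::ab_group_add"
  assumes "acts act I" "cocycle act I v" "\<And>r. r \<in> R \<Longrightarrow> spanM I v (u r)"
  shows "spanM I v (\<lambda>i. \<Sum>r\<in>R. u r i)"
  using assms(3)
  by (induction R rule: infinite_finite_induct)
     (use spanM_zero[OF assms(1,2)] spanM_add[OF assms(1,2)] in auto)

lemma spanM_cong: "spanM I v u \<Longrightarrow> (\<And>i. i \<in> I \<Longrightarrow> u i = w i) \<Longrightarrow> spanM I v w"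
  by (auto simp: spanM_def)

lemma spanM_act:
  fixes v :: "'j \<Rightarrow> 'a \<Rightarrow> 'c::ab_group_add"
  assumes "acts act I" "cocycle act I v" "spanM I v u" "x \<in> carrier G"
  shows "spanM I v (\<lambda>i. u (act x i))"
proof -
  obtain m where *: "m \<in> M" "\<forall>i\<in>I. u i = v i m" using assms by (auto simp: spanM_def)
  have "v i (inv x \<otimes> m \<otimes> x) = u (act x i)" if "i \<in> I" for i
    using cocycle_conj[OF assms(1,2), of "act x i" "inv x" m] actsD(1,5)[OF assms(1) that] assms(4) * that
    by simp
  then show ?thesis unfolding spanM_def using M_conj'[OF assms(4) *(1)] by force
qed

text \<open>If \<open>m\<close> in \<open>M\<close> has the same value as \<open>x\<close>, then
  \<open>x \<otimes> inv m\<close> is a zero of the cocycle with the same image as \<open>x\<close>.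
  So the zeros cover the alternating group.\<close>

lemma cocycle_vanishes:
  fixes v :: "'j \<Rightarrow> 'a \<Rightarrow> 'c::ab_group_add"
  assumes act: "acts act I" and v: "cocycle act I v" and "\<And>x. x \<in> carrier G \<Longrightarrow> spanM I v (\<lambda>i. v i x)"
    and "x \<in> carrier G" "i \<in> I"
  shows "v i x = 0"
proof -
  define K where "K = {x \<in> carrier G. \<forall>i\<in>I. v i x = 0}"
  have "subgroup K G"
  proof (rule subgroupI)
    show "K \<noteq> {}" using cocycle_one[OF act v] by (auto simp: K_def)
    show "inv x \<in> K" if x: "x \<in> K" for x
    proof -
      have "v i (inv x) = 0" if i: "i \<in> I" for i
        using cocycle_inv[OF act v actsD(1)[OF act i, of "inv x"], of x] actsD(1,6)[OF act i] x by (simp add: K_def)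
      then show ?thesis using x by (simp add: K_def)
    qed
    show "x \<otimes> y \<in> K" if "x \<in> K" "y \<in> K" for x y
      using that cocycleD[OF v] actsD(1)[OF act] by (simp add: K_def)
  qed (auto simp: K_def)
  moreover have "\<pi> ` K = Alt \<Omega>"
  proof
    show "\<pi> ` K \<subseteq> Alt \<Omega>" using \<pi>_Alt by (auto simp: K_def)
    show "Alt \<Omega> \<subseteq> \<pi> ` K"
    proof
      fix g assume "g \<in> Alt \<Omega>"
      then obtain x where x: "x \<in> carrier G" "\<pi> x = g" using \<pi>_lift by blast
      then obtain m where m: "m \<in> M" "\<forall>i\<in>I. v i x = v i m" using assms(3) by (auto simp: spanM_def)
      have "v i (x \<otimes> inv m) = 0" if i: "i \<in> I" for i
      proof -
        have a: "act (inv m) i = i" "act m i = i" using actsD(2)[OF act i] M_inv m by auto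
        have "v i (x \<otimes> inv m) = v i x + v i (inv m)"
          using cocycleD[OF v x(1) _ i, of "inv m"] m M_carrier a by simp
        also have "v i (inv m) = - v i m" using cocycle_inv[OF act v i, of m] m M_carrier a by simp
        finally show ?thesis using m i by simp
      qed
      moreover have "\<pi> (x \<otimes> inv m) = g" using x m M_carrier M_inv \<pi>_M by (simp add: \<pi>_mult)
      ultimately show "g \<in> \<pi> ` K" using x m M_carrier by (auto simp: K_def intro!: image_eqI[of _ _ "x \<otimes> inv m"])
    qed
  qed
  ultimately have "K = carrier G" by (rule frattini)
  then show ?thesis using assms(4,5) by (auto simp: K_def)
qed

end

section \<open>Homomorphisms on the stabilizer of a point\<close>

locale alt_ext_hom = alt_ext G \<Omega> \<pi> + prime_order_subgroup p A
  for G :: "('a, 'b) monoid_scheme" (structure) and \<Omega> :: "'i set" and \<pi> and p and A :: "'c::ab_group_add set" +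
  assumes odd_p: "odd p" and p_\<Omega>: "\<not> p dvd card \<Omega>"
begin

lemma p_not_dvd_2: "\<not> p dvd 2"
proof
  assume "p dvd 2"
  then have "p = 2" using prime_ge_2_nat[OF prime_p] dvd_imp_le[of p 2] by simp
  then show False using odd_p by simp
qed

lemma A_half: "x \<in> A \<Longrightarrow> x + x = 0 \<Longrightarrow> x = 0"
  using A_nsm_eq_0[OF p_not_dvd_2, of x] by (simp add: numeral_2_eq_2)

lemma avoid:
  assumes "length xs < 23" shows "\<exists>x\<in>\<Omega>. x \<notin> set xs"
proof (rule ccontr)
  assume "\<not> ?thesis"
  then have "card \<Omega> \<le> card (set xs)" by (intro card_mono) auto
  then show False using assms card_\<Omega> card_length[of xs] by linarith
qed

lemma avoid_set:
  assumes "finite T" "card T + length xs < 23" shows "\<exists>x\<in>\<Omega>. x \<notin> T \<and> x \<notin> set xs"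
proof -
  obtain ys where ys: "set ys = T" "length ys = card T" using assms(1) finite_distinct_list distinct_card by metis
  then show ?thesis using avoid[of "ys @ xs"] assms(2) by auto
qed

lemma acts_points: "acts \<pi> \<Omega>"
  by (auto simp: acts_def \<pi>_in \<pi>_mult M_def)

lemma B_sing: "{x \<in> carrier G. \<pi> x a = a} = B {a}"
  by (simp add: B_def)

lemma spanM_multiples:
  assumes "acts act I" "cocycle act I v" "x \<in> A" "x \<noteq> 0" "y \<in> A" "spanM I v (\<lambda>i. u i x)"
    and "\<And>n i. i \<in> I \<Longrightarrow> nsm n (u i x) = u i (nsm n x)"
  shows "spanM I v (\<lambda>i. u i y)"
proof -
  obtain n where n: "y = nsm n x" using A_cyclic[OF assms(3-5)] by blast
  show ?thesis
    by (rule spanM_cong[OF spanM_nsm[OF assms(1,2,6), of n]]) (simp add: assms(7) n)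
qed

text \<open>These functions generate all functions of sum zero.\<close>

definition dipole :: "'i \<Rightarrow> 'i \<Rightarrow> 'c \<Rightarrow> 'i \<Rightarrow> 'c" where
  "dipole r s x y = (if y = r then x else if y = s then - x else 0)"

text \<open>If not, the values of the induced cocycle on \<open>M\<close> are all functions of sum
  zero with values in \<open>A\<close>. Every value of the cocycle has sum zero, so
  \<open>cocycle_vanishes\<close> applies without correcting by a coboundary.\<close>

lemma point_hom_vanishes:
  assumes a: "a \<in> \<Omega>" and hom: "is_hom (B {a}) \<phi>" and \<phi>A: "\<And>x. x \<in> B {a} \<Longrightarrow> \<phi> x \<in> A" and m: "m \<in> M"
  shows "\<phi> m = 0"
proof (rule ccontr)
  assume nz: "\<phi> m \<noteq> 0"
  note act = acts_points
  have trans: "\<exists>t\<in>carrier G. \<pi> t a = i" if "i \<in> \<Omega>" for i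
    using transitive_lift[of "{a}" "\<lambda>_. i"] a that card_\<Omega> by auto
  have hom': "is_hom {x \<in> carrier G. \<pi> x a = a} \<phi>" using hom by (simp add: B_sing)
  obtain v where v: "cocycle \<pi> \<Omega> v" and va: "\<And>x. x \<in> carrier G \<Longrightarrow> \<pi> x a = a \<Longrightarrow> v a x = \<phi> x"
    and vS: "\<And>i x. i \<in> \<Omega> \<Longrightarrow> x \<in> carrier G \<Longrightarrow> \<exists>y\<in>carrier G. \<pi> y a = a \<and> v i x = \<phi> y"
    by (rule cocycle_induced[OF act a trans hom'], assumption, rule that)
  have vA: "v i x \<in> A" if "i \<in> \<Omega>" "x \<in> carrier G" for i x
    using vS[OF that] \<phi>A by (auto simp: B_def)
  \<comment> \<open>Summing over all points is invariant under the action and turns the cocycle into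
    a homomorphism.\<close>
  have "is_hom (carrier G) (\<lambda>x. \<Sum>i\<in>\<Omega>. v i x)"
    unfolding is_hom_def
  proof (intro ballI)
    fix x y assume xy: "x \<in> carrier G" "y \<in> carrier G"
    have "\<pi> y permutes \<Omega>" using \<pi>_Alt[OF xy(2)] Alt_permutes by blast
    then have "(\<Sum>i\<in>\<Omega>. v (\<pi> y i) x) = (\<Sum>i\<in>\<Omega>. v i x)"
      using sum.permute[of "\<pi> y" \<Omega> "\<lambda>i. v i x"] by (simp add: comp_def)
    then show "(\<Sum>i\<in>\<Omega>. v i (x \<otimes> y)) = (\<Sum>i\<in>\<Omega>. v i x) + (\<Sum>i\<in>\<Omega>. v i y)"
      using cocycleD[OF v xy] by (simp add: sum.distrib)
  qed
  then have sum0: "(\<Sum>i\<in>\<Omega>. v i x) = 0" if "x \<in> carrier G" for x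
    using hom_carrier_trivial that by blast
  define f where "f i = v i m" for i
  have mc: "m \<in> carrier G" using m M_carrier by blast
  have fa: "f a \<noteq> 0" using va mc \<pi>_M[OF m] nz by (simp add: f_def)
  have spf: "spanM \<Omega> v f" unfolding spanM_def f_def using m by blast
  \<comment> \<open>A constant nonzero \<open>f\<close> has nonzero sum, because p does not divide
    the number of points.\<close>
  have "\<exists>i\<in>\<Omega>. f i \<noteq> f a"
  proof (rule ccontr)
    assume "\<not> ?thesis"
    then have "(\<Sum>i\<in>\<Omega>. f i) = (\<Sum>i\<in>\<Omega>. f a)" by (intro sum.cong) auto
    moreover have "(\<Sum>i\<in>\<Omega>. f i) = 0" using sum0[OF mc] by (simp add: f_def)
    ultimately have "nsm (card \<Omega>) (f a) = 0" using sum_const_nsm[OF fin\<Omega>, of "f a"] by metis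
    then show False using A_nsm_eq_0[OF p_\<Omega>, of "f a"] fa vA[OF a mc] by (simp add: f_def)
  qed
  then obtain j where j: "j \<in> \<Omega>" "f j \<noteq> f a" by blast
  then have "j \<noteq> a" by auto
  obtain l where l: "l \<in> \<Omega>" "l \<notin> {a, j}" using avoid[of "[a, j]"] by auto
  obtain u where u: "u \<in> \<Omega>" "u \<notin> {a, j, l}" using avoid[of "[a, j, l]"] by auto
  obtain w where w: "w \<in> \<Omega>" "w \<notin> {a, j, l, u}" using avoid[of "[a, j, l, u]"] by auto
  have d: "distinct [a, j, l]" "distinct [a, u, w]" using \<open>j \<noteq> a\<close> l u w by auto
  obtain g where g: "g \<in> carrier G" "\<pi> g = cyc3 a j l" using \<pi>_lift[OF cyc3_in_Alt[OF a j(1) l(1) d(1)]] by blast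
  obtain h where h: "h \<in> carrier G" "\<pi> h = cyc3 a u w" using \<pi>_lift[OF cyc3_in_Alt[OF a u(1) w(1) d(2)]] by blast
  \<comment> \<open>\<open>e\<close> lives on \<open>a\<close>, \<open>j\<close>, \<open>l\<close>
    only. Of these points \<open>h\<close> moves just \<open>a\<close>, so the difference with the
    translate by \<open>h\<close> keeps the entry at \<open>a\<close> and its negative at
    \<open>w\<close>.\<close>
  define e where "e i = f i - f (\<pi> g i)" for i
  have spe: "spanM \<Omega> v e"
    unfolding e_def using spanM_diff[OF act v spf spanM_act[OF act v spf g(1)]] .
  define x where "x = e a"
  have x: "x \<noteq> 0" "x \<in> A"
    using j d(1) g a vA mc A_diff by (auto simp: x_def e_def cyc3_apply f_def)
  have "spanM \<Omega> v (\<lambda>i. e i - e (\<pi> h i))"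
    using spanM_diff[OF act v spe spanM_act[OF act v spe h(1)]] .
  then have sp1: "spanM \<Omega> v (dipole a w x)"
    by (rule spanM_cong)
      (use d u w in \<open>auto simp: dipole_def x_def e_def g h cyc3_apply split: if_splits\<close>)
  have sp2: "spanM \<Omega> v (dipole r a y)" if r: "r \<in> \<Omega>" "r \<noteq> a" and y: "y \<in> A" for r y
  proof -
    have "\<exists>t\<in>carrier G. \<forall>i\<in>{r, a}. \<pi> t i = (if i = r then a else w)"
      by (rule transitive_lift) (use r a w card_\<Omega> in \<open>auto simp: inj_on_def\<close>)
    then obtain t where t: "t \<in> carrier G" "\<pi> t r = a" "\<pi> t a = w" using r by auto
    have "dipole a w x (\<pi> t i) = dipole r a x i" for i
      using \<pi>_inj[OF t(1), of i r] \<pi>_inj[OF t(1), of i a] t w by (auto simp: dipole_def)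
    then have "spanM \<Omega> v (dipole r a x)" using spanM_act[OF act v sp1 t(1)] by simp
    moreover have "nsm n (dipole r a x i) = dipole r a (nsm n x) i" for n i
      by (simp add: dipole_def nsm_minus)
    ultimately show ?thesis
      using spanM_multiples[OF act v x(2,1) y, of "\<lambda>i x. dipole r a x i"] by simp
  qed
  have "spanM \<Omega> v (\<lambda>i. v i z)" if z: "z \<in> carrier G" for z
  proof -
    \<comment> \<open>Dipoles against \<open>a\<close> reproduce the values away from
      \<open>a\<close>; the value at \<open>a\<close> comes out right because the sum is
      zero.\<close>
    have "spanM \<Omega> v (\<lambda>i. \<Sum>r\<in>\<Omega> - {a}. dipole r a (v r z) i)"
      by (rule spanM_sum[OF act v]) (use sp2 vA z in auto)
    then show ?thesis
    proof (rule spanM_cong)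
      fix i assume i: "i \<in> \<Omega>"
      show "(\<Sum>r\<in>\<Omega> - {a}. dipole r a (v r z) i) = v i z"
      proof (cases "i = a")
        case True
        have "(\<Sum>r\<in>\<Omega> - {a}. dipole r a (v r z) i) = (\<Sum>r\<in>\<Omega> - {a}. - v r z)"
          using True by (intro sum.cong) (auto simp: dipole_def)
        also have "\<dots> = v a z" using sum0[OF z] sum.remove[OF fin\<Omega> a, of "\<lambda>r. v r z"]
          by (simp add: sum_negf eq_neg_iff_add_eq_0 neg_eq_iff_add_eq_0 add.commute)
        finally show ?thesis using True by simp
      next
        case False
        have "(\<Sum>r\<in>\<Omega> - {a}. dipole r a (v r z) i) = (\<Sum>r\<in>\<Omega> - {a}. if r = i then v r z else 0)"
          using False by (intro sum.cong) (auto simp: dipole_def)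
        also have "\<dots> = v i z" using False i fin\<Omega> by simp
        finally show ?thesis .
      qed
    qed
  qed
  then have "v a m = 0" by (intro cocycle_vanishes[OF act v]) (use mc a in auto)
  then show False using fa by (simp add: f_def)
qed

text \<open>Extends \<open>lm\<close> to be trivial on \<open>K\<close>. Vanishing on the
  intersection of \<open>K\<close> and \<open>M\<close> makes this well defined, invariance under
  \<open>K\<close> makes it multiplicative.\<close>

lemma supplement_hom:
  fixes lm :: "'a \<Rightarrow> 'c"
  assumes K: "subgroup K G" and hom: "is_hom M lm" and S: "\<And>x. x \<in> S \<Longrightarrow> \<exists>k\<in>K. \<exists>m\<in>M. x = k \<otimes> m"
    and inv: "\<And>k m. k \<in> K \<Longrightarrow> m \<in> M \<Longrightarrow> lm (inv k \<otimes> m \<otimes> k) = lm m"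
    and ker: "\<And>m. m \<in> K \<Longrightarrow> m \<in> M \<Longrightarrow> lm m = 0"
  obtains \<Psi> where "\<And>k m. k \<in> K \<Longrightarrow> m \<in> M \<Longrightarrow> \<Psi> (k \<otimes> m) = lm m" "is_hom S \<Psi>"
proof -
  have kc: "k \<in> carrier G" if "k \<in> K" for k using subgroup.mem_carrier[OF K that] .
  define \<Psi> where "\<Psi> x = lm (SOME m. m \<in> M \<and> (\<exists>k\<in>K. x = k \<otimes> m))" for x
  have \<Psi>: "\<Psi> (k \<otimes> m) = lm m" if km: "k \<in> K" "m \<in> M" for k m
  proof -
    define n where "n = (SOME n. n \<in> M \<and> (\<exists>l\<in>K. k \<otimes> m = l \<otimes> n))"
    have "n \<in> M \<and> (\<exists>l\<in>K. k \<otimes> m = l \<otimes> n)" unfolding n_def by (rule someI[of _ m]) (use km in auto)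
    then obtain l where n: "n \<in> M" "l \<in> K" "k \<otimes> m = l \<otimes> n" by blast
    have c: "k \<in> carrier G" "m \<in> carrier G" "l \<in> carrier G" "n \<in> carrier G" using km n kc M_carrier by auto
    have "m \<otimes> inv n = inv k \<otimes> (k \<otimes> m) \<otimes> inv n" using c by (simp add: m_assoc[symmetric])
    also have "\<dots> = inv k \<otimes> l" unfolding n(3) using c by (simp add: m_assoc)
    finally have "m \<otimes> inv n \<in> K" using subgroup.m_closed[OF K] subgroup.m_inv_closed[OF K] km n by simp
    then have "lm (m \<otimes> inv n) = 0" using ker km n M_mult M_inv by blast
    moreover have "lm (m \<otimes> inv n) = lm m + - lm n"
      using is_homD[OF hom km(2) M_inv[OF n(1)]] hom_inv[OF hom M_subgroup n(1)] by simp
    ultimately have "lm n = lm m" by (metis add.right_inverse add_left_cancel add.commute minus_minus eq_neg_iff_add_eq_0)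
    then show ?thesis by (simp add: \<Psi>_def n_def)
  qed
  moreover have "is_hom S \<Psi>"
    unfolding is_hom_def
  proof (intro ballI)
    fix x y assume "x \<in> S" "y \<in> S"
    then obtain k m l n where *: "k \<in> K" "m \<in> M" "x = k \<otimes> m" "l \<in> K" "n \<in> M" "y = l \<otimes> n" using S by meson
    have c: "k \<in> carrier G" "m \<in> carrier G" "l \<in> carrier G" "n \<in> carrier G" using * kc M_carrier by auto
    have m': "inv l \<otimes> m \<otimes> l \<in> M" using M_conj' c * by blast
    have "l \<otimes> (inv l \<otimes> (m \<otimes> l)) = m \<otimes> l" using c by (simp add: m_assoc[symmetric])
    then have "x \<otimes> y = (k \<otimes> l) \<otimes> ((inv l \<otimes> m \<otimes> l) \<otimes> n)"
      unfolding *(3,6) using c by (simp add: m_assoc[symmetric]) (simp add: m_assoc)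
    then have "\<Psi> (x \<otimes> y) = lm ((inv l \<otimes> m \<otimes> l) \<otimes> n)"
      using \<Psi>[OF subgroup.m_closed[OF K *(1,4)] M_mult[OF m' *(5)]] by simp
    also have "\<dots> = lm m + lm n" using is_homD[OF hom m' *(5)] inv[OF *(4,2)] by simp
    finally show "\<Psi> (x \<otimes> y) = \<Psi> x + \<Psi> y" using \<Psi> * by simp
  qed
  ultimately show thesis using that by blast
qed

text \<open>The hypothesis makes \<open>B T / ker lm\<close> a central extension of \<open>Alt (\<Omega> - T)\<close> that splits over the stabilizer
  of \<open>z\<close>. With a splitting \<open>K'\<close> over that stabilizer and a lift \<open>t\<close> of an involution moving \<open>z\<close>, the set
  \<open>K' \<union> K' t K'\<close> is a splitting over \<open>B T\<close>; closure under products reduces to the braid relation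
  \<open>t s t = s t s\<close>, which holds since \<open>t\<close> inverts \<open>(t s)\<^sup>3\<close> and \<open>p\<close> is odd.\<close>

lemma hom_extends:
  fixes lm :: "'a \<Rightarrow> 'c"
  assumes T: "T \<subseteq> \<Omega>" "card T \<le> 5" and z: "z \<in> \<Omega>" "z \<notin> T"
    and lmA: "\<And>m. m \<in> M \<Longrightarrow> lm m \<in> A"
    and inv: "\<And>b m. b \<in> B T \<Longrightarrow> m \<in> M \<Longrightarrow> lm (b \<otimes> m \<otimes> inv b) = lm m"
    and \<psi>: "is_hom (B (insert z T)) \<psi>" and \<psi>A: "\<And>x. x \<in> B (insert z T) \<Longrightarrow> \<psi> x \<in> A"
    and \<psi>lm: "\<And>m. m \<in> M \<Longrightarrow> \<psi> m = lm m"
  shows "\<exists>\<Psi>. is_hom (B T) \<Psi> \<and> (\<forall>x\<in>B T. \<Psi> x \<in> A) \<and> (\<forall>m\<in>M. \<Psi> m = lm m)"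
proof (cases "\<forall>m\<in>M. lm m = 0")
  case True
  then show ?thesis by (intro exI[of _ "\<lambda>_. 0"]) (auto simp: is_hom_def A_zero)
next
  case False
  then obtain m0 where m0: "m0 \<in> M" "lm m0 \<noteq> 0" by blast
  have lm: "is_hom M lm"
    using is_homD[OF \<psi>] \<psi>lm M_B M_mult unfolding is_hom_def by metis
  have surj: "\<exists>m\<in>M. lm m = y" if y: "y \<in> A" for y
  proof -
    have "\<exists>m\<in>M. lm m = nsm n (lm m0)" for n
    proof (induction n)
      case 0
      then show ?case using hom_one[OF lm M_subgroup] M_one by force
    next
      case (Suc n)
      then obtain m where "m \<in> M" "lm m = nsm n (lm m0)" by blast
      then show ?case using is_homD[OF lm m0(1), of m] M_mult[OF m0(1), of m] by (intro bexI[of _ "m0 \<otimes> m"]) auto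
    qed
    then show ?thesis using A_cyclic[OF lmA[OF m0(1)] m0(2) y] by metis
  qed
  define B' where "B' = B (insert z T)"
  define K' where "K' = {x \<in> B'. \<psi> x = 0}"
  have K': "subgroup K' G" unfolding K'_def B'_def by (rule hom_kernel_subgroup[OF \<psi> B_subgroup])
  note K'm = subgroup.m_closed[OF K'] and K'i = subgroup.m_inv_closed[OF K']
  have B'B: "x \<in> B T" if "x \<in> B'" for x using that by (auto simp: B'_def B_def)
  have K'B': "x \<in> B'" if "x \<in> K'" for x using that by (simp add: K'_def)
  have K'B: "x \<in> B T" "x \<in> carrier G" "\<pi> x z = z" if "x \<in> K'" for x
    using B'B[OF K'B'[OF that]] B_carrier K'B'[OF that] B_fix[of x "insert z T" z] by (auto simp: B'_def)
  define J where "J = {m \<in> M. lm m = 0}"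
  have J: "subgroup J G" unfolding J_def by (rule hom_kernel_subgroup[OF lm M_subgroup])
  note Jm = subgroup.m_closed[OF J] and Ji = subgroup.m_inv_closed[OF J]
  have Jc: "x \<in> carrier G" if "x \<in> J" for x using that M_carrier by (simp add: J_def)
  have JK': "x \<in> K'" if "x \<in> J" for x using that \<psi>lm M_B by (simp add: J_def K'_def B'_def)
  have K'J: "x \<in> J" if "x \<in> K'" "x \<in> M" for x using that \<psi>lm by (simp add: J_def K'_def)
  have inv': "lm (inv b \<otimes> m \<otimes> b) = lm m" if "b \<in> B T" "m \<in> M" for b m
    using inv[OF B_inv[OF that(1)] that(2)] B_carrier[OF that(1)] by simp
  have Jconj: "inv b \<otimes> j \<otimes> b \<in> J" if "b \<in> B T" "j \<in> J" for b j
    using inv'[OF that(1)] M_conj'[OF B_carrier[OF that(1)]] that(2) by (simp add: J_def)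
  have adj: "\<exists>k\<in>K'. \<exists>m\<in>M. b = k \<otimes> m" if b: "b \<in> B'" for b
  proof -
    obtain m where m: "m \<in> M" "lm m = \<psi> b" using surj \<psi>A b by (auto simp: B'_def)
    have mB: "m \<in> B'" "inv m \<in> B'" using m M_inv M_B by (auto simp: B'_def)
    have "b \<otimes> inv m \<in> B'" using b mB B_mult by (simp add: B'_def)
    moreover have "\<psi> (b \<otimes> inv m) = 0"
      using is_homD[OF \<psi>, of b "inv m"] hom_inv[OF \<psi> B_subgroup, of m] b mB m \<psi>lm by (simp add: B'_def)
    moreover have "b = (b \<otimes> inv m) \<otimes> m" using b m M_carrier by (simp add: B'_def B_def m_assoc)
    ultimately show ?thesis using m by (auto simp: K'_def)
  qed
  have finT: "finite T" using T fin\<Omega> finite_subset by blast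
  obtain y where y: "y \<in> \<Omega>" "y \<notin> T" "y \<noteq> z" using avoid_set[OF finT, of "[z]"] T(2) by auto
  obtain x where x: "x \<in> \<Omega>" "x \<notin> T" "x \<noteq> z" "x \<noteq> y" using avoid_set[OF finT, of "[z, y]"] T(2) by auto
  \<comment> \<open>Swapping \<open>u\<close> and \<open>w\<close> serves only to make the
    transpositions of \<open>z\<close>, \<open>y\<close> and of \<open>x\<close>, \<open>y\<close>
    even.\<close>
  obtain u where u: "u \<in> \<Omega>" "u \<notin> T" "u \<noteq> z" "u \<noteq> y" "u \<noteq> x"
    using avoid_set[OF finT, of "[z, y, x]"] T(2) by auto
  obtain w where w: "w \<in> \<Omega>" "w \<notin> T" "w \<noteq> z" "w \<noteq> y" "w \<noteq> x" "w \<noteq> u"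
    using avoid_set[OF finT, of "[z, y, x, u]"] T(2) by auto
  define B'' where "B'' = B (insert y (insert z T))"
  have B''B': "b \<in> B'" if "b \<in> B''" for b using that by (auto simp: B'_def B''_def B_def)
  have B''c: "b \<in> carrier G" if "b \<in> B''" for b using that by (auto simp: B''_def B_def)
  have dbl: "transpose a y \<circ> transpose u w \<in> Alt (\<Omega> - T)" if "a \<in> \<Omega> - T" "a \<noteq> y" for a
    using that y u w fin\<Omega> unfolding Alt_def
    by (auto intro!: permutes_compose permutes_swap_id simp: evenperm_comp evenperm_swap permutation_swap_id)
  obtain t0 where t0: "t0 \<in> B T" "\<pi> t0 = transpose z y \<circ> transpose u w"
    using B_lift[OF T(1) dbl[of z]] z y by auto
  note t0c = B_carrier[OF t0(1)]
  have "\<pi> (t0 \<otimes> t0) = id"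
    using t0 t0c z y u w by (simp add: \<pi>_mult fun_eq_iff transpose_def)
  then have t0M: "t0 \<otimes> t0 \<in> M" using t0c by (simp add: M_def)
  \<comment> \<open>Multiplying \<open>t0\<close> by an element of \<open>M\<close> with value
    \<open>c\<close> adds \<open>2c\<close> to the value of its square, so the corrected lift
    \<open>t\<close> squares into the kernel \<open>J\<close>.\<close>
  obtain c where c: "c \<in> A" "nsm 2 c = - lm (t0 \<otimes> t0)"
    using A_divisible[OF p_not_dvd_2, of "- lm (t0 \<otimes> t0)"] lmA[OF t0M] A_uminus by blast
  obtain m1 where m1: "m1 \<in> M" "lm m1 = c" using surj c by blast
  note m1c = M_carrier[OF m1(1)]
  define t where "t = t0 \<otimes> m1"
  have tB: "t \<in> B T" unfolding t_def using B_mult[OF t0(1) M_B[OF m1(1)]] .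
  note tc = B_carrier[OF tB]
  have \<pi>t: "\<pi> t = transpose z y \<circ> transpose u w"
    using t0 t0c m1c \<pi>_M[OF m1(1)] by (simp add: t_def \<pi>_mult)
  have \<pi>ti: "\<pi> (inv t) = transpose z y \<circ> transpose u w"
  proof (rule ext)
    fix i
    have "\<pi> t ((transpose z y \<circ> transpose u w) i) = i" using z y u w by (auto simp: \<pi>t transpose_def)
    then show "\<pi> (inv t) i = (transpose z y \<circ> transpose u w) i" using \<pi>_inv_left[OF tc] by metis
  qed
  have ttJ: "t \<otimes> t \<in> J"
  proof -
    have n: "inv t0 \<otimes> m1 \<otimes> t0 \<in> M" using M_conj'[OF t0c m1(1)] .
    have e: "t \<otimes> t = (t0 \<otimes> t0) \<otimes> ((inv t0 \<otimes> m1 \<otimes> t0) \<otimes> m1)"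
      using t0c m1c by (simp add: t_def group_word)
    have "lm (t \<otimes> t) = lm (t0 \<otimes> t0) + (lm (inv t0 \<otimes> m1 \<otimes> t0) + lm m1)"
      unfolding e using is_homD[OF lm t0M M_mult[OF n m1(1)]] is_homD[OF lm n m1(1)] by simp
    also have "\<dots> = lm (t0 \<otimes> t0) + nsm 2 c" using inv'[OF t0(1) m1(1)] m1 by (simp add: numeral_2_eq_2)
    finally have "lm (t \<otimes> t) = 0" using c by simp
    moreover have "t \<otimes> t \<in> M" unfolding e using M_mult[OF t0M M_mult[OF n m1(1)]] .
    ultimately show ?thesis by (simp add: J_def)
  qed
  have tconj: "t \<otimes> b \<otimes> inv t \<in> B''" "inv t \<otimes> b \<otimes> t \<in> B''" if b: "b \<in> B''" for b
  proof -
    have f: "\<pi> b z = z" "\<pi> b y = y" "\<And>i. i \<in> T \<Longrightarrow> \<pi> b i = i" "b \<in> carrier G"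
      using b by (auto simp: B''_def B_def)
    have \<pi>T: "\<pi> t i = i" "\<pi> (inv t) i = i" if "i \<in> T" for i
      using that z y u w by (auto simp: \<pi>t \<pi>ti transpose_def)
    have \<pi>zy: "\<pi> t z = y" "\<pi> t y = z" "\<pi> (inv t) z = y" "\<pi> (inv t) y = z"
      using z y u w by (auto simp: \<pi>t \<pi>ti transpose_def)
    show "t \<otimes> b \<otimes> inv t \<in> B''" "inv t \<otimes> b \<otimes> t \<in> B''"
      using f \<pi>T \<pi>zy tc by (auto simp: B''_def B_def \<pi>_mult_apply)
  qed
  have cB'': "card (\<Omega> - insert y (insert z T)) \<ge> 5"
  proof -
    have "card (insert y (insert z T)) \<le> 7" using T(2) finT by (simp add: card_insert_if)
    moreover have "card \<Omega> - card (insert y (insert z T)) \<le> card (\<Omega> - insert y (insert z T))"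
      by (rule diff_card_le_card_Diff) (use finT in simp)
    ultimately show ?thesis using card_\<Omega> by linarith
  qed
  have \<psi>t: "\<psi> (t \<otimes> b \<otimes> inv t) = \<psi> b" if b: "b \<in> B''" for b
  proof -
    \<comment> \<open>The two homomorphisms agree on \<open>M\<close>, and a homomorphism that is
      trivial on \<open>M\<close> is trivial, so conjugation by \<open>t\<close> preserves \<psi>
      and hence \<open>K'\<close> on \<open>B''\<close>.\<close>
    have h: "is_hom (B (insert y (insert z T))) (\<lambda>b. \<psi> (t \<otimes> b \<otimes> inv t) - \<psi> b)"
      unfolding is_hom_def B''_def[symmetric]
    proof (intro ballI)
      fix b d assume bd: "b \<in> B''" "d \<in> B''"
      have "t \<otimes> (b \<otimes> d) \<otimes> inv t = (t \<otimes> b \<otimes> inv t) \<otimes> (t \<otimes> d \<otimes> inv t)"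
        using bd B''c tc by (simp add: group_word)
      then show "\<psi> (t \<otimes> (b \<otimes> d) \<otimes> inv t) - \<psi> (b \<otimes> d) = \<psi> (t \<otimes> b \<otimes> inv t) - \<psi> b + (\<psi> (t \<otimes> d \<otimes> inv t) - \<psi> d)"
        using is_homD[OF \<psi>, folded B'_def] tconj bd B''B' by simp
    qed
    have h0: "\<psi> (t \<otimes> m \<otimes> inv t) - \<psi> m = 0" if "m \<in> M" for m
      using inv[OF tB that] \<psi>lm[OF that] \<psi>lm[OF M_conj[OF tc that]] by simp
    have "insert y (insert z T) \<subseteq> \<Omega>" using T z y by blast
    from hom_trivial[OF h this cB'' h0, of b] have "\<psi> (t \<otimes> b \<otimes> inv t) - \<psi> b = 0"
      using b by (simp add: B''_def)
    then show ?thesis by simp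
  qed
  have tK: "t \<otimes> b \<otimes> inv t \<in> K'" "inv t \<otimes> b \<otimes> t \<in> K'" if b: "b \<in> B''" "b \<in> K'" for b
  proof -
    show "t \<otimes> b \<otimes> inv t \<in> K'" using \<psi>t[OF b(1)] b tconj[OF b(1)] B''B' by (simp add: K'_def)
    have "t \<otimes> (inv t \<otimes> b \<otimes> t) \<otimes> inv t = b" using B''c b tc by (simp add: group_word)
    then have "\<psi> (inv t \<otimes> b \<otimes> t) = \<psi> b" using \<psi>t[OF tconj(2)[OF b(1)]] by simp
    then show "inv t \<otimes> b \<otimes> t \<in> K'" using b tconj[OF b(1)] B''B' by (simp add: K'_def)
  qed
  have lift_K': "\<exists>k\<in>K'. \<pi> k = g" if g: "g \<in> Alt (\<Omega> - insert z T)" for g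
  proof -
    obtain b where b: "b \<in> B'" "\<pi> b = g" using B_lift[OF _ g] T z by (auto simp: B'_def)
    then obtain k m where km: "k \<in> K'" "m \<in> M" "b = k \<otimes> m" using adj by blast
    have "\<pi> b = \<pi> k" using km K'B M_carrier \<pi>_M by (simp add: \<pi>_mult)
    then show ?thesis using km b by auto
  qed
  have "transpose x y \<circ> transpose u w \<in> Alt (\<Omega> - insert z T)"
    using z y u w x fin\<Omega> unfolding Alt_def
    by (auto intro!: permutes_compose permutes_swap_id simp: evenperm_comp evenperm_swap permutation_swap_id)
  then obtain s where s: "s \<in> K'" "\<pi> s = transpose x y \<circ> transpose u w" using lift_K' by blast
  note sB = K'B(1)[OF s(1)] and sc = K'B(2)[OF s(1)]
  have "\<pi> (s \<otimes> s) = id" using s sc x y u w by (simp add: \<pi>_mult fun_eq_iff transpose_def)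
  then have ssJ: "s \<otimes> s \<in> J" using sc K'J K'm s by (simp add: M_def)
  define q where "q = t \<otimes> s"
  have qB: "q \<in> B T" unfolding q_def using B_mult[OF tB sB] .
  note qc = B_carrier[OF qB]
  have "\<pi> q = cyc3 y x z"
    using s sc tc x y z u w by (auto simp: q_def \<pi>_mult \<pi>t fun_eq_iff transpose_def cyc3_apply)
  then have "\<pi> (q \<otimes> (q \<otimes> q)) = id"
    using qc x y z by (auto simp: \<pi>_mult fun_eq_iff cyc3_apply)
  then have q3M: "q \<otimes> (q \<otimes> q) \<in> M" using qc by (simp add: M_def)
  have q3J: "q \<otimes> (q \<otimes> q) \<in> J"
  proof -
    define j where "j = (t \<otimes> t) \<otimes> (s \<otimes> s)"
    have jJ: "j \<in> J" unfolding j_def using Jm ttJ ssJ by blast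
    note jc = Jc[OF jJ]
    have j2: "inv q \<otimes> j \<otimes> q \<in> J" "inv (q \<otimes> q) \<otimes> j \<otimes> (q \<otimes> q) \<in> J"
      using Jconj[OF qB jJ] Jconj[OF B_mult[OF qB qB] jJ] by simp_all
    define r where "r = j \<otimes> ((inv q \<otimes> j \<otimes> q) \<otimes> (inv (q \<otimes> q) \<otimes> j \<otimes> (q \<otimes> q)))"
    have rJ: "r \<in> J" unfolding r_def using Jm[OF jJ Jm[OF j2]] .
    \<comment> \<open>Modulo \<open>J\<close> both \<open>t\<close> and \<open>s\<close> are
      involutions, so \<open>t\<close> inverts \<open>q\<close>; the factor \<open>j\<close> keeps
      the exact account.\<close>
    have e: "t \<otimes> q \<otimes> inv t = j \<otimes> inv q" using tc sc by (simp add: j_def q_def group_word)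
    have "t \<otimes> (q \<otimes> (q \<otimes> q)) \<otimes> inv t = (t \<otimes> q \<otimes> inv t) \<otimes> ((t \<otimes> q \<otimes> inv t) \<otimes> (t \<otimes> q \<otimes> inv t))"
      using tc qc by (simp add: group_word)
    also have "\<dots> = r \<otimes> inv (q \<otimes> (q \<otimes> q))"
      unfolding e r_def using jc qc by (simp add: group_word)
    finally have "lm (q \<otimes> (q \<otimes> q)) = lm (r \<otimes> inv (q \<otimes> (q \<otimes> q)))"
      using inv[OF tB q3M] by simp
    also have "\<dots> = - lm (q \<otimes> (q \<otimes> q))"
      using is_homD[OF lm _ M_inv[OF q3M], of r] hom_inv[OF lm M_subgroup q3M] rJ by (simp add: J_def)
    finally have "lm (q \<otimes> (q \<otimes> q)) = 0" using A_half[OF lmA[OF q3M]] by (simp add: eq_neg_iff_add_eq_0)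
    then show ?thesis using q3M by (simp add: J_def)
  qed
  define DC where "DC = {k \<otimes> t \<otimes> l |k l. k \<in> K' \<and> l \<in> K'}"
  have DCI: "k \<otimes> t \<otimes> l \<in> DC" if "k \<in> K'" "l \<in> K'" for k l using that by (auto simp: DC_def)
  have DCE: "\<exists>k\<in>K'. \<exists>l\<in>K'. x = k \<otimes> t \<otimes> l" if "x \<in> DC" for x using that by (auto simp: DC_def)
  have DCc: "x \<in> carrier G" if "x \<in> DC" for x using DCE[OF that] K'B tc by auto
  have DC_left: "k \<otimes> x \<in> DC" if kx: "k \<in> K'" "x \<in> DC" for k x
  proof -
    obtain l1 l2 where l: "l1 \<in> K'" "l2 \<in> K'" "x = l1 \<otimes> t \<otimes> l2" using DCE[OF kx(2)] by blast
    have "k \<otimes> x = (k \<otimes> l1) \<otimes> t \<otimes> l2" using l kx K'B tc by (simp add: group_word)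
    then show ?thesis using DCI[OF K'm[OF kx(1) l(1)] l(2)] by simp
  qed
  have DC_right: "x \<otimes> k \<in> DC" if kx: "k \<in> K'" "x \<in> DC" for k x
  proof -
    obtain l1 l2 where l: "l1 \<in> K'" "l2 \<in> K'" "x = l1 \<otimes> t \<otimes> l2" using DCE[OF kx(2)] by blast
    have "x \<otimes> k = l1 \<otimes> t \<otimes> (l2 \<otimes> k)" using l kx K'B tc by (simp add: group_word)
    then show ?thesis using DCI[OF l(1) K'm[OF l(2) kx(1)]] by simp
  qed
  have tst: "t \<otimes> s \<otimes> t \<in> DC"
  proof -
    \<comment> \<open>Solved from the cube of \<open>q\<close>, which lies in \<open>J\<close>;
      apart from \<open>t\<close> all factors are in \<open>K'\<close>.\<close>
    have "t \<otimes> s \<otimes> t = ((q \<otimes> (q \<otimes> q)) \<otimes> (inv s \<otimes> inv (t \<otimes> t))) \<otimes> t \<otimes> inv s"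
      using tc sc by (simp add: q_def group_word)
    then show ?thesis using DCI K'm K'i s(1) JK'[OF q3J] JK'[OF Ji[OF ttJ]] by simp
  qed
  have tkt: "t \<otimes> k \<otimes> t \<in> K' \<union> DC" if k: "k \<in> K'" for k
  proof (cases "\<pi> k y = y")
    case True
    then have "k \<in> B''" using K'B'[OF k] by (auto simp: B'_def B''_def B_def)
    then have "t \<otimes> k \<otimes> inv t \<in> K'" using tK k by blast
    then have "(t \<otimes> k \<otimes> inv t) \<otimes> (t \<otimes> t) \<in> K'" using K'm JK'[OF ttJ] by blast
    moreover have "(t \<otimes> k \<otimes> inv t) \<otimes> (t \<otimes> t) = t \<otimes> k \<otimes> t" using tc K'B(2)[OF k] by (simp add: group_word)
    ultimately show ?thesis by simp
  next
    case False
    note kc = K'B(2)[OF k]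
    let ?y = "\<pi> k y"
    have ky: "?y \<in> \<Omega> - insert y (insert z T)"
    proof -
      have "?y \<noteq> z" using \<pi>_inj[OF kc, of y z] K'B(3)[OF k] y by metis
      moreover have "?y \<notin> T"
      proof
        assume "?y \<in> T"
        then have "\<pi> k ?y = ?y" using B_fix[OF K'B(1)[OF k]] by blast
        then show False using \<pi>_inj[OF kc] False by blast
      qed
      ultimately show ?thesis using False \<pi>_in[OF kc] y by blast
    qed
    \<comment> \<open>Writes \<open>k\<close> as \<open>k1 \<otimes> s \<otimes> k2\<close> with
      \<open>k1\<close>, \<open>k2\<close> fixing \<open>y\<close>: \<open>k1\<close> takes
      \<open>x\<close> to the image of \<open>y\<close> under \<open>k\<close>, and \<open>s\<close>
      takes \<open>y\<close> to \<open>x\<close>. Conjugation by \<open>t\<close> then keeps the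
      outer factors in \<open>K'\<close>.\<close>
    have "\<exists>g\<in>Alt (\<Omega> - insert y (insert z T)). \<forall>i\<in>{x}. g i = ?y"
      by (rule Alt_extend) (use fin\<Omega> x ky cB'' in auto)
    then obtain g where g: "g \<in> Alt (\<Omega> - insert y (insert z T))" "g x = ?y" by blast
    have "g \<in> Alt (\<Omega> - insert z T)" using g(1) Alt_mono[of "\<Omega> - insert y (insert z T)"] by blast
    then obtain k1 where k1: "k1 \<in> K'" "\<pi> k1 = g" using lift_K' by blast
    have gy: "g y = y" using Alt_outside[OF g(1), of y] by simp
    have k1B: "k1 \<in> B''" using K'B'[OF k1(1)] k1(2) gy by (auto simp: B'_def B''_def B_def)
    define k2 where "k2 = inv s \<otimes> (inv k1 \<otimes> k)"
    have k2: "k2 \<in> K'" unfolding k2_def using K'm K'i s k1 k by blast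
    have k1c: "k1 \<in> carrier G" using K'B k1 by blast
    have "\<pi> (inv k1) ?y = x" using \<pi>_inv_left[OF k1c, of x] g k1 by simp
    moreover have "\<pi> (inv s) x = y"
    proof -
      have "\<pi> s y = x" using s x y u w by (simp add: transpose_def)
      then show ?thesis using \<pi>_inv_left[OF sc, of y] by simp
    qed
    ultimately have "\<pi> k2 y = y" using sc k1c kc by (simp add: k2_def \<pi>_mult_apply)
    then have k2B: "k2 \<in> B''" using K'B'[OF k2] by (auto simp: B'_def B''_def B_def)
    have "t \<otimes> k \<otimes> t = (t \<otimes> k1 \<otimes> inv t) \<otimes> ((t \<otimes> s \<otimes> t) \<otimes> (inv t \<otimes> k2 \<otimes> t))"
      using tc sc k1c kc by (simp add: k2_def group_word)
    also have "\<dots> \<in> DC" using DC_left[OF tK(1)[OF k1B k1(1)] DC_right[OF tK(2)[OF k2B k2] tst]] .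
    finally show ?thesis by simp
  qed
  define K where "K = K' \<union> DC"
  have K'K: "k \<otimes> x \<in> K" "x \<otimes> k \<in> K" if "k \<in> K'" "x \<in> K" for k x
    using that K'm DC_left DC_right by (auto simp: K_def)
  have KG: "subgroup K G"
  proof (rule subgroupI)
    show "K \<subseteq> carrier G" using K'B DCc by (auto simp: K_def)
    show "K \<noteq> {}" using subgroup.one_closed[OF K'] by (auto simp: K_def)
    show "inv x \<in> K" if xK: "x \<in> K" for x
    proof (cases "x \<in> K'")
      case False
      then have "x \<in> DC" using xK by (simp add: K_def)
      then obtain k l where kl: "k \<in> K'" "l \<in> K'" "x = k \<otimes> t \<otimes> l" using DCE by blast
      have "inv x = (inv l \<otimes> inv (t \<otimes> t)) \<otimes> t \<otimes> inv k"
        using kl tc K'B by (simp add: group_word)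
      then show ?thesis using DCI K'm K'i kl JK'[OF Ji[OF ttJ]] by (simp add: K_def)
    qed (use K'i in \<open>simp add: K_def\<close>)
    show "a \<otimes> b \<in> K" if ab: "a \<in> K" "b \<in> K" for a b
    proof (cases "a \<in> K' \<or> b \<in> K'")
      case False
      then have "a \<in> DC" "b \<in> DC" using ab by (auto simp: K_def)
      then obtain k l k' l' where kl: "k \<in> K'" "l \<in> K'" "a = k \<otimes> t \<otimes> l" "k' \<in> K'" "l' \<in> K'" "b = k' \<otimes> t \<otimes> l'"
        using DCE by meson
      have "a \<otimes> b = k \<otimes> ((t \<otimes> (l \<otimes> k') \<otimes> t) \<otimes> l')" using kl tc K'B by (simp add: group_word)
      moreover have "t \<otimes> (l \<otimes> k') \<otimes> t \<in> K" using tkt[OF K'm[OF kl(2,4)]] by (simp add: K_def)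
      ultimately show ?thesis using K'K kl by simp
    qed (use K'K ab in auto)
  qed
  have KM: "lm m = 0" if m: "m \<in> K" "m \<in> M" for m
  proof (cases "m \<in> K'")
    case True
    then show ?thesis using K'J m by (simp add: J_def)
  next
    case False
    then have "m \<in> DC" using m by (simp add: K_def)
    then obtain k l where kl: "k \<in> K'" "l \<in> K'" "m = k \<otimes> t \<otimes> l" using DCE by blast
    \<comment> \<open>Elements of \<open>DC\<close> move \<open>z\<close>, elements of
      \<open>M\<close> do not, so passing from \<open>K'\<close> to \<open>K\<close> adds nothing to
      the intersection with \<open>M\<close>.\<close>
    have "\<pi> m z = \<pi> k (\<pi> t (\<pi> l z))" using kl K'B tc by (simp add: \<pi>_mult_apply)
    also have "\<dots> = \<pi> k y" using K'B(3)[OF kl(2)] z y u w by (simp add: \<pi>t transpose_def)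
    finally have "\<pi> k y = \<pi> k z" using \<pi>_M[OF m(2)] K'B(3)[OF kl(1)] by simp
    then show ?thesis using \<pi>_inj[OF K'B(2)[OF kl(1)]] y by blast
  qed
  have cover: "\<exists>k\<in>K. \<exists>m\<in>M. b = k \<otimes> m" if b: "b \<in> B T" for b
  proof (cases "\<pi> b z = z")
    case True
    then have "b \<in> B'" using b by (simp add: B'_def B_def)
    then show ?thesis using adj[of b] unfolding K_def by blast
  next
    case False
    note bc = B_carrier[OF b]
    let ?z = "\<pi> b z"
    have bz: "?z \<in> \<Omega> - insert z T"
    proof -
      have "?z \<notin> T"
      proof
        assume "?z \<in> T"
        then have "\<pi> b ?z = ?z" using B_fix[OF b] by blast
        then show False using \<pi>_inj[OF bc] False by blast
      qed
      then show ?thesis using False \<pi>_in[OF bc] z by blast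
    qed
    have "card (\<Omega> - insert y (insert z T)) \<le> card (\<Omega> - insert z T)"
      by (rule card_mono) (use fin\<Omega> in auto)
    then have "\<exists>g\<in>Alt (\<Omega> - insert z T). \<forall>i\<in>{y}. g i = ?z"
      by (intro Alt_extend) (use fin\<Omega> y bz cB'' in auto)
    then obtain k1 where k1: "k1 \<in> K'" "\<pi> k1 y = ?z" using lift_K' by blast
    have k1c: "k1 \<in> carrier G" using K'B k1 by blast
    define c where "c = inv t \<otimes> (inv k1 \<otimes> b)"
    have "\<pi> (inv k1) ?z = y" using \<pi>_inv_left[OF k1c, of y] k1 by simp
    then have "\<pi> c z = z" using tc k1c bc z y u w by (simp add: c_def \<pi>_mult_apply \<pi>ti transpose_def)
    moreover have "c \<in> B T" unfolding c_def using B_mult B_inv tB K'B(1)[OF k1(1)] b by blast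
    ultimately have "c \<in> B'" by (simp add: B'_def B_def)
    then obtain k2 m where k2: "k2 \<in> K'" "m \<in> M" "c = k2 \<otimes> m" using adj by blast
    have "b = k1 \<otimes> t \<otimes> c" using tc k1c bc by (simp add: c_def group_word)
    then have "b = (k1 \<otimes> t \<otimes> k2) \<otimes> m" using k2 K'B M_carrier tc k1c by (simp add: group_word)
    then show ?thesis using DCI[OF k1(1) k2(1)] k2(2) unfolding K_def by blast
  qed
  have KB: "k \<in> B T" if k: "k \<in> K" for k
  proof (cases "k \<in> K'")
    case False
    then have "k \<in> DC" using k by (simp add: K_def)
    then obtain k1 k2 where "k1 \<in> K'" "k2 \<in> K'" "k = k1 \<otimes> t \<otimes> k2" using DCE by blast
    then show ?thesis using K'B(1) B_mult tB by simp
  qed (rule K'B(1))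
  obtain \<Psi> where \<Psi>: "\<And>k m. k \<in> K \<Longrightarrow> m \<in> M \<Longrightarrow> \<Psi> (k \<otimes> m) = lm m" "is_hom (B T) \<Psi>"
    using supplement_hom[OF KG lm cover inv'[OF KB] KM] by blast
  show ?thesis
  proof (intro exI[of _ \<Psi>] conjI ballI)
    show "\<Psi> b \<in> A" if "b \<in> B T" for b using cover[OF that] \<Psi>(1) lmA by auto
    show "\<Psi> m = lm m" if "m \<in> M" for m
      using \<Psi>(1)[OF subgroup.one_closed[OF KG] that] M_carrier[OF that] by simp
  qed (rule \<Psi>(2))
qed

section \<open>Homomorphisms on the stabilizer of two points\<close>

definition pairs where "pairs = {(i, j). i \<in> \<Omega> \<and> j \<in> \<Omega> \<and> i \<noteq> j}"

definition pact where "pact x = map_prod (\<pi> x) (\<pi> x)"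

lemma pact_apply [simp]: "pact x (i, j) = (\<pi> x i, \<pi> x j)"
  by (simp add: pact_def)

lemma pairs_iff [simp]: "(i, j) \<in> pairs \<longleftrightarrow> i \<in> \<Omega> \<and> j \<in> \<Omega> \<and> i \<noteq> j"
  by (simp add: pairs_def)

lemma acts_pairs: "acts pact pairs"
  unfolding acts_def by (auto simp: \<pi>_in \<pi>_inj \<pi>_mult_apply \<pi>_M pairs_def)

definition rows :: "('i \<times> 'i \<Rightarrow> 'c) \<Rightarrow> 'i \<Rightarrow> 'c" where
  "rows F i = (\<Sum>j\<in>\<Omega> - {i}. F (i, j))"

lemma rows_diff: "rows (\<lambda>e. F e - H e) i = rows F i - rows H i"
  by (simp add: rows_def sum_subtractf)

lemma rows_pact:
  assumes "x \<in> carrier G" shows "rows (\<lambda>e. F (pact x e)) i = rows F (\<pi> x i)"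
proof -
  have "bij_betw (\<pi> x) (\<Omega> - {i}) (\<Omega> - {\<pi> x i})"
  proof (rule bij_betwI')
    fix y assume y: "y \<in> \<Omega> - {\<pi> x i}"
    have e: "\<pi> x (\<pi> (inv x) y) = y" using \<pi>_inv_right[OF assms] .
    show "\<exists>z\<in>\<Omega> - {i}. y = \<pi> x z"
    proof (rule bexI)
      show "y = \<pi> x (\<pi> (inv x) y)" using e by simp
      have "\<pi> (inv x) y \<noteq> i"
      proof
        assume "\<pi> (inv x) y = i"
        then have "\<pi> x i = y" using e by simp
        then show False using y by simp
      qed
      then show "\<pi> (inv x) y \<in> \<Omega> - {i}" using y \<pi>_in[of "inv x" y] assms by blast
    qed
  next
    show "\<pi> x y \<in> \<Omega> - {\<pi> x i}" if "y \<in> \<Omega> - {i}" for y using that \<pi>_in[OF assms, of y] \<pi>_inj[OF assms, of y i] by blast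
  qed (rule \<pi>_inj[OF assms])
  from sum.reindex_bij_betw[OF this, of "\<lambda>j. F (\<pi> x i, j)"] show ?thesis by (simp add: rows_def)
qed

text \<open>Row sums form a cocycle on single points. On the stabilizer of \<open>i\<close> its
  coordinate at \<open>i\<close> is a homomorphism, which vanishes by the one-point case and
  perfectness. By Shapiro's lemma the cocycle is a coboundary; \<open>c\<close> reads off its values
  on coset representatives.\<close>

lemma cocycle_rows:
  assumes w: "cocycle pact pairs w" and wA: "\<And>e x. e \<in> pairs \<Longrightarrow> x \<in> carrier G \<Longrightarrow> w e x \<in> A"
  shows "\<exists>c. (\<forall>i\<in>\<Omega>. c i \<in> A) \<and> (\<forall>x\<in>carrier G. \<forall>i\<in>\<Omega>. rows (\<lambda>e. w e x) i = c (\<pi> x i) - c i)"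
proof -
  define R where "R i x = rows (\<lambda>e. w e x) i" for i x
  have R: "R i (x \<otimes> y) = R (\<pi> y i) x + R i y" if "x \<in> carrier G" "y \<in> carrier G" "i \<in> \<Omega>" for i x y
  proof -
    have "R i (x \<otimes> y) = (\<Sum>j\<in>\<Omega> - {i}. w (pact y (i, j)) x + w (i, j) y)"
      unfolding R_def rows_def using that by (intro sum.cong) (auto simp: cocycleD[OF w])
    also have "\<dots> = rows (\<lambda>e. w (pact y e) x) i + R i y" by (simp add: rows_def R_def sum.distrib)
    also have "rows (\<lambda>e. w (pact y e) x) i = R (\<pi> y i) x"
      using rows_pact[OF that(2), of "\<lambda>e. w e x" i] by (simp add: R_def)
    finally show ?thesis .
  qed
  have RA: "R i x \<in> A" if "x \<in> carrier G" "i \<in> \<Omega>" for i x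
    unfolding R_def rows_def using that by (intro A_sum wA) auto
  have hom: "is_hom (B {i}) (R i)" if "i \<in> \<Omega>" for i
    unfolding is_hom_def using R that by (auto simp: B_def)
  have R0: "R i x = 0" if i: "i \<in> \<Omega>" and x: "x \<in> B {i}" for i x
  proof (rule hom_trivial[OF hom[OF i] _ _ _ x])
    show "5 \<le> card (\<Omega> - {i})" using card_\<Omega> i fin\<Omega> by simp
    show "R i m = 0" if "m \<in> M" for m
      using point_hom_vanishes[OF i hom[OF i] _ that] RA i B_carrier by blast
  qed (use i in auto)
  obtain a where a: "a \<in> \<Omega>" using avoid[of "[]"] by auto
  have "\<exists>t\<in>carrier G. \<forall>j\<in>{a}. \<pi> t j = i" if "i \<in> \<Omega>" for i
    using transitive_lift[of "{a}" "\<lambda>_. i"] a that card_\<Omega> by auto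
  then have "\<exists>t. t \<in> carrier G \<and> \<pi> t a = i" if "i \<in> \<Omega>" for i using that by blast
  then obtain t where t: "\<And>i. i \<in> \<Omega> \<Longrightarrow> t i \<in> carrier G \<and> \<pi> (t i) a = i" by metis
  have "R i x = R a (t (\<pi> x i)) - R a (t i)" if x: "x \<in> carrier G" and i: "i \<in> \<Omega>" for x i
  proof -
    have xi: "\<pi> x i \<in> \<Omega>" using \<pi>_in[OF x] i by simp
    \<comment> \<open>The part of \<open>x \<otimes> t i\<close> in the stabilizer of
      \<open>a\<close>, where the coordinate at \<open>a\<close> is zero.\<close>
    define g where "g = inv (t (\<pi> x i)) \<otimes> (x \<otimes> t i)"
    have gB: "g \<in> B {a}"
      using t[OF i] t[OF xi] x \<pi>_inv_left[of "t (\<pi> x i)" a] by (simp add: g_def B_def \<pi>_mult_apply)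
    have "x \<otimes> t i = t (\<pi> x i) \<otimes> g" using t[OF i] t[OF xi] x by (simp add: g_def inv_cancel)
    then have "R a (x \<otimes> t i) = R a (t (\<pi> x i)) + R a g"
      using R[of "t (\<pi> x i)" g a] t[OF xi] a gB by (simp add: B_def)
    then show ?thesis using R[OF x _ a, of "t i"] t[OF i] R0[OF a gB] by (simp add: algebra_simps)
  qed
  then have "\<forall>x\<in>carrier G. \<forall>i\<in>\<Omega>. rows (\<lambda>e. w e x) i = R a (t (\<pi> x i)) - R a (t i)"
    by (simp add: R_def)
  moreover have "\<forall>i\<in>\<Omega>. R a (t i) \<in> A" using RA a t by blast
  ultimately show ?thesis by (intro exI[of _ "\<lambda>i. R a (t i)"] conjI)
qed

lemma cocycle_rows_M:
  assumes "cocycle pact pairs w" "\<And>e x. e \<in> pairs \<Longrightarrow> x \<in> carrier G \<Longrightarrow> w e x \<in> A" "m \<in> M" "i \<in> \<Omega>"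
  shows "rows (\<lambda>e. w e m) i = 0"
proof -
  have "\<exists>c. (\<forall>i\<in>\<Omega>. c i \<in> A) \<and> (\<forall>x\<in>carrier G. \<forall>i\<in>\<Omega>. rows (\<lambda>e. w e x) i = c (\<pi> x i) - c i)"
    by (rule cocycle_rows[OF assms(1)]) (rule assms(2))
  then obtain c where c: "\<forall>x\<in>carrier G. \<forall>i\<in>\<Omega>. rows (\<lambda>e. w e x) i = c (\<pi> x i) - c i"
    by (elim exE conjE) (rule that)
  show ?thesis using c[rule_format, OF M_carrier[OF assms(3)] assms(4)] \<pi>_M[OF assms(3)] by simp
qed

end

text \<open>\<open>\<sigma>\<close> is the sign under which functions on ordered pairs of points behave when the points are swapped.\<close>

locale signed_pairs = alt_ext_hom G \<Omega> \<pi> p A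
  for G :: "('a, 'b) monoid_scheme" (structure) and \<Omega> :: "'i set" and \<pi> and p and A :: "'c::ab_group_add set" +
  fixes \<sigma> :: "'c \<Rightarrow> 'c" and w :: "'i \<times> 'i \<Rightarrow> 'a \<Rightarrow> 'c"
  assumes \<sigma>_cases: "\<sigma> = (\<lambda>x. x) \<or> \<sigma> = uminus"
    and w: "cocycle pact pairs w" and wA: "e \<in> pairs \<Longrightarrow> x \<in> carrier G \<Longrightarrow> w e x \<in> A"
    and w_swap: "(i, j) \<in> pairs \<Longrightarrow> x \<in> carrier G \<Longrightarrow> w (j, i) x = \<sigma> (w (i, j) x)"
begin

lemma \<sigma>_simps [simp]: "\<sigma> (\<sigma> x) = x" "\<sigma> 0 = 0" "\<sigma> (- x) = - \<sigma> x" "\<sigma> (x - y) = \<sigma> x - \<sigma> y" "\<sigma> x = 0 \<longleftrightarrow> x = 0"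
  "\<sigma> (x + y) = \<sigma> x + \<sigma> y" "nsm n (\<sigma> x) = \<sigma> (nsm n x)"
  using \<sigma>_cases by (auto simp: nsm_minus)

lemma \<sigma>_A: "x \<in> A \<Longrightarrow> \<sigma> x \<in> A"
  using \<sigma>_cases A_uminus by auto

abbreviation spanned where "spanned \<equiv> spanM pairs w"

lemmas spanned_diff = spanM_diff[OF acts_pairs w]
lemmas spanned_add = spanM_add[OF acts_pairs w]
lemmas spanned_act = spanM_act[OF acts_pairs w]

definition swaps where "swaps F \<longleftrightarrow> (\<forall>i\<in>\<Omega>. \<forall>j\<in>\<Omega>. i \<noteq> j \<longrightarrow> F (j, i) = \<sigma> (F (i, j)))"

text \<open>The action of 1 - x from the group ring. It kills the entries whose two points are fixed
  by \<open>x\<close>, so shifts by 3-cycles shrink supports inside a submodule.\<close>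

definition shift where "shift x F e = F e - F (pact x e)"

lemma shift_apply: "shift x F (i, j) = F (i, j) - F (\<pi> x i, \<pi> x j)"
  by (simp add: shift_def)

lemma spanned_shift: "spanned F \<Longrightarrow> x \<in> carrier G \<Longrightarrow> spanned (shift x F)"
  using spanned_diff[of F "\<lambda>e. F (pact x e)"] spanned_act[of F x] by (simp add: shift_def[abs_def])

lemma swapsD: "swaps F \<Longrightarrow> i \<in> \<Omega> \<Longrightarrow> j \<in> \<Omega> \<Longrightarrow> i \<noteq> j \<Longrightarrow> F (j, i) = \<sigma> (F (i, j))"
  unfolding swaps_def by blast

lemma swaps_shift:
  assumes F: "swaps F" and x: "x \<in> carrier G" shows "swaps (shift x F)"
  unfolding swaps_def
proof (intro ballI impI)
  fix i j assume ij: "i \<in> \<Omega>" "j \<in> \<Omega>" "i \<noteq> j"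
  have "\<pi> x i \<in> \<Omega>" "\<pi> x j \<in> \<Omega>" "\<pi> x i \<noteq> \<pi> x j" using ij \<pi>_in[OF x] \<pi>_inj[OF x] by blast+
  from swapsD[OF F ij] swapsD[OF F this] show "shift x F (j, i) = \<sigma> (shift x F (i, j))"
    unfolding shift_apply by simp
qed

text \<open>The product of \<open>dipole r r'\<close> in one variable and \<open>dipole s s'\<close>
  in the other, made symmetric with sign \<sigma>.\<close>

definition block where
  "block r r' s s' y = (\<lambda>(i, j).
     if i = r then dipole s s' y j else if i = r' then - dipole s s' y j
     else if j = r then \<sigma> (dipole s s' y i) else if j = r' then - \<sigma> (dipole s s' y i) else 0)"

lemma nsm_block: "nsm n (block r r' s s' y e) = block r r' s s' (nsm n y) e"
  by (cases e) (simp add: block_def dipole_def nsm_minus)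

text \<open>The mixed second difference; it vanishes throughout when \<open>F\<close> is a sum of a
  function of the first and a function of the second point.\<close>

definition four where "four F a a' b b' = F (a, b) - F (a', b) - F (a, b') + F (a', b')"

text \<open>Shifts by 3-cycles \<open>g\<close> through \<open>a\<close>, \<open>a'\<close> and
  \<open>h\<close> through \<open>b\<close>, \<open>b'\<close> leave entries only between their
  supports, with the second difference at \<open>(a, b)\<close>. Shifts by \<open>g'\<close> and
  \<open>h'\<close>, which meet these supports in \<open>a\<close> and \<open>b\<close> only, then
  cut each variable down to a dipole.\<close>

lemma block_from_four:
  assumes sp: "spanned F" and sw: "swaps F" and d: "distinct [a, a', b, b']" "{a, a', b, b'} \<subseteq> \<Omega>"
  obtains u t where "distinct [a, u, b, t]" "u \<in> \<Omega>" "t \<in> \<Omega>" "spanned (block a u b t (four F a a' b b'))"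
proof -
  have in\<Omega>: "a \<in> \<Omega>" "a' \<in> \<Omega>" "b \<in> \<Omega>" "b' \<in> \<Omega>" using d by auto
  obtain a2 where a2: "a2 \<in> \<Omega>" "a2 \<notin> {a, a', b, b'}" using avoid[of "[a, a', b, b']"] by auto
  obtain b2 where b2: "b2 \<in> \<Omega>" "b2 \<notin> {a, a', b, b', a2}" using avoid[of "[a, a', b, b', a2]"] by auto
  obtain u0 where u0: "u0 \<in> \<Omega>" "u0 \<notin> {a, a', b, b', a2, b2}" using avoid[of "[a, a', b, b', a2, b2]"] by auto
  obtain u where u: "u \<in> \<Omega>" "u \<notin> {a, a', b, b', a2, b2, u0}" using avoid[of "[a, a', b, b', a2, b2, u0]"] by auto
  obtain t0 where t0: "t0 \<in> \<Omega>" "t0 \<notin> {a, a', b, b', a2, b2, u0, u}"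
    using avoid[of "[a, a', b, b', a2, b2, u0, u]"] by auto
  obtain t where t: "t \<in> \<Omega>" "t \<notin> {a, a', b, b', a2, b2, u0, u, t0}"
    using avoid[of "[a, a', b, b', a2, b2, u0, u, t0]"] by auto
  let ?P = "{a, a', a2}" and ?Q = "{b, b', b2}"
  have ds: "distinct [a, a', a2]" "distinct [b, b', b2]" "distinct [a, u0, u]" "distinct [b, t0, t]"
    using d a2 b2 u0 u t0 t by auto
  obtain g where g: "g \<in> carrier G" "\<pi> g = cyc3 a a' a2" using \<pi>_lift[OF cyc3_in_Alt[OF in\<Omega>(1,2) a2(1) ds(1)]] by blast
  obtain h where h: "h \<in> carrier G" "\<pi> h = cyc3 b b' b2" using \<pi>_lift[OF cyc3_in_Alt[OF in\<Omega>(3,4) b2(1) ds(2)]] by blast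
  obtain g' where g': "g' \<in> carrier G" "\<pi> g' = cyc3 a u0 u" using \<pi>_lift[OF cyc3_in_Alt[OF in\<Omega>(1) u0(1) u(1) ds(3)]] by blast
  obtain h' where h': "h' \<in> carrier G" "\<pi> h' = cyc3 b t0 t" using \<pi>_lift[OF cyc3_in_Alt[OF in\<Omega>(3) t0(1) t(1) ds(4)]] by blast
  define e1 where "e1 = shift g F"
  define e2 where "e2 = shift h e1"
  define e3 where "e3 = shift g' e2"
  define e4 where "e4 = shift h' e3"
  have sp4: "spanned e4" unfolding e4_def e3_def e2_def e1_def using sp g h g' h' by (intro spanned_shift)
  have sw1: "swaps e1" unfolding e1_def using swaps_shift[OF sw g(1)] .
  have sw2: "swaps e2" unfolding e2_def using swaps_shift[OF sw1 h(1)] .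
  have sw3: "swaps e3" unfolding e3_def using swaps_shift[OF sw2 g'(1)] .
  have sw4: "swaps e4" unfolding e4_def using swaps_shift[OF sw3 h'(1)] .
  have gv: "\<pi> g a = a'" "\<pi> g a' = a2" "\<pi> g a2 = a" using ds(1) by (auto simp: g cyc3_apply)
  have hv: "\<pi> h b = b'" "\<pi> h b' = b2" "\<pi> h b2 = b" using ds(2) by (auto simp: h cyc3_apply)
  have gv': "\<pi> g' a = u0" "\<pi> g' u0 = u" "\<pi> g' u = a" using ds(3) by (auto simp: g' cyc3_apply)
  have hv': "\<pi> h' b = t0" "\<pi> h' t0 = t" "\<pi> h' t = b" using ds(4) by (auto simp: h' cyc3_apply)
  have ne: "distinct [a, a', b, b', a2, b2, u0, u, t0, t]"
    using d(1) a2(2) b2(2) u0(2) u(2) t0(2) t(2) by auto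
  have ner: "distinct [t, t0, u, u0, b2, a2, b', b, a', a]" using ne by auto
  have fixg: "\<pi> g i = i" if "i \<notin> ?P" for i using that ds by (simp add: g cyc3_apply)
  have fixh: "\<pi> h i = i" if "i \<notin> ?Q" for i using that ds by (simp add: h cyc3_apply)
  have fixg': "\<pi> g' i = i" if "i \<notin> {a, u0, u}" for i using that ds by (simp add: g' cyc3_apply)
  have fixh': "\<pi> h' i = i" if "i \<notin> {b, t0, t}" for i using that ds by (simp add: h' cyc3_apply)
  have e1_0: "e1 (i, j) = 0" if "i \<notin> ?P" "j \<notin> ?P" for i j
    unfolding e1_def shift_apply using fixg[OF that(1)] fixg[OF that(2)] by simp
  have hP: "\<pi> h i \<notin> ?P" if "i \<notin> ?P" for i
    using that hv fixh[of i] ne by (cases "i \<in> ?Q") auto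
  have e2_P: "e2 (i, j) = 0" if "i \<notin> ?P" "j \<notin> ?P" for i j
    unfolding e2_def shift_apply using e1_0[OF that] e1_0[OF hP[OF that(1)] hP[OF that(2)]] by simp
  have e2_Q: "e2 (i, j) = 0" if "i \<notin> ?Q" "j \<notin> ?Q" for i j
    unfolding e2_def shift_apply using fixh[OF that(1)] fixh[OF that(2)] by simp
  have e2_ab: "e2 (a, b) = four F a a' b b'"
    using gv(1) hv(1) fixg[of b] fixg[of b'] fixh[of a] fixh[of a'] ne ner
    by (simp add: e2_def e1_def shift_apply four_def)
  have e3_Q: "e3 (i, j) = (if i = a then e2 (a, j) else if i = u then - e2 (a, j) else 0)" if "j \<in> ?Q" for i j
  proof -
    have j: "\<pi> g' j = j" "j \<notin> ?P" using that fixg'[of j] ne ner by auto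
    have "e2 (u0, j) = 0" "e2 (u, j) = 0" using e2_P[of u0 j] e2_P[of u j] j ne ner by simp_all
    then show ?thesis
      unfolding e3_def shift_apply using j(1) fixg'[of i] gv' ne ner by (cases "i \<in> {a, u0, u}") auto
  qed
  have e3_0: "e3 (i, j) = 0" if "i \<notin> ?Q" "j \<notin> ?Q" for i j
  proof -
    have "\<pi> g' x \<notin> ?Q" if "x \<notin> ?Q" for x
      using that gv' fixg'[of x] ne by (cases "x \<in> {a, u0, u}") auto
    then show ?thesis unfolding e3_def shift_apply using e2_Q that by simp
  qed
  have e4_a: "e4 (i, j) = dipole b t (e3 (i, b)) j" if i: "i \<in> {a, u}" for i j
  proof -
    have fi: "\<pi> h' i = i" "i \<notin> ?Q" using i fixh'[of i] ne ner by auto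
    have "e3 (i, t0) = 0" "e3 (i, t) = 0" using e3_0[OF fi(2), of t0] e3_0[OF fi(2), of t] ne ner by simp_all
    then show ?thesis
      unfolding e4_def shift_apply dipole_def using fi(1) fixh'[of j] hv' ne ner by (cases "j \<in> {b, t0, t}") auto
  qed
  \<comment> \<open>Entries with the first point in \<open>?Q\<close> are controlled through the
    symmetry under swapping.\<close>
  have e3_0': "e3 (i, j) = 0" if "i \<notin> {a, u}" "j \<notin> {a, u}" "i \<in> \<Omega>" "j \<in> \<Omega>" "i \<noteq> j" for i j
  proof (cases "j \<in> ?Q")
    case False
    show ?thesis
    proof (cases "i \<in> ?Q")
      case True
      then have "e3 (j, i) = 0" using e3_Q[of i j] that by auto
      then show ?thesis using swapsD[OF sw3, of j i] that by simp
    qed (use e3_0 False in blast)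
  qed (use e3_Q that in auto)
  have e4_0: "e4 (i, j) = 0" if "i \<notin> {a, u}" "j \<notin> {a, u}" "i \<in> \<Omega>" "j \<in> \<Omega>" "i \<noteq> j" for i j
  proof -
    have "\<pi> h' x \<notin> {a, u}" if "x \<notin> {a, u}" for x
      using that hv' fixh'[of x] ne by (cases "x \<in> {b, t0, t}") auto
    then show ?thesis
      unfolding e4_def shift_apply using e3_0' that \<pi>_in[OF h'(1)] \<pi>_inj[OF h'(1)] by simp
  qed
  let ?y = "four F a a' b b'"
  have eb: "e3 (a, b) = ?y" "e3 (u, b) = - ?y" using e3_Q[of b a] e3_Q[of b u] e2_ab ner by simp_all
  show thesis
  proof (rule that[of u t])
    show "distinct [a, u, b, t]" using d u t by auto
    show "spanned (block a u b t ?y)"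
    proof (rule spanM_cong[OF sp4])
      fix e assume "e \<in> pairs"
      then obtain i j where e: "e = (i, j)" "i \<in> \<Omega>" "j \<in> \<Omega>" "i \<noteq> j" by (auto simp: pairs_def)
      have un: "u \<noteq> a" using ner by simp
      have e4_block: "e4 (i, j) = block a u b t ?y (i, j)" if "i \<in> {a, u}" for i j
        using e4_a[OF that, of j] that eb un by (cases "i = a") (simp_all add: block_def dipole_def)
      have "swaps (block a u b t ?y)" using ne by (auto simp: swaps_def block_def dipole_def)
      note sws = swapsD[OF sw4, of j i] swapsD[OF this, of j i]
      consider "i \<in> {a, u}" | "i \<notin> {a, u}" "j \<in> {a, u}" | "i \<notin> {a, u}" "j \<notin> {a, u}" by blast
      then show "e4 e = block a u b t ?y e"
      proof cases
        case 1
        then show ?thesis using e4_block e(1) by simp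
      next
        case 2
        then show ?thesis using sws e4_block[of j i] e by simp
      next
        case 3
        then show ?thesis using e4_0[of i j] e by (simp add: block_def)
      qed
    qed
  qed (use u t in auto)
qed

text \<open>The alternating group is transitive on quadruples of distinct points, and multiples of a
  nonzero element exhaust \<open>A\<close>.\<close>

lemma all_blocks:
  assumes "spanned F" "swaps F" "distinct [a, a', b, b']" "{a, a', b, b'} \<subseteq> \<Omega>"
    and "four F a a' b b' \<noteq> 0" "four F a a' b b' \<in> A"
    and d: "distinct [r, r', s, s']" "{r, r', s, s'} \<subseteq> \<Omega>" and y: "y \<in> A"
  shows "spanned (block r r' s s' y)"
proof -
  let ?x = "four F a a' b b'"
  obtain u t where ut: "distinct [a, u, b, t]" "u \<in> \<Omega>" "t \<in> \<Omega>" "spanned (block a u b t ?x)"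
    using block_from_four[OF assms(1-4)] .
  define f where "f i = (if i = r then a else if i = r' then u else if i = s then b else t)" for i
  have f: "f r = a" "f r' = u" "f s = b" "f s' = t" using d(1) by (auto simp: f_def)
  have "\<exists>g\<in>carrier G. \<forall>i\<in>{r, r', s, s'}. \<pi> g i = f i"
  proof (rule transitive_lift[OF d(2)])
    show "inj_on f {r, r', s, s'}" using f ut(1) d(1) by simp
    show "f ` {r, r', s, s'} \<subseteq> \<Omega>" using f ut(2,3) assms(4) by simp
    show "card {r, r', s, s'} + 2 \<le> card \<Omega>" using d(1) card_\<Omega> by simp
  qed
  then obtain g where g: "g \<in> carrier G" "\<pi> g r = a" "\<pi> g r' = u" "\<pi> g s = b" "\<pi> g s' = t" using f by auto
  have "dipole b t z (\<pi> g i) = dipole s s' z i" for i z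
    using \<pi>_inj[OF g(1), of i s] \<pi>_inj[OF g(1), of i s'] by (simp add: dipole_def g)
  then have "block a u b t ?x (pact g e) = block r r' s s' ?x e" for e
    using \<pi>_inj[OF g(1), of _ r] \<pi>_inj[OF g(1), of _ r'] by (cases e) (simp add: block_def g)
  then have "spanned (block r r' s s' ?x)" using spanned_act[OF ut(4) g(1)] by simp
  then show ?thesis
    using spanM_multiples[OF acts_pairs w assms(6,5) y, of "\<lambda>e x. block r r' s s' x e"] nsm_block by simp
qed

lemma sum_dipole:
  assumes "s \<in> S" "s' \<in> S" "s \<noteq> s'" "finite S" shows "(\<Sum>j\<in>S. dipole s s' y j) = 0"
proof -
  have "(\<Sum>j\<in>S. dipole s s' y j) = (\<Sum>j\<in>{s, s'}. dipole s s' y j)"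
    by (rule sum.mono_neutral_right) (use assms in \<open>auto simp: dipole_def\<close>)
  then show ?thesis using assms(3) by (simp add: dipole_def)
qed

lemma rows_block:
  assumes d: "distinct [r, r', s, s']" "{r, r', s, s'} \<subseteq> \<Omega>" and i: "i \<in> \<Omega>"
  shows "rows (block r r' s s' y) i = 0"
proof -
  have in\<Omega>: "r \<in> \<Omega>" "r' \<in> \<Omega>" "s \<in> \<Omega>" "s' \<in> \<Omega>" using d(2) by auto
  consider "i = r" | "i = r'" | "i \<noteq> r" "i \<noteq> r'" by blast
  then show ?thesis
  proof cases
    case 1
    then show ?thesis using sum_dipole[of s "\<Omega> - {r}" s' y] d(1) in\<Omega> fin\<Omega> by (auto simp: rows_def block_def)
  next
    case 2
    then show ?thesis using sum_dipole[of s "\<Omega> - {r'}" s' y] d(1) in\<Omega> fin\<Omega>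
      by (auto simp: rows_def block_def sum_negf)
  next
    case 3
    have "rows (block r r' s s' y) i = (\<Sum>j\<in>\<Omega> - {i}. dipole r r' (\<sigma> (dipole s s' y i)) j)"
      unfolding rows_def using 3 by (intro sum.cong) (auto simp: block_def dipole_def)
    then show ?thesis using sum_dipole[of r "\<Omega> - {i}" r'] 3 d(1) in\<Omega> fin\<Omega> by auto
  qed
qed

lemma swaps_block:
  assumes "distinct [r, r', s, s']" shows "swaps (block r r' s s' y)"
  using assms by (auto simp: swaps_def block_def dipole_def)

text \<open>The submodule generated by the blocks, characterized by linear conditions.\<close>

definition admissible where
  "admissible F \<longleftrightarrow> swaps F \<and> (\<forall>e\<in>pairs. F e \<in> A) \<and> (\<forall>i\<in>\<Omega>. rows F i = 0)"

lemma admissible_diff_block: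
  assumes "admissible F" "distinct [r, r', s, s']" "{r, r', s, s'} \<subseteq> \<Omega>" "y \<in> A"
  shows "admissible (\<lambda>e. F e - block r r' s s' y e)"
proof -
  have "block r r' s s' y e \<in> A" for e
    using assms(4) A_zero A_uminus \<sigma>_A by (cases e) (auto simp: block_def dipole_def)
  then have "F e - block r r' s s' y e \<in> A" if "e \<in> pairs" for e
    using assms(1) that A_diff by (simp add: admissible_def)
  moreover have "swaps (\<lambda>e. F e - block r r' s s' y e)"
    unfolding swaps_def
  proof (intro ballI impI)
    fix i j assume ij: "i \<in> \<Omega>" "j \<in> \<Omega>" "i \<noteq> j"
    have "swaps F" using assms(1) by (simp add: admissible_def)
    from swapsD[OF this ij] swapsD[OF swaps_block[OF assms(2), of y] ij]
    show "F (j, i) - block r r' s s' y (j, i) = \<sigma> (F (i, j) - block r r' s s' y (i, j))" by simp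
  qed
  ultimately show ?thesis
    using assms(1) rows_block[OF assms(2,3)] by (simp add: admissible_def rows_diff)
qed

text \<open>Elimination with blocks: entries are confined to the rows and columns of
  \<open>o1\<close> and \<open>o2\<close>, then to the triangle on \<open>o1\<close>,
  \<open>o2\<close>, \<open>o3\<close>, where the zero row sums leave one free value.\<close>

lemma admissible_spanned:
  assumes blocks: "\<And>r r' s s' y. distinct [r, r', s, s'] \<Longrightarrow> {r, r', s, s'} \<subseteq> \<Omega> \<Longrightarrow> y \<in> A \<Longrightarrow> spanned (block r r' s s' y)"
    and F: "admissible F"
  shows "spanned F"
proof -
  obtain o1 where o1: "o1 \<in> \<Omega>" using avoid[of "[]"] by auto
  obtain o2 where o2: "o2 \<in> \<Omega>" "o2 \<noteq> o1" using avoid[of "[o1]"] by auto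
  obtain o3 where o3: "o3 \<in> \<Omega>" "o3 \<noteq> o1" "o3 \<noteq> o2" using avoid[of "[o1, o2]"] by auto
  obtain o4 where o4: "o4 \<in> \<Omega>" "o4 \<noteq> o1" "o4 \<noteq> o2" "o4 \<noteq> o3" using avoid[of "[o1, o2, o3]"] by auto
  have step: "spanned F" if "spanned (\<lambda>e. F e - block r r' s s' y e)" "distinct [r, r', s, s']"
    "{r, r', s, s'} \<subseteq> \<Omega>" "y \<in> A" for F r r' s s' y
    using spanned_add[OF that(1) blocks[OF that(2-4)]] by simp
  have last: "spanned F"
    if F: "admissible F" and z: "\<And>i j. (i, j) \<in> pairs \<Longrightarrow> F (i, j) \<noteq> 0 \<Longrightarrow> i \<in> {o1, o2, o3} \<and> j \<in> {o1, o2, o3}" for F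
  proof -
    have sw: "swaps F" using F by (simp add: admissible_def)
    have row: "F (x, y) + F (x, z) = 0" if "distinct [x, y, z]" "{x, y, z} = {o1, o2, o3}" for x y z
    proof -
      have x: "x \<in> \<Omega>" "y \<in> \<Omega>" "z \<in> \<Omega>" using that o1 o2 o3 by auto
      have "rows F x = (\<Sum>j\<in>{y, z}. F (x, j))"
        unfolding rows_def by (rule sum.mono_neutral_right) (use fin\<Omega> x that z[of x] in auto)
      then show ?thesis using F x that(1) by (simp add: admissible_def)
    qed
    define y where "y = F (o1, o2)"
    have yA: "y \<in> A" using F o1 o2 by (simp add: admissible_def y_def)
    have y13: "F (o1, o3) = - y" using row[of o1 o2 o3] o2 o3 by (simp add: y_def eq_neg_iff_add_eq_0 add.commute)
    have y21: "F (o2, o1) = \<sigma> y" using swapsD[OF sw, of o1 o2] o1 o2 by (simp add: y_def)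
    have y31: "F (o3, o1) = - \<sigma> y" using swapsD[OF sw, of o1 o3] o1 o3 y13 by simp
    have y23: "F (o2, o3) = - \<sigma> y" using row[of o2 o1 o3] o2 o3 y21 by (simp add: eq_neg_iff_add_eq_0 add.commute insert_commute)
    have y32: "F (o3, o2) = \<sigma> y" using row[of o3 o1 o2] o2 o3 y31 by (simp add: eq_neg_iff_add_eq_0 add.commute insert_commute)
    have y32': "F (o3, o2) = - y" using swapsD[OF sw, of o2 o3] o2 o3 y23 by simp
    have \<sigma>y: "\<sigma> y = - y" using y32 y32' by simp
    \<comment> \<open>The three blocks below produce twice their coefficient. In the symmetric case
      \<sigma>y = -y already forces the value to be zero.\<close>
    obtain c where c: "c \<in> A" "nsm 2 c = y" using A_divisible[OF p_not_dvd_2 yA] by blast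
    then have cc: "c + c = y" by (simp add: numeral_2_eq_2)
    then have mcc: "- c - c = - y" by (metis minus_add_distrib uminus_add_conv_diff add.commute diff_minus_eq_add)
    have "\<sigma> c + \<sigma> c = - (c + c)" using \<sigma>y unfolding cc[symmetric] by simp
    then have "(\<sigma> c + c) + (\<sigma> c + c) = 0" by (simp add: algebra_simps)
    then have \<sigma>c: "\<sigma> c = - c" using A_half[OF A_add[OF \<sigma>_A[OF c(1)] c(1)]] by (simp add: eq_neg_iff_add_eq_0)
    \<comment> \<open>In the exterior square, (o1-o3)(o2-o4) + (o3-o4)(o1-o2) + (o2-o3)(o4-o1)
      equals 2(o1 o2 + o2 o3 + o3 o1): all terms with \<open>o4\<close> cancel.\<close>
    have "spanned (\<lambda>e. block o1 o3 o2 o4 c e + block o3 o4 o1 o2 c e + block o2 o3 o4 o1 c e)"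
      using o1 o2 o3 o4 c by (intro spanned_add blocks) auto
    then show ?thesis
    proof (rule spanM_cong)
      fix e assume "e \<in> pairs"
      then obtain i j where e: "e = (i, j)" "(i, j) \<in> pairs" by (cases e) auto
      have ne: "o1 \<noteq> o2" "o1 \<noteq> o3" "o1 \<noteq> o4" "o2 \<noteq> o3" "o2 \<noteq> o4" "o3 \<noteq> o4" using o2 o3 o4 by auto
      show "block o1 o3 o2 o4 c e + block o3 o4 o1 o2 c e + block o2 o3 o4 o1 c e = F e"
      proof (cases "i \<in> {o1, o2, o3} \<and> j \<in> {o1, o2, o3}")
        case True
        then show ?thesis using e ne ne[symmetric] y13 y21 y31 y23 y32 \<sigma>c cc mcc \<sigma>y
          by (auto simp: block_def dipole_def y_def[symmetric])
      next
        case False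
        then have "F e = 0" using z e by blast
        then show ?thesis using e ne ne[symmetric] \<sigma>c False by (auto simp: block_def dipole_def)
      qed
    qed
  qed
  have second: "spanned F"
    if "admissible F" "\<And>i j. (i, j) \<in> pairs \<Longrightarrow> F (i, j) \<noteq> 0 \<Longrightarrow> i \<in> {o1, o2} \<or> j \<in> {o1, o2}" for F
    using that
  proof (induction "card {i \<in> \<Omega> - {o1, o2, o3}. F (i, o1) \<noteq> 0}" arbitrary: F rule: less_induct)
    case less
    have sw: "swaps F" using less.prems by (simp add: admissible_def)
    have row: "F (i, o2) = - F (i, o1)" if "i \<in> \<Omega>" "i \<notin> {o1, o2}" for i
    proof -
      have "rows F i = (\<Sum>j\<in>{o1, o2}. F (i, j))"
        unfolding rows_def
        by (rule sum.mono_neutral_right) (use fin\<Omega> that o1 o2 less.prems(2)[of i] in auto)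
      then show ?thesis using less.prems that o2 by (simp add: admissible_def eq_neg_iff_add_eq_0 add.commute)
    qed
    show ?case
    proof (cases "\<exists>i\<in>\<Omega> - {o1, o2, o3}. F (i, o1) \<noteq> 0")
      case True
      then obtain i where i: "i \<in> \<Omega>" "i \<notin> {o1, o2, o3}" "F (i, o1) \<noteq> 0" by blast
      \<comment> \<open>Row \<open>i\<close> has only two entries, at \<open>o1\<close> and
        \<open>o2\<close>, and they are opposite; this block clears both and disturbs only the row
        and column of \<open>o3\<close> in return.\<close>
      define F' where "F' e = F e - block i o3 o1 o2 (F (i, o1)) e" for e
      have d: "distinct [i, o3, o1, o2]" "{i, o3, o1, o2} \<subseteq> \<Omega>" "F (i, o1) \<in> A"
        using i o1 o2 o3 less.prems(1) by (auto simp: admissible_def)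
      have "spanned F'"
      proof (rule less.hyps)
        show "admissible F'" unfolding F'_def by (rule admissible_diff_block[OF less.prems(1) d])
        show "j \<in> {o1, o2} \<or> l \<in> {o1, o2}" if jl: "(j, l) \<in> pairs" "F' (j, l) \<noteq> 0" for j l
        proof (rule ccontr)
          assume n: "\<not> ?thesis"
          then have "F (j, l) = 0" using less.prems(2) jl(1) by blast
          then show False using n jl(2) d(1) by (auto simp: F'_def block_def dipole_def split: if_splits)
        qed
        have "{j \<in> \<Omega> - {o1, o2, o3}. F' (j, o1) \<noteq> 0} \<subseteq> {j \<in> \<Omega> - {o1, o2, o3}. F (j, o1) \<noteq> 0} - {i}"
          using d(1) by (auto simp: F'_def block_def dipole_def)
        then have "card {j \<in> \<Omega> - {o1, o2, o3}. F' (j, o1) \<noteq> 0} \<le> card ({j \<in> \<Omega> - {o1, o2, o3}. F (j, o1) \<noteq> 0} - {i})"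
          using fin\<Omega> by (intro card_mono) auto
        also have "\<dots> < card {j \<in> \<Omega> - {o1, o2, o3}. F (j, o1) \<noteq> 0}"
          using fin\<Omega> i by (intro card_Diff1_less) auto
        finally show "card {j \<in> \<Omega> - {o1, o2, o3}. F' (j, o1) \<noteq> 0} < card {j \<in> \<Omega> - {o1, o2, o3}. F (j, o1) \<noteq> 0}" .
      qed
      then show ?thesis unfolding F'_def using step d by blast
    next
      case False
      have zero: "F (i, j) = 0" if ij: "(i, j) \<in> pairs" "i \<notin> {o1, o2, o3}" for i j
      proof (rule ccontr)
        assume "F (i, j) \<noteq> 0"
        then have "j = o1 \<or> j = o2" using less.prems(2)[OF ij(1)] ij by blast
        moreover have "F (i, o1) = 0" using False ij by auto
        ultimately show False using row[of i] ij \<open>F (i, j) \<noteq> 0\<close> by auto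
      qed
      show ?thesis
      proof (rule last[OF less.prems(1)])
        fix i j assume ij: "(i, j) \<in> pairs" "F (i, j) \<noteq> 0"
        have "F (j, i) \<noteq> 0" using swapsD[OF sw, of i j] ij by simp
        then show "i \<in> {o1, o2, o3} \<and> j \<in> {o1, o2, o3}" using zero[of i j] zero[of j i] ij by auto
      qed
    qed
  qed
  show ?thesis
    using F
  proof (induction "card {e \<in> pairs. fst e \<notin> {o1, o2} \<and> snd e \<notin> {o1, o2} \<and> F e \<noteq> 0}" arbitrary: F rule: less_induct)
    case less
    show ?case
    proof (cases "\<exists>i j. (i, j) \<in> pairs \<and> F (i, j) \<noteq> 0 \<and> i \<notin> {o1, o2} \<and> j \<notin> {o1, o2}")
      case True
      then obtain i j where ij: "(i, j) \<in> pairs" "F (i, j) \<noteq> 0" "i \<notin> {o1, o2}" "j \<notin> {o1, o2}" by blast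
      \<comment> \<open>Off the rows and columns of \<open>o1\<close> and \<open>o2\<close> this
        block has entries at \<open>(i, j)\<close> and \<open>(j, i)\<close> only.\<close>
      define F' where "F' e = F e - block i o1 j o2 (F (i, j)) e" for e
      have d: "distinct [i, o1, j, o2]" "{i, o1, j, o2} \<subseteq> \<Omega>" "F (i, j) \<in> A"
        using ij o1 o2 less.prems by (auto simp: admissible_def)
      have sw: "swaps F" using less.prems by (simp add: admissible_def)
      let ?N = "\<lambda>F. {e \<in> pairs. fst e \<notin> {o1, o2} \<and> snd e \<notin> {o1, o2} \<and> F e \<noteq> 0}"
      have "pairs \<subseteq> \<Omega> \<times> \<Omega>" by (auto simp: pairs_def)
      then have finp: "finite pairs" using fin\<Omega> finite_subset by blast
      have ji: "F (j, i) = \<sigma> (F (i, j))" using swapsD[OF sw, of i j] ij by simp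
      have "spanned F'"
      proof (rule less.hyps)
        show "admissible F'" unfolding F'_def by (rule admissible_diff_block[OF less.prems d])
        have "?N F' \<subseteq> ?N F - {(i, j)}"
          using d(1) ij ji by (auto simp: F'_def block_def dipole_def split: if_splits)
        then have "card (?N F') \<le> card (?N F - {(i, j)})"
          using finp by (intro card_mono) auto
        also have "\<dots> < card (?N F)" using finp ij by (intro card_Diff1_less) auto
        finally show "card (?N F') < card (?N F)" .
      qed
      then show ?thesis unfolding F'_def using step d by blast
    next
      case False
      then show ?thesis using second[OF less.prems] by blast
    qed
  qed
qed

end

section \<open>Prescribed row sums and correction by a coboundary\<close>

context alt_ext_hom
begin

lemma rows_support:
  assumes "finite S" "S \<subseteq> \<Omega> - {i}" "\<And>j. j \<in> \<Omega> \<Longrightarrow> j \<noteq> i \<Longrightarrow> j \<notin> S \<Longrightarrow> F (i, j) = 0"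
  shows "rows F i = (\<Sum>j\<in>S. F (i, j))"
  unfolding rows_def by (rule sum.mono_neutral_right) (use assms fin\<Omega> in auto)

lemma rows_sum: "rows (\<lambda>e. \<Sum>r\<in>R. F r e) i = (\<Sum>r\<in>R. rows (F r) i)"
  unfolding rows_def by (rule sum.swap)

text \<open>Weights on the edges of a triangle whose row sums cancel except at \<open>i\<close>: in
  the symmetric case this prescribes the row sum at one point at a time.\<close>

definition tripod where
  "tripod i j l h = (\<lambda>(x, y). if (x = i \<and> (y = j \<or> y = l)) \<or> (y = i \<and> (x = j \<or> x = l)) then h
     else if (x = j \<and> y = l) \<or> (x = l \<and> y = j) then - h else 0)"

lemma rows_tripod:
  assumes d: "distinct [i, j, l]" "{i, j, l} \<subseteq> \<Omega>" and r: "r \<in> \<Omega>"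
  shows "rows (tripod i j l h) r = (if r = i then h + h else 0)"
proof -
  consider "r = i" | "r = j" | "r = l" | "r \<notin> {i, j, l}" by blast
  then show ?thesis
  proof cases
    case 1
    then have "rows (tripod i j l h) r = (\<Sum>y\<in>{j, l}. tripod i j l h (r, y))"
      by (intro rows_support) (use d in \<open>auto simp: tripod_def\<close>)
    then show ?thesis using 1 d(1) by (auto simp: tripod_def)
  next
    case 2
    then have "rows (tripod i j l h) r = (\<Sum>y\<in>{i, l}. tripod i j l h (r, y))"
      by (intro rows_support) (use d in \<open>auto simp: tripod_def\<close>)
    then show ?thesis using 2 d(1) by (auto simp: tripod_def)
  next
    case 3
    then have "rows (tripod i j l h) r = (\<Sum>y\<in>{i, j}. tripod i j l h (r, y))"
      by (intro rows_support) (use d in \<open>auto simp: tripod_def\<close>)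
    then show ?thesis using 3 d(1) by (auto simp: tripod_def)
  next
    case 4
    then have "rows (tripod i j l h) r = (\<Sum>y\<in>{}. tripod i j l h (r, y))"
      by (intro rows_support) (use d in \<open>auto simp: tripod_def\<close>)
    then show ?thesis using 4 by simp
  qed
qed

end

context signed_pairs
begin

text \<open>The antisymmetric case divides by the number of points, the symmetric case by two. The
  constant \<kappa> is harmless, since \<open>cocycle_rows\<close> involves only differences of
  values of \<open>c\<close>.\<close>

lemma potential_exists:
  assumes cA: "\<And>i. i \<in> \<Omega> \<Longrightarrow> c i \<in> A"
  shows "\<exists>\<beta> \<kappa>. swaps \<beta> \<and> (\<forall>e\<in>pairs. \<beta> e \<in> A) \<and> (\<forall>i\<in>\<Omega>. rows \<beta> i = c i - \<kappa>)"
  using \<sigma>_cases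
proof
  assume \<sigma>: "\<sigma> = uminus"
  have "\<exists>d\<in>A. nsm (card \<Omega>) d = c i" if "i \<in> \<Omega>" for i using A_divisible[OF p_\<Omega> cA[OF that]] .
  then obtain d where d: "\<And>i. i \<in> \<Omega> \<Longrightarrow> d i \<in> A \<and> nsm (card \<Omega>) (d i) = c i" by metis
  define \<beta> where "\<beta> = (\<lambda>(i, j). d i - d j)"
  have "rows \<beta> i = c i - (\<Sum>j\<in>\<Omega>. d j)" if i: "i \<in> \<Omega>" for i
  proof -
    have "rows \<beta> i = (\<Sum>j\<in>\<Omega>. d i - d j)"
      unfolding rows_def \<beta>_def using sum.remove[OF fin\<Omega> i, of "\<lambda>j. d i - d j"] by simp
    also have "\<dots> = (\<Sum>j\<in>\<Omega>. d i) - (\<Sum>j\<in>\<Omega>. d j)" by (rule sum_subtractf)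
    also have "(\<Sum>j\<in>\<Omega>. d i) = c i" using sum_const_nsm[OF fin\<Omega>, of "d i"] d[OF i] by metis
    finally show ?thesis .
  qed
  moreover have "swaps \<beta>" unfolding swaps_def by (simp add: \<beta>_def \<sigma>)
  moreover have "\<forall>e\<in>pairs. \<beta> e \<in> A" using d A_diff by (auto simp: \<beta>_def pairs_def)
  ultimately show ?thesis by blast
next
  assume \<sigma>: "\<sigma> = (\<lambda>x. x)"
  have "\<exists>F. swaps F \<and> (\<forall>e\<in>pairs. F e \<in> A) \<and> (\<forall>r\<in>\<Omega>. rows F r = (if r = i then c i else 0))" if i: "i \<in> \<Omega>" for i
  proof -
    obtain j where j: "j \<in> \<Omega>" "j \<noteq> i" using avoid[of "[i]"] by auto
    obtain l where l: "l \<in> \<Omega>" "l \<noteq> i" "l \<noteq> j" using avoid[of "[i, j]"] by auto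
    obtain h where h: "h \<in> A" "nsm 2 h = c i" using A_divisible[OF p_not_dvd_2 cA[OF i]] by blast
    have "\<forall>r\<in>\<Omega>. rows (tripod i j l h) r = (if r = i then c i else 0)"
      using rows_tripod[of i j l _ h] i j l h(2) by (simp add: numeral_2_eq_2)
    moreover have "swaps (tripod i j l h)"
      using j l unfolding swaps_def by (auto simp: tripod_def \<sigma>)
    moreover have "\<forall>e\<in>pairs. tripod i j l h e \<in> A" using h A_uminus A_zero by (auto simp: tripod_def)
    ultimately show ?thesis by blast
  qed
  then obtain F where F: "\<And>i. i \<in> \<Omega> \<Longrightarrow> swaps (F i) \<and> (\<forall>e\<in>pairs. F i e \<in> A) \<and> (\<forall>r\<in>\<Omega>. rows (F i) r = (if r = i then c i else 0))"
    by metis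
  define \<beta> where "\<beta> e = (\<Sum>i\<in>\<Omega>. F i e)" for e
  have "rows \<beta> r = c r - 0" if r: "r \<in> \<Omega>" for r
  proof -
    have "rows \<beta> r = (\<Sum>i\<in>\<Omega>. rows (F i) r)" unfolding \<beta>_def by (rule rows_sum)
    also have "\<dots> = (\<Sum>i\<in>\<Omega>. if i = r then c i else 0)" using F r by (intro sum.cong) auto
    also have "\<dots> = c r" using r fin\<Omega> by simp
    finally show ?thesis by simp
  qed
  moreover have "swaps \<beta>"
    unfolding swaps_def
  proof (intro ballI impI)
    fix x y assume xy: "x \<in> \<Omega>" "y \<in> \<Omega>" "x \<noteq> y"
    have "\<beta> (y, x) = (\<Sum>i\<in>\<Omega>. \<sigma> (F i (x, y)))"
      unfolding \<beta>_def using F swapsD[OF _ xy] by (intro sum.cong) blast+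
    then show "\<beta> (y, x) = \<sigma> (\<beta> (x, y))" by (simp add: \<sigma> \<beta>_def)
  qed
  moreover have "\<forall>e\<in>pairs. \<beta> e \<in> A" unfolding \<beta>_def using F by (intro ballI A_sum) blast
  ultimately show ?thesis by blast
qed

lemma swaps_w: "x \<in> carrier G \<Longrightarrow> swaps (\<lambda>e. w e x)"
  unfolding swaps_def by (intro ballI impI w_swap) simp_all

lemma spanned_w: "m \<in> M \<Longrightarrow> spanned (\<lambda>e. w e m)"
  unfolding spanM_def by blast

text \<open>Otherwise the values on \<open>M\<close> contain all blocks, hence all admissible
  functions. A coboundary makes all values of the cocycle admissible without changing it on
  \<open>M\<close>, and \<open>cocycle_vanishes\<close> contradicts the assumption.\<close>

lemma four_zero:
  assumes m: "m \<in> M" and d: "distinct [a, a', b, b']" "{a, a', b, b'} \<subseteq> \<Omega>"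
  shows "four (\<lambda>e. w e m) a a' b b' = 0"
proof (rule ccontr)
  assume nz: "four (\<lambda>e. w e m) a a' b b' \<noteq> 0"
  have "four (\<lambda>e. w e m) a a' b b' \<in> A"
    unfolding four_def using d M_carrier[OF m] by (intro A_add A_diff wA) auto
  then have blocks: "spanned (block r r' s s' y)"
    if "distinct [r, r', s, s']" "{r, r', s, s'} \<subseteq> \<Omega>" "y \<in> A" for r r' s s' y
    using all_blocks[OF spanned_w[OF m] swaps_w[OF M_carrier[OF m]] d nz _ that] by blast
  have "\<exists>c. (\<forall>i\<in>\<Omega>. c i \<in> A) \<and> (\<forall>x\<in>carrier G. \<forall>i\<in>\<Omega>. rows (\<lambda>e. w e x) i = c (\<pi> x i) - c i)"
    by (rule cocycle_rows[OF w]) (rule wA)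
  then obtain c where c: "\<And>i. i \<in> \<Omega> \<Longrightarrow> c i \<in> A"
    "\<And>x i. x \<in> carrier G \<Longrightarrow> i \<in> \<Omega> \<Longrightarrow> rows (\<lambda>e. w e x) i = c (\<pi> x i) - c i" by blast
  obtain \<beta> \<kappa> where \<beta>: "swaps \<beta>" "\<And>e. e \<in> pairs \<Longrightarrow> \<beta> e \<in> A" "\<And>i. i \<in> \<Omega> \<Longrightarrow> rows \<beta> i = c i - \<kappa>"
    using potential_exists[of c] c(1) by blast
  \<comment> \<open>The coboundary of \<beta> has the row sums found in \<open>cocycle_rows\<close>,
    so those of \<open>w'\<close> are zero.\<close>
  define w' where "w' e x = w e x - (\<beta> (pact x e) - \<beta> e)" for e x
  have w'M: "w' e n = w e n" if "n \<in> M" "e \<in> pairs" for e n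
    using actsD(2)[OF acts_pairs that(2,1)] by (simp add: w'_def)
  have coc: "cocycle pact pairs w'"
    unfolding cocycle_def
  proof (intro ballI)
    fix x y e assume *: "x \<in> carrier G" "y \<in> carrier G" "e \<in> pairs"
    show "w' e (x \<otimes> y) = w' (pact y e) x + w' e y"
      using cocycleD[OF w *] actsD(4)[OF acts_pairs *(3,1,2)] by (simp add: w'_def)
  qed
  have adm: "admissible (\<lambda>e. w' e x)" if x: "x \<in> carrier G" for x
    unfolding admissible_def
  proof (intro conjI ballI)
    show "w' e x \<in> A" if "e \<in> pairs" for e
      unfolding w'_def using wA[OF that x] \<beta>(2) that actsD(1)[OF acts_pairs that x] by (intro A_diff) auto
    show "rows (\<lambda>e. w' e x) i = 0" if i: "i \<in> \<Omega>" for i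
    proof -
      have "rows (\<lambda>e. w' e x) i = rows (\<lambda>e. w e x) i - (rows (\<lambda>e. \<beta> (pact x e)) i - rows \<beta> i)"
        by (simp add: w'_def rows_diff)
      also have "\<dots> = 0" using c(2)[OF x i] rows_pact[OF x, of \<beta> i] \<beta>(3) i \<pi>_in[OF x] by simp
      finally show ?thesis .
    qed
    show "swaps (\<lambda>e. w' e x)"
      unfolding swaps_def
    proof (intro ballI impI)
      fix i j assume ij: "i \<in> \<Omega>" "j \<in> \<Omega>" "i \<noteq> j"
      have xij: "\<pi> x i \<in> \<Omega>" "\<pi> x j \<in> \<Omega>" "\<pi> x i \<noteq> \<pi> x j" using ij \<pi>_in[OF x] \<pi>_inj[OF x] by blast+
      from swapsD[OF swaps_w[OF x] ij] swapsD[OF \<beta>(1) ij] swapsD[OF \<beta>(1) xij]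
      show "w' (j, i) x = \<sigma> (w' (i, j) x)" by (simp add: w'_def)
    qed
  qed
  have "spanM pairs w' (\<lambda>e. w' e x)" if x: "x \<in> carrier G" for x
  proof -
    have "spanned (\<lambda>e. w' e x)" using admissible_spanned[OF blocks adm[OF x]] by blast
    then obtain n where "n \<in> M" "\<forall>e\<in>pairs. w' e x = w e n" unfolding spanM_def by blast
    then show ?thesis unfolding spanM_def using w'M by (intro bexI[of _ n]) auto
  qed
  then have "w' e m = 0" if "e \<in> pairs" for e
    using cocycle_vanishes[OF acts_pairs coc _ M_carrier[OF m] that] by blast
  then have "w e m = 0" if "e \<in> pairs" for e using w'M[OF m that] that by simp
  then have "four (\<lambda>e. w e m) a a' b b' = 0" using d by (simp add: four_def)
  then show False using nz by simp
qed

text \<open>With all mixed differences zero, an antisymmetric \<open>f\<close> sums to zero around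
  triangles. Adding this up over the third point and using zero row sums gives
  \<open>card \<Omega>\<close> times \<open>f a b\<close> equal to zero.\<close>

lemma w_vanishes_odd:
  assumes \<sigma>: "\<sigma> = uminus" and m: "m \<in> M" and ab: "(a, b) \<in> pairs"
  shows "w (a, b) m = 0"
proof -
  define f where "f i j = w (i, j) m" for i j
  have fA: "f i j \<in> A" if "i \<in> \<Omega>" "j \<in> \<Omega>" "i \<noteq> j" for i j
    using wA M_carrier[OF m] that by (simp add: f_def)
  have anti: "f j i = - f i j" if "i \<in> \<Omega>" "j \<in> \<Omega>" "i \<noteq> j" for i j
    using w_swap[of i j m] that M_carrier[OF m] by (simp add: f_def \<sigma>)
  have quad: "f x y + f y z = f x u + f u z" if "distinct [x, y, z, u]" "{x, y, z, u} \<subseteq> \<Omega>" for x y z u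
  proof -
    have "f x y - f z y - f x u + f z u = 0"
      using four_zero[OF m, of x z y u] that by (auto simp: four_def f_def)
    moreover have "f z y = - f y z" "f z u = - f u z" using anti[of y z] anti[of u z] that by auto
    ultimately show ?thesis by (simp add: algebra_simps eq_neg_iff_add_eq_0)
  qed
  have tri: "f x y + f y z + f z x = 0" if xyz: "distinct [x, y, z]" "{x, y, z} \<subseteq> \<Omega>" for x y z
  proof -
    obtain u where u: "u \<in> \<Omega>" "u \<notin> {x, y, z}" using avoid[of "[x, y, z]"] by auto
    have 1: "f x y + f y z = f x u + f u z" using quad[of x y z u] xyz u by auto
    have 2: "f z x + f x u = f z y + f y u" using quad[of z x u y] xyz u by auto
    have 3: "f y u + f u z = f y x + f x z" using quad[of y u z x] xyz u by auto
    have a: "f z y = - f y z" "f y x = - f x y" "f x z = - f z x"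
      using anti[of y z] anti[of x y] anti[of z x] xyz by auto
    \<comment> \<open>The quadrilateral relations reverse the triangle, so its sum equals its own
      negative.\<close>
    have "f x y + f y z + f z x = f z y + f y x + f x z"
    proof -
      have "f x y + f y z + f z x = (f z x + f x u) + f u z" using 1 by (simp add: algebra_simps)
      also have "\<dots> = f z y + (f y u + f u z)" using 2 by (simp add: algebra_simps)
      finally show ?thesis using 3 by (simp add: algebra_simps)
    qed
    then have "(f x y + f y z + f z x) + (f x y + f y z + f z x) = 0" by (simp add: a algebra_simps)
    moreover have "f x y + f y z + f z x \<in> A" using fA xyz by (intro A_add) auto
    ultimately show ?thesis using A_half by blast
  qed
  have in\<Omega>: "a \<in> \<Omega>" "b \<in> \<Omega>" "a \<noteq> b" using ab by auto
  have row: "(\<Sum>j\<in>\<Omega> - {i}. f i j) = 0" if "i \<in> \<Omega>" for i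
  proof -
    have "rows (\<lambda>e. w e m) i = 0" by (rule cocycle_rows_M[OF w _ m that]) (rule wA)
    then show ?thesis by (simp add: rows_def f_def)
  qed
  let ?S = "\<Omega> - {a} - {b}"
  have finS: "finite ?S" using fin\<Omega> by simp
  have h1: "f a b + (\<Sum>c\<in>?S. f a c) = 0"
    using row[OF in\<Omega>(1)] sum.remove[of "\<Omega> - {a}" b "f a"] fin\<Omega> in\<Omega> by simp
  have h2: "(\<Sum>c\<in>?S. f c a) = (\<Sum>c\<in>?S. - f a c)" using anti in\<Omega> by (intro sum.cong) auto
  have "f a b = - (\<Sum>c\<in>?S. f a c)" using h1 by (simp add: eq_neg_iff_add_eq_0)
  then have s1: "(\<Sum>c\<in>?S. f c a) = f a b" using h2 by (simp add: sum_negf)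
  have "\<Omega> - {b} - {a} = ?S" by blast
  then have "f b a + (\<Sum>c\<in>?S. f b c) = 0"
    using row[OF in\<Omega>(2)] sum.remove[of "\<Omega> - {b}" a "f b"] fin\<Omega> in\<Omega> by simp
  then have s2: "(\<Sum>c\<in>?S. f b c) = f a b" using anti[OF in\<Omega>] by simp
  \<comment> \<open>The \<open>card \<Omega> - 2\<close> constant terms and the two row sums, each
    contributing \<open>f a b\<close>, add up to the factor \<open>card \<Omega>\<close>.\<close>
  have "(\<Sum>c\<in>?S. f a b + f b c + f c a) = 0" proof (intro sum.neutral ballI)
    fix c assume "c \<in> ?S"
    then show "f a b + f b c + f c a = 0" using tri[of a b c] in\<Omega> by auto
  qed
  then have "nsm (card ?S) (f a b) + f a b + f a b = 0"
    using s1 s2 sum_const_nsm[OF finS, of "f a b"] by (simp only: sum.distrib)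
  moreover have "card \<Omega> = Suc (Suc (card ?S))" using card_\<Omega> fin\<Omega> in\<Omega> by simp
  ultimately have "nsm (card \<Omega>) (f a b) = 0" by (simp add: algebra_simps)
  then show ?thesis using A_nsm_eq_0[OF p_\<Omega> fA[OF in\<Omega>]] by (simp add: f_def)
qed

text \<open>Vanishing mixed differences make \<mu> depend on \<open>i\<close> and \<open>n\<close>
  only; it is twice the potential m_i when \<open>f\<close> has the form m_i + m_j. On
  \<open>M\<close> it is thus invariant under the stabilizer of \<open>i\<close>. On the stabilizer
  of all three points it is a homomorphism, which \<open>hom_extends\<close> carries back to the
  stabilizer of \<open>i\<close>.\<close>

lemma w_vanishes_even:
  assumes \<sigma>: "\<sigma> = (\<lambda>x. x)" and m: "m \<in> M" and ab: "(a, b) \<in> pairs"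
  shows "w (a, b) m = 0"
proof -
  define f where "f m i j = w (i, j) m" for m i j
  have fA: "f n i j \<in> A" if "i \<in> \<Omega>" "j \<in> \<Omega>" "i \<noteq> j" "n \<in> carrier G" for n i j
    using wA that by (simp add: f_def)
  have symm: "f n j i = f n i j" if "i \<in> \<Omega>" "j \<in> \<Omega>" "i \<noteq> j" "n \<in> carrier G" for n i j
    using w_swap[of i j n] that by (simp add: f_def \<sigma>)
  define \<mu> where "\<mu> i j l n = f n i j + f n i l - f n j l" for i j l n
  have \<mu>_swap: "\<mu> i j l n = \<mu> i l j n" if "distinct [i, j, l]" "{i, j, l} \<subseteq> \<Omega>" "n \<in> M" for i j l n
    using symm[of j l n] that M_carrier by (simp add: \<mu>_def add.commute)
  have \<mu>_step: "\<mu> i j l n = \<mu> i j' l n" if "distinct [i, j, j', l]" "{i, j, j', l} \<subseteq> \<Omega>" "n \<in> M" for i j j' l n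
  proof -
    have "f n i j - f n l j - f n i j' + f n l j' = 0"
      using four_zero[OF that(3), of i l j j'] that by (auto simp: four_def f_def)
    moreover have "f n l j = f n j l" "f n l j' = f n j' l"
      using symm[of j l n] symm[of j' l n] that M_carrier by auto
    ultimately show ?thesis by (simp add: \<mu>_def algebra_simps eq_neg_iff_add_eq_0)
  qed
  have \<mu>_indep: "\<mu> i j l n = \<mu> i j' l' n"
    if d: "distinct [i, j, l]" "distinct [i, j', l']" "{i, j, l, j', l'} \<subseteq> \<Omega>" "n \<in> M" for i j l j' l' n
  proof -
    obtain u where u: "u \<in> \<Omega>" "u \<notin> {i, j, l, j', l'}" using avoid[of "[i, j, l, j', l']"] by auto
    obtain v where v: "v \<in> \<Omega>" "v \<notin> {i, j, l, j', l', u}" using avoid[of "[i, j, l, j', l', u]"] by auto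
    have to_uv: "\<mu> i x y n = \<mu> i v u n" if xy: "distinct [i, x, y]" "{i, x, y} \<subseteq> \<Omega>" "u \<notin> {x, y}" "v \<notin> {x, y}" for x y
    proof -
      have "\<mu> i x y n = \<mu> i u y n" using \<mu>_step[of i x u y n] xy u d(4) by auto
      also have "\<dots> = \<mu> i y u n" using \<mu>_swap[of i u y n] xy u d by auto
      also have "\<dots> = \<mu> i v u n" using \<mu>_step[of i y v u n] xy u v d by auto
      finally show ?thesis .
    qed
    show ?thesis using to_uv[of j l] to_uv[of j' l'] d u v by auto
  qed
  have \<mu>0: "\<mu> i j l n = 0" if d: "distinct [i, j, l]" "{i, j, l} \<subseteq> \<Omega>" and n: "n \<in> M" for i j l n
  proof -
    have in\<Omega>: "i \<in> \<Omega>" "j \<in> \<Omega>" "l \<in> \<Omega>" using d by auto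
    \<comment> \<open>Conjugating \<open>n\<close> by an element fixing \<open>i\<close> only moves
      \<open>j\<close> and \<open>l\<close>, on which \<mu> does not depend.\<close>
    have inv: "\<mu> i j l (x \<otimes> n \<otimes> inv x) = \<mu> i j l n" if x: "x \<in> B {i}" and n: "n \<in> M" for x n
    proof -
      note xc = B_carrier[OF x]
      define y where "y = inv x"
      have yc: "y \<in> carrier G" using xc by (simp add: y_def)
      have yi: "\<pi> y i = i" using B_fix[OF B_inv[OF x]] by (simp add: y_def)
      have yB: "\<pi> y r \<in> \<Omega>" if "r \<in> \<Omega>" for r using \<pi>_in[OF yc] that by simp
      have conj: "f (x \<otimes> n \<otimes> inv x) r s = f n (\<pi> y r) (\<pi> y s)" if "(r, s) \<in> pairs" for r s
      proof -
        have "(\<pi> y r, \<pi> y s) \<in> pairs" using actsD(1)[OF acts_pairs that yc] by simp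
        from cocycle_conj[OF acts_pairs w this xc n] show ?thesis
          using \<pi>_inv_right[OF xc] by (simp add: f_def y_def)
      qed
      have "\<mu> i j l (x \<otimes> n \<otimes> inv x) = \<mu> i (\<pi> y j) (\<pi> y l) n"
        using conj[of i j] conj[of i l] conj[of j l] d in\<Omega> yi by (auto simp: \<mu>_def)
      also have "\<dots> = \<mu> i j l n"
      proof (rule \<mu>_indep)
        show "distinct [i, \<pi> y j, \<pi> y l]"
          using \<pi>_inj[OF yc, of i j] \<pi>_inj[OF yc, of i l] \<pi>_inj[OF yc, of j l] d yi by auto
      qed (use d in\<Omega> yB n in auto)
      finally show ?thesis .
    qed
    have \<mu>A: "\<mu> i j l x \<in> A" if "x \<in> carrier G" for x
      unfolding \<mu>_def using fA in\<Omega> d(1) that by (intro A_diff A_add) auto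
    have "is_hom (B (insert l {i, j})) (\<mu> i j l)"
      unfolding is_hom_def
    proof (intro ballI)
      fix x y assume xy: "x \<in> B (insert l {i, j})" "y \<in> B (insert l {i, j})"
      have "pact y (i, j) = (i, j)" "pact y (i, l) = (i, l)" "pact y (j, l) = (j, l)"
        using B_fix[OF xy(2)] by auto
      then show "\<mu> i j l (x \<otimes> y) = \<mu> i j l x + \<mu> i j l y"
        using cocycleD[OF w B_carrier[OF xy(1)] B_carrier[OF xy(2)]] in\<Omega> d(1) by (simp add: \<mu>_def f_def)
    qed
    then have "\<exists>\<Psi>. is_hom (B {i, j}) \<Psi> \<and> (\<forall>x\<in>B {i, j}. \<Psi> x \<in> A) \<and> (\<forall>m\<in>M. \<Psi> m = \<mu> i j l m)"
      using in\<Omega> d(1) \<mu>A M_carrier B_carrier B_mono[of "{i}" "{i, j}"]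
      by (intro hom_extends[where \<psi> = "\<mu> i j l" and z = l] inv) auto
    then obtain \<Psi> where \<Psi>: "is_hom (B {i, j}) \<Psi>" "\<forall>x\<in>B {i, j}. \<Psi> x \<in> A" "\<forall>m\<in>M. \<Psi> m = \<mu> i j l m" by blast
    have "{i, j} = insert j {i}" by blast
    then have "\<exists>\<Psi>. is_hom (B {i}) \<Psi> \<and> (\<forall>x\<in>B {i}. \<Psi> x \<in> A) \<and> (\<forall>m\<in>M. \<Psi> m = \<mu> i j l m)"
      using in\<Omega> d(1) \<mu>A M_carrier \<Psi>
      by (intro hom_extends[where \<psi> = \<Psi> and z = j] inv) auto
    then obtain \<Phi> where "is_hom (B {i}) \<Phi>" "\<forall>x\<in>B {i}. \<Phi> x \<in> A" "\<forall>m\<in>M. \<Phi> m = \<mu> i j l m" by blast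
    then show ?thesis using point_hom_vanishes[OF in\<Omega>(1), of \<Phi> n] n by auto
  qed
  have in\<Omega>: "a \<in> \<Omega>" "b \<in> \<Omega>" "a \<noteq> b" using ab by auto
  obtain c where c: "c \<in> \<Omega>" "c \<notin> {a, b}" using avoid[of "[a, b]"] by auto
  have "\<mu> a b c m = 0" "\<mu> b a c m = 0" using \<mu>0[of a b c m] \<mu>0[of b a c m] in\<Omega> c m by auto
  then have "f m a b + f m a c = f m b c" "f m a b + f m b c = f m a c"
    using symm[OF in\<Omega> M_carrier[OF m]] by (simp_all add: \<mu>_def)
  then have "(f m a b + f m a b) + f m a c = 0 + f m a c" by (simp only: add.assoc add_0)
  then have "f m a b + f m a b = 0" by (rule add_right_imp_eq)
  then show ?thesis using A_half fA[OF in\<Omega> M_carrier[OF m]] by (simp add: f_def)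
qed

lemma w_vanishes:
  assumes "m \<in> M" "(i, j) \<in> pairs" shows "w (i, j) m = 0"
  using \<sigma>_cases w_vanishes_odd[OF _ assms] w_vanishes_even[OF _ assms] by blast

end

text \<open>The induced cocycle is split into its symmetric and antisymmetric parts, both of which
  vanish on \<open>M\<close>. Recovering it divides by two, which is possible as p is odd.\<close>

theorem (in alt_ext_hom) pair_hom_vanishes:
  assumes ab: "a \<in> \<Omega>" "b \<in> \<Omega>" "a \<noteq> b" and hom: "is_hom (B {a, b}) \<phi>"
    and \<phi>A: "\<And>x. x \<in> B {a, b} \<Longrightarrow> \<phi> x \<in> A" and m: "m \<in> M"
  shows "\<phi> m = 0"
proof -
  have stab: "{x \<in> carrier G. pact x (a, b) = (a, b)} = B {a, b}" by (auto simp: B_def)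
  have trans: "\<exists>t\<in>carrier G. pact t (a, b) = e" if eI: "e \<in> pairs" for e
  proof -
    obtain i j where e: "e = (i, j)" "i \<in> \<Omega>" "j \<in> \<Omega>" "i \<noteq> j" using eI by (auto simp: pairs_def)
    have "\<exists>t\<in>carrier G. \<forall>r\<in>{a, b}. \<pi> t r = (if r = a then i else j)"
      by (rule transitive_lift) (use ab e card_\<Omega> in auto)
    then show ?thesis using ab e by auto
  qed
  have hom': "is_hom {x \<in> carrier G. pact x (a, b) = (a, b)} \<phi>" using hom stab by simp
  obtain v where v: "cocycle pact pairs v" and va: "\<And>x. x \<in> carrier G \<Longrightarrow> pact x (a, b) = (a, b) \<Longrightarrow> v (a, b) x = \<phi> x"
    and vS: "\<And>i x. i \<in> pairs \<Longrightarrow> x \<in> carrier G \<Longrightarrow> \<exists>y\<in>carrier G. pact y (a, b) = (a, b) \<and> v i x = \<phi> y"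
    by (rule cocycle_induced[OF acts_pairs _ trans hom'], use ab in simp, assumption, rule that)
  have vA: "v e x \<in> A" if ex: "e \<in> pairs" "x \<in> carrier G" for e x
  proof -
    obtain y where y: "y \<in> carrier G" "pact y (a, b) = (a, b)" "v e x = \<phi> y" using vS[OF ex] by blast
    then have "y \<in> B {a, b}" using stab by blast
    then show ?thesis using \<phi>A y(3) by simp
  qed
  have van: "v (a, b) m + \<sigma> (v (b, a) m) = 0" if \<sigma>: "\<sigma> = (\<lambda>x. x) \<or> \<sigma> = uminus" for \<sigma> :: "'c \<Rightarrow> 'c"
  proof -
    define w where "w = (\<lambda>(i, j) x. v (i, j) x + \<sigma> (v (j, i) x))"
    have add: "\<sigma> (x + y) = \<sigma> x + \<sigma> y" "\<sigma> (\<sigma> x) = x" for x y using \<sigma> by auto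
    have sA: "\<sigma> x \<in> A" if "x \<in> A" for x using \<sigma> that A_uminus by auto
    interpret signed_pairs G \<Omega> \<pi> p A \<sigma> w
    proof
      show "\<sigma> = (\<lambda>x. x) \<or> \<sigma> = uminus" by (rule \<sigma>)
      show "cocycle pact pairs w"
        unfolding cocycle_def
      proof (intro ballI)
        fix x y e assume xy: "x \<in> carrier G" "y \<in> carrier G" and "e \<in> pairs"
        then obtain i j where e: "e = (i, j)" "(i, j) \<in> pairs" "(j, i) \<in> pairs" by (auto simp: pairs_def)
        show "w e (x \<otimes> y) = w (pact y e) x + w e y"
          using cocycleD[OF v xy e(2)] cocycleD[OF v xy e(3)] by (simp add: e(1) w_def add)
      qed
      show "w e x \<in> A" if "e \<in> pairs" "x \<in> carrier G" for e x
        using that vA sA by (auto simp: w_def pairs_def intro!: A_add)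
      show "w (j, i) x = \<sigma> (w (i, j) x)" for i j x
        by (simp add: w_def add add.commute)
    qed
    show ?thesis using w_vanishes[OF m, of a b] ab by (simp add: w_def)
  qed
  have "v (a, b) m + v (b, a) m = 0" "v (a, b) m - v (b, a) m = 0"
    using van[of "\<lambda>x. x"] van[of uminus] by auto
  then have "v (a, b) m + v (a, b) m = 0" by simp
  then have "v (a, b) m = 0" using A_half vA ab M_carrier[OF m] by simp
  then show ?thesis using va[of m] M_carrier[OF m] \<pi>_M[OF m] by simp
qed

section \<open>Sylow subgroups of the kernel\<close>

context group
begin

text \<open>The points that are not fixed form orbits whose sizes are powers of p other than
  1.\<close>

lemma p_group_fixed_points:
  assumes p: "Factorial_Ring.prime p" and ord: "order G = p ^ n" and fin: "finite S"
    and closed: "\<And>g s. g \<in> carrier G \<Longrightarrow> s \<in> S \<Longrightarrow> act g s \<in> S"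
    and one: "\<And>s. s \<in> S \<Longrightarrow> act \<one> s = s"
    and mult: "\<And>g h s. g \<in> carrier G \<Longrightarrow> h \<in> carrier G \<Longrightarrow> s \<in> S \<Longrightarrow> act (g \<otimes> h) s = act g (act h s)"
  shows "p dvd card (S - {s \<in> S. \<forall>g\<in>carrier G. act g s = s})"
proof -
  \<comment> \<open>\<open>act\<close> is controlled on \<open>S\<close> only; restriction makes it
    an element of \<open>BijGroup S\<close>.\<close>
  define \<phi> where "\<phi> g = (\<lambda>s\<in>S. act g s)" for g
  have inv1: "act (inv g) (act g s) = s" "act g (act (inv g) s) = s" if "g \<in> carrier G" "s \<in> S" for g s
    using mult[of "inv g" g s] mult[of g "inv g" s] one that by simp_all
  have bij: "\<phi> g \<in> Bij S" if g: "g \<in> carrier G" for g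
  proof -
    have "bij_betw (act g) S S"
      by (rule bij_betwI[where g = "act (inv g)"]) (use inv1 g closed in auto)
    then have "bij_betw (\<phi> g) S S" by (subst bij_betw_cong[of S _ "act g"]) (auto simp: \<phi>_def)
    then show ?thesis by (simp add: Bij_def \<phi>_def)
  qed
  interpret group_action G S \<phi>
    unfolding group_action_def group_hom_def group_hom_axioms_def
  proof (intro conjI)
    show "group (BijGroup S)" by (rule group_BijGroup)
    show "\<phi> \<in> hom G (BijGroup S)"
    proof (rule homI)
      show "\<phi> g \<in> carrier (BijGroup S)" if "g \<in> carrier G" for g using bij[OF that] by (simp add: BijGroup_def)
      fix g h assume gh: "g \<in> carrier G" "h \<in> carrier G"
      have "\<phi> (g \<otimes> h) = compose S (\<phi> g) (\<phi> h)"
        using gh closed mult by (intro ext) (auto simp: \<phi>_def compose_def)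
      then show "\<phi> (g \<otimes> h) = \<phi> g \<otimes>\<^bsub>BijGroup S\<^esub> \<phi> h" using bij gh by (simp add: BijGroup_def)
    qed
  qed (rule is_group)
  let ?F = "{s \<in> S. \<forall>g\<in>carrier G. act g s = s}"
  define orb where "orb s = {act g s |g. g \<in> carrier G}" for s
  have orb: "orbit G \<phi> s = orb s" if "s \<in> S" for s using that by (auto simp: orbit_def orb_def \<phi>_def)
  have orb_self: "s \<in> orb s" if "s \<in> S" for s using one[OF that] one_closed unfolding orb_def by force
  have orb_sub: "orb s \<subseteq> S" if "s \<in> S" for s using that closed by (auto simp: orb_def)
  have orb_eq: "orb t = orb s" if st: "s \<in> S" "t \<in> orb s" for s t
  proof -
    obtain g where g: "g \<in> carrier G" "t = act g s" using st by (auto simp: orb_def)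
    have *: "act h t = act (h \<otimes> g) s" if "h \<in> carrier G" for h using mult[OF that g(1) st(1)] g by simp
    show ?thesis
    proof
      show "orb t \<subseteq> orb s"
      proof
        fix u assume "u \<in> orb t"
        then obtain h where h: "h \<in> carrier G" "u = act h t" by (auto simp: orb_def)
        then show "u \<in> orb s" using *[OF h(1)] m_closed[OF h(1) g(1)] unfolding orb_def by blast
      qed
      show "orb s \<subseteq> orb t"
      proof
        fix u assume "u \<in> orb s"
        then obtain h where h: "h \<in> carrier G" "u = act h s" by (auto simp: orb_def)
        have "act (h \<otimes> inv g) t = u" using *[of "h \<otimes> inv g"] h g by (simp add: m_assoc)
        then show "u \<in> orb t" using h g unfolding orb_def by blast
      qed
    qed
  qed
  have orb_dvd: "p dvd card (orb s)" if s: "s \<in> S - ?F" for s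
  proof -
    have "card (orb s) * card (stabilizer G \<phi> s) = p ^ n"
      using orbit_stabilizer_theorem[of s] orb[of s] s ord by simp
    then have "card (orb s) dvd p ^ n" by (metis dvd_triv_left)
    then obtain i where i: "card (orb s) = p ^ i" using p divides_primepow_nat by blast
    have "i \<noteq> 0"
    proof
      assume "i = 0"
      then obtain u where "orb s = {u}" using i by (auto simp: card_1_singleton_iff)
      then have "act g s = s" if "g \<in> carrier G" for g
        using orb_self[of s] s that unfolding orb_def by auto
      then show False using s by blast
    qed
    then show ?thesis using i by (simp add: dvd_power)
  qed
  have U: "\<Union> (orb ` (S - ?F)) = S - ?F"
  proof
    show "S - ?F \<subseteq> \<Union> (orb ` (S - ?F))" using orb_self by blast
    show "\<Union> (orb ` (S - ?F)) \<subseteq> S - ?F"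
    proof
      fix t assume "t \<in> \<Union> (orb ` (S - ?F))"
      then obtain s where s: "s \<in> S" "s \<notin> ?F" "t \<in> orb s" by blast
      have "t \<notin> ?F"
      proof
        assume t: "t \<in> ?F"
        have "s \<in> orb t" using orb_eq[OF s(1,3)] orb_self[OF s(1)] by simp
        then have "s = t" using t by (auto simp: orb_def)
        then show False using t s by simp
      qed
      then show "t \<in> S - ?F" using orb_sub s by blast
    qed
  qed
  have "p dvd card (\<Union> (orb ` (S - ?F)))"
  proof (rule dvd_partition)
    show "finite (\<Union> (orb ` (S - ?F)))" unfolding U using fin by simp
    show "\<forall>c\<in>orb ` (S - ?F). p dvd card c" using orb_dvd by blast
    show "\<forall>c1\<in>orb ` (S - ?F). \<forall>c2\<in>orb ` (S - ?F). c1 \<noteq> c2 \<longrightarrow> c1 \<inter> c2 = {}"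
    proof (intro ballI impI)
      fix c1 c2 assume c: "c1 \<in> orb ` (S - ?F)" "c2 \<in> orb ` (S - ?F)" "c1 \<noteq> c2"
      then obtain s1 s2 where s: "s1 \<in> S" "c1 = orb s1" "s2 \<in> S" "c2 = orb s2" by blast
      then show "c1 \<inter> c2 = {}" using orb_eq[of s1] orb_eq[of s2] c(3) by blast
    qed
  qed
  then show ?thesis unfolding U .
qed

text \<open>The group acts on itself by conjugation with the centre as fixed points. A trivial
  centre would make p divide p^n - 1.\<close>

lemma p_group_center:
  assumes p: "Factorial_Ring.prime p" and ord: "order G = p ^ n" "n > 0"
  shows "\<exists>z\<in>carrier G. z \<noteq> \<one> \<and> (\<forall>g\<in>carrier G. g \<otimes> z = z \<otimes> g)"
proof (rule ccontr)
  assume n: "\<not> ?thesis"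
  have "p > 0" using p by (simp add: prime_gt_0_nat)
  then have fin: "finite (carrier G)" using ord order_gt_0_iff_finite by simp
  let ?F = "{z \<in> carrier G. \<forall>g\<in>carrier G. g \<otimes> z \<otimes> inv g = z}"
  have "p dvd card (carrier G - ?F)"
    by (rule p_group_fixed_points[OF p ord(1) fin]) (simp_all add: m_assoc inv_mult_group)
  moreover have "?F = {\<one>}"
  proof
    show "?F \<subseteq> {\<one>}"
    proof clarify
      fix z assume z: "z \<in> carrier G" "\<forall>g\<in>carrier G. g \<otimes> z \<otimes> inv g = z"
      have "g \<otimes> z = z \<otimes> g" if "g \<in> carrier G" for g
        using z that by (metis inv_solve_right m_closed)
      then show "z = \<one>" using n z by blast
    qed
  qed simp
  moreover have "card (carrier G - {\<one>}) = p ^ n - 1" using fin ord by (simp add: order_def)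
  ultimately have "p dvd p ^ n - 1" by simp
  moreover have "p dvd p ^ n" using ord by (simp add: dvd_power)
  moreover have "p ^ n > 0" using \<open>p > 0\<close> by simp
  ultimately have "p dvd 1" by (metis One_nat_def Suc_leI dvd_diffD1)
  then show False using p by (simp add: prime_nat_iff)
qed

text \<open>\<open>Q\<close> acts on the right cosets of \<open>P\<close>, whose number is prime to
  p. It therefore fixes some coset \<open>P #> x\<close>, which says that \<open>x\<close>
  conjugates \<open>Q\<close> into \<open>P\<close>.\<close>

lemma sylow_conjugate:
  assumes p: "Factorial_Ring.prime p" and P: "subgroup P G" "card P = p ^ a" and Q: "subgroup Q G" "card Q = p ^ a"
    and ord: "order G = p ^ a * m" "\<not> p dvd m"
  shows "\<exists>x\<in>carrier G. \<forall>y\<in>Q. x \<otimes> y \<otimes> inv x \<in> P"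
proof -
  have p0: "p > 0" using p by (simp add: prime_gt_0_nat)
  let ?S = "rcosets P"
  have "card ?S * p ^ a = m * p ^ a" using lagrange[OF P(1)] P(2) ord by (simp add: mult.commute)
  then have cS: "card ?S = m" using p0 by simp
  have finS: "finite ?S"
  proof (rule ccontr)
    assume "infinite ?S"
    then have "m = 0" using cS by simp
    then show False using ord by simp
  qed
  interpret Qg: group "G\<lparr>carrier := Q\<rparr>" using subgroup_imp_group[OF Q(1)] .
  have Qc: "y \<in> carrier G" if "y \<in> Q" for y using subgroup.mem_carrier[OF Q(1) that] .
  have Pc: "P \<subseteq> carrier G" using subgroup.subset[OF P(1)] .
  \<comment> \<open>The inverse turns right translation into a left action.\<close>
  let ?act = "\<lambda>y C. C #> inv y"
  let ?F = "{C \<in> ?S. \<forall>y\<in>Q. C #> inv y = C}"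
  have coset: "\<exists>x\<in>carrier G. C = P #> x" if "C \<in> ?S" for C using that by (auto simp: RCOSETS_def)
  have "p dvd card (?S - {C \<in> ?S. \<forall>y\<in>carrier (G\<lparr>carrier := Q\<rparr>). C #> inv y = C})"
  proof (rule Qg.p_group_fixed_points[OF p _ finS])
    show "order (G\<lparr>carrier := Q\<rparr>) = p ^ a" using Q by (simp add: order_def)
    show "C #> inv y \<in> ?S" if yC: "y \<in> carrier (G\<lparr>carrier := Q\<rparr>)" "C \<in> ?S" for y C
    proof -
      obtain x where "x \<in> carrier G" "C = P #> x" using coset[OF yC(2)] by blast
      then show ?thesis using yC(1) Qc Pc by (simp add: coset_mult_assoc rcosetsI)
    qed
    show "C #> inv \<one>\<^bsub>G\<lparr>carrier := Q\<rparr>\<^esub> = C" if "C \<in> ?S" for C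
      using coset[OF that] Pc by (auto simp: coset_mult_assoc)
    show "C #> inv (g \<otimes>\<^bsub>G\<lparr>carrier := Q\<rparr>\<^esub> h) = C #> inv h #> inv g"
      if gh: "g \<in> carrier (G\<lparr>carrier := Q\<rparr>)" "h \<in> carrier (G\<lparr>carrier := Q\<rparr>)" "C \<in> ?S" for g h C
    proof -
      obtain x where "x \<in> carrier G" "C = P #> x" using coset[OF gh(3)] by blast
      then show ?thesis using gh(1,2) Qc Pc by (simp add: coset_mult_assoc inv_mult_group m_assoc)
    qed
  qed
  then have d: "p dvd card (?S - ?F)" by simp
  have "?F \<noteq> {}"
  proof
    assume "?F = {}"
    then have "?S - ?F = ?S" by blast
    then have "p dvd card ?S" using d by simp
    then show False using cS ord by simp
  qed
  then obtain C where C: "C \<in> ?S" "\<forall>y\<in>Q. C #> inv y = C" by blast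
  then obtain x where x: "x \<in> carrier G" "C = P #> x" using coset by blast
  have "x \<otimes> y \<otimes> inv x \<in> P" if y: "y \<in> Q" for y
  proof -
    have iy: "inv y \<in> Q" using subgroup.m_inv_closed[OF Q(1) y] .
    have "P #> x #> y = P #> x" using C(2) iy x Qc[OF y] by (metis inv_inv)
    then have "P #> (x \<otimes> y) = P #> x" using coset_mult_assoc[OF Pc x(1) Qc[OF y]] by simp
    moreover have "x \<otimes> y \<in> P #> (x \<otimes> y)" using rcos_self[OF _ P(1)] x Qc[OF y] by simp
    ultimately obtain h where "h \<in> P" "x \<otimes> y = h \<otimes> x" by (auto simp: r_coset_def)
    moreover from this have "x \<otimes> y \<otimes> inv x = h" using x Pc by (simp add: subset_iff inv_solve_right' m_assoc)
    ultimately show ?thesis by simp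
  qed
  then show ?thesis using x by blast
qed

lemma sylow_exists:
  assumes p: "Factorial_Ring.prime p" and fin: "finite (carrier G)"
  obtains P where "subgroup P G" "card P = p ^ multiplicity p (order G)"
proof -
  have "order G \<noteq> 0" using fin order_gt_0_iff_finite by simp
  then obtain m where "order G = p ^ multiplicity p (order G) * m"
    using multiplicity_dvd[of p "order G"] by (auto simp: dvd_def)
  then show thesis using sylow_thm[OF p is_group _ fin] that by blast
qed

lemma card_subgroup_dvd:
  assumes "subgroup H G" "subgroup K G" "H \<subseteq> K" shows "card H dvd card K"
proof -
  interpret K: group "G\<lparr>carrier := K\<rparr>" using subgroup_imp_group[OF assms(2)] .
  have "subgroup H (G\<lparr>carrier := K\<rparr>)" using subgroup_incl[OF assms] .
  from K.lagrange[OF this] have "card (rcosets\<^bsub>G\<lparr>carrier := K\<rparr>\<^esub> H) * card H = card K"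
    by (simp add: order_def)
  then show ?thesis by (metis dvd_triv_right)
qed

text \<open>The full power of every prime in the order of \<open>K\<close> divides the order of the
  intersection, so the orders agree.\<close>

lemma subgroup_all_sylows:
  assumes D: "subgroup D G" and K: "subgroup K G" "finite K"
    and syl: "\<And>p. Factorial_Ring.prime p \<Longrightarrow> \<exists>P. subgroup P G \<and> card P = p ^ multiplicity p (card K) \<and> P \<subseteq> D \<inter> K"
  shows "K \<subseteq> D"
proof -
  have DK: "subgroup (D \<inter> K) G" using subgroups_Inter_pair[OF D K(1)] .
  have fin: "finite (D \<inter> K)" using K by simp
  have c0: "card (D \<inter> K) \<noteq> 0" "card K \<noteq> 0" using fin K(2) subgroup.one_closed[OF DK] by auto
  have "card K dvd card (D \<inter> K)"
  proof (rule multiplicity_le_imp_dvd[OF c0(2)])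
    fix p :: nat assume p: "Factorial_Ring.prime p"
    obtain P where "subgroup P G" "card P = p ^ multiplicity p (card K)" "P \<subseteq> D \<inter> K" using syl[OF p] by blast
    then have "p ^ multiplicity p (card K) dvd card (D \<inter> K)" using card_subgroup_dvd[OF _ DK] by metis
    then show "multiplicity p (card K) \<le> multiplicity p (card (D \<inter> K))"
      using c0 p by (intro multiplicity_geI) auto
  qed
  then have "card K \<le> card (D \<inter> K)" using c0 by (intro dvd_imp_le) auto
  then have "D \<inter> K = K" using K(2) by (intro card_subset_eq) (auto intro: card_mono antisym)
  then show ?thesis by blast
qed

end

\<comment> \<open>The rationals modulo the integers: one type with elements of every prime order.
  The relevant prime appears only inside the proof of \<open>no_small_supplement\<close>, where no
  new type can be made for it.\<close>
quotient_type circle = rat / "\<lambda>x y :: rat. x - y \<in> \<int>"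
proof (rule equivpI)
  show "reflp (\<lambda>x y :: rat. x - y \<in> \<int>)" by (simp add: reflp_def)
  show "symp (\<lambda>x y :: rat. x - y \<in> \<int>)" by (rule sympI) (metis Ints_minus minus_diff_eq)
  show "transp (\<lambda>x y :: rat. x - y \<in> \<int>)"
    by (rule transpI) (metis Ints_add diff_add_cancel add_diff_eq)
qed

instantiation circle :: ab_group_add
begin

lift_definition zero_circle :: circle is 0 .

lift_definition plus_circle :: "circle \<Rightarrow> circle \<Rightarrow> circle" is "(+)"
  by (metis Ints_add add_diff_add)

lift_definition uminus_circle :: "circle \<Rightarrow> circle" is uminus
  by (metis Ints_minus minus_diff_minus)

definition minus_circle :: "circle \<Rightarrow> circle \<Rightarrow> circle" where "minus_circle x y = x + - y"

instance
proof
  fix a b c :: circle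
  show "a + b + c = a + (b + c)" by transfer (simp add: add.assoc)
  show "a + b = b + a" by transfer (simp add: add.commute)
  show "0 + a = a" by transfer simp
  show "- a + a = 0" by transfer simp
  show "a - b = a + - b" by (rule minus_circle_def)
qed

end

lift_definition circle_of :: "rat \<Rightarrow> circle" is "\<lambda>x. x" .

lemma nsm_circle_of: "nsm n (circle_of x) = circle_of (of_nat n * x)"
proof (induction n)
  case 0
  show ?case by simp (transfer, simp)
next
  case (Suc n)
  then show ?case by simp (transfer, simp add: algebra_simps)
qed

lemma circle_of_eq_0: "circle_of x = 0 \<longleftrightarrow> x \<in> \<int>"
  by transfer simp

lemma circle_torsion_exists:
  assumes "Factorial_Ring.prime q" shows "\<exists>c :: circle. c \<noteq> 0 \<and> nsm q c = 0"
proof (intro exI conjI)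
  have q: "q > 1" using assms prime_gt_1_nat by blast
  have "(1 / of_nat q :: rat) \<notin> \<int>"
  proof
    assume "(1 / of_nat q :: rat) \<in> \<int>"
    then obtain n where n: "(1 / of_nat q :: rat) = of_int n" by (auto elim: Ints_cases)
    have "0 < (1 / of_nat q :: rat)" "(1 / of_nat q :: rat) < 1" using q by simp_all
    then show False unfolding n by simp
  qed
  then show "circle_of (1 / of_nat q) \<noteq> 0" by (simp add: circle_of_eq_0)
  show "nsm q (circle_of (1 / of_nat q)) = 0" using q by (simp add: nsm_circle_of circle_of_eq_0)
qed

lemma prime_order_subgroup_multiples:
  assumes q: "Factorial_Ring.prime q" and c: "c \<noteq> 0" "nsm q c = 0"
  shows "prime_order_subgroup q {nsm n c |n. True}"
proof
  have qm: "nsm (n * q) c = 0" for n using c(2) by (simp add: nsm_mult)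
  show "0 \<in> {nsm n c |n. True}" by (auto intro: exI[of _ 0])
  show "nsm q x = 0" if "x \<in> {nsm n c |n. True}" for x
    using that qm by (auto simp: nsm_mult[symmetric] mult.commute)
  have minus: "- nsm n c = nsm (n * (q - 1)) c" for n
  proof -
    have "n + n * (q - 1) = n * q" using prime_gt_0_nat[OF q] by (simp add: algebra_simps)
    then have "nsm n c + nsm (n * (q - 1)) c = 0" using qm[of n] by (metis nsm_add)
    then show ?thesis by (simp add: eq_neg_iff_add_eq_0 minus_unique)
  qed
  show "x - y \<in> {nsm n c |n. True}" if xy: "x \<in> {nsm n c |n. True}" "y \<in> {nsm n c |n. True}" for x y
  proof -
    obtain m n where "x = nsm m c" "y = nsm n c" using xy by blast
    then have "x - y = nsm (m + n * (q - 1)) c" using minus[of n] by (simp add: nsm_add)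
    then show ?thesis by blast
  qed
  show "\<exists>n. y = nsm n x" if xy: "x \<in> {nsm n c |n. True}" "x \<noteq> 0" "y \<in> {nsm n c |n. True}" for x y
  proof -
    obtain m n where mn: "x = nsm m c" "y = nsm n c" using xy by blast
    have "\<not> q dvd m"
    proof
      assume "q dvd m"
      then have "x = 0" using mn qm by (auto simp: mult.commute)
      then show False using xy by simp
    qed
    then have "coprime m q" using prime_imp_coprime[OF q] by (simp add: coprime_commute)
    moreover have "m \<noteq> 0" using \<open>\<not> q dvd m\<close> by (metis dvd_0_right)
    ultimately obtain u v where "m * u = q * v + 1" using bezout_nat[of m q] by auto
    then have "nsm (u * m) c = nsm (v * q + 1) c" by (simp add: mult.commute)
    then have "nsm u x = c" using qm by (simp add: nsm_mult nsm_add mn)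
    then have "nsm (n * u) x = y" by (simp add: nsm_mult mn)
    then show ?thesis by blast
  qed
qed (rule q)

section \<open>Conjugation, normalizers and the Frattini argument\<close>

lemma (in group) conj_inj: "g \<in> carrier G \<Longrightarrow> S \<subseteq> carrier G \<Longrightarrow> inj_on (\<lambda>x. g \<otimes> x \<otimes> inv g) S"
  by (intro inj_onI) (simp add: subset_iff)

lemma (in group) conj_subgroup:
  assumes P: "subgroup P G" and g: "g \<in> carrier G" shows "subgroup ((\<lambda>x. g \<otimes> x \<otimes> inv g) ` P) G"
proof (rule subgroupI)
  have Pc: "x \<in> carrier G" if "x \<in> P" for x using subgroup.mem_carrier[OF P that] .
  show "(\<lambda>x. g \<otimes> x \<otimes> inv g) ` P \<subseteq> carrier G" using Pc g by auto
  show "(\<lambda>x. g \<otimes> x \<otimes> inv g) ` P \<noteq> {}" using subgroup.one_closed[OF P] by blast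
  show "inv a \<in> (\<lambda>x. g \<otimes> x \<otimes> inv g) ` P" if a: "a \<in> (\<lambda>x. g \<otimes> x \<otimes> inv g) ` P" for a
  proof -
    obtain x where x: "x \<in> P" "a = g \<otimes> x \<otimes> inv g" using a by blast
    then have "inv a = g \<otimes> inv x \<otimes> inv g" using Pc g by (simp add: group_word)
    then show ?thesis using subgroup.m_inv_closed[OF P x(1)] by blast
  qed
  show "a \<otimes> b \<in> (\<lambda>x. g \<otimes> x \<otimes> inv g) ` P"
    if ab: "a \<in> (\<lambda>x. g \<otimes> x \<otimes> inv g) ` P" "b \<in> (\<lambda>x. g \<otimes> x \<otimes> inv g) ` P" for a b
  proof -
    obtain x y where x: "x \<in> P" "a = g \<otimes> x \<otimes> inv g" "y \<in> P" "b = g \<otimes> y \<otimes> inv g" using ab by blast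
    then have "a \<otimes> b = g \<otimes> (x \<otimes> y) \<otimes> inv g" using Pc g by (simp add: group_word)
    then show ?thesis using subgroup.m_closed[OF P x(1,3)] by blast
  qed
qed

text \<open>Conjugation by such an element maps the finite set into itself and injectively, hence
  onto itself, so inverses qualify too.\<close>

lemma (in group) normalizer_subgroup:
  assumes fin: "finite P" and P: "P \<subseteq> carrier G"
  shows "subgroup {g \<in> carrier G. \<forall>x\<in>P. g \<otimes> x \<otimes> inv g \<in> P} G"
proof (rule subgroupI)
  let ?N = "{g \<in> carrier G. \<forall>x\<in>P. g \<otimes> x \<otimes> inv g \<in> P}"
  have Pc: "x \<in> carrier G" if "x \<in> P" for x using P that by blast
  have "\<one> \<in> ?N" using Pc by simp
  then show "?N \<noteq> {}" by blast
  show "a \<otimes> b \<in> ?N" if ab: "a \<in> ?N" "b \<in> ?N" for a b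
  proof -
    have "a \<otimes> b \<otimes> x \<otimes> inv (a \<otimes> b) = a \<otimes> (b \<otimes> x \<otimes> inv b) \<otimes> inv a" if "x \<in> P" for x
      using ab Pc[OF that] by (simp add: group_word)
    then show ?thesis using ab by simp
  qed
  show "inv a \<in> ?N" if a: "a \<in> ?N" for a
  proof -
    have ac: "a \<in> carrier G" using a by simp
    have im: "(\<lambda>x. a \<otimes> x \<otimes> inv a) ` P = P"
      using a conj_inj[OF ac P] fin by (intro endo_inj_surj) auto
    have "inv a \<otimes> x \<otimes> a \<in> P" if x: "x \<in> P" for x
    proof -
      obtain y where y: "y \<in> P" "x = a \<otimes> y \<otimes> inv a" using x im by blast
      then have "inv a \<otimes> x \<otimes> a = y" using ac Pc by (simp add: group_word)
      then show ?thesis using y by simp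
    qed
    then show ?thesis using ac by simp
  qed
qed simp

context alt_ext
begin

lemma M_normal_cover:
  assumes "subgroup K G" "\<And>g. g \<in> carrier G \<Longrightarrow> \<exists>m\<in>M. m \<otimes> g \<in> K"
  shows "K = carrier G"
proof (rule frattini[OF assms(1)])
  show "\<pi> ` K = Alt \<Omega>"
  proof
    show "\<pi> ` K \<subseteq> Alt \<Omega>" using subgroup.mem_carrier[OF assms(1)] \<pi>_Alt by blast
    show "Alt \<Omega> \<subseteq> \<pi> ` K"
    proof
      fix a assume "a \<in> Alt \<Omega>"
      then obtain g where g: "g \<in> carrier G" "\<pi> g = a" using \<pi>_lift by blast
      obtain m where m: "m \<in> M" "m \<otimes> g \<in> K" using assms(2)[OF g(1)] by blast
      have "\<pi> (m \<otimes> g) = a" using g m M_carrier \<pi>_M by (simp add: \<pi>_mult)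
      then show "a \<in> \<pi> ` K" using m by blast
    qed
  qed
qed

lemma finM: "finite M"
  using finG finite_subset[of M "carrier G"] M_carrier by blast

text \<open>Frattini's argument: a conjugate of \<open>P\<close> is again Sylow in \<open>M\<close>,
  so an element of \<open>M\<close> conjugates it back to \<open>P\<close>. The normalizer of
  \<open>P\<close> is thus a supplement of \<open>M\<close> and hence the whole group.\<close>

lemma sylow_normal:
  assumes p: "Factorial_Ring.prime p" and P: "subgroup P G" "P \<subseteq> M" "card P = p ^ multiplicity p (card M)"
    and g: "g \<in> carrier G" "x \<in> P"
  shows "g \<otimes> x \<otimes> inv g \<in> P"
proof -
  let ?N = "{g \<in> carrier G. \<forall>x\<in>P. g \<otimes> x \<otimes> inv g \<in> P}"
  have Pc: "P \<subseteq> carrier G" using subgroup.subset[OF P(1)] .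
  have finP: "finite P" using finG Pc finite_subset by blast
  interpret Mg: group "G\<lparr>carrier := M\<rparr>" using subgroup_imp_group[OF M_subgroup] .
  have cM: "card M \<noteq> 0" using finM M_one by auto
  obtain r where r: "card M = p ^ multiplicity p (card M) * r" "\<not> p dvd r"
    using multiplicity_decompose'[of "card M" p] cM p by (metis not_prime_unit)
  have "\<exists>m\<in>M. m \<otimes> g \<in> ?N" if g: "g \<in> carrier G" for g
  proof -
    let ?Q = "(\<lambda>x. g \<otimes> x \<otimes> inv g) ` P"
    have "?Q \<subseteq> M" using M_conj[OF g] P(2) by blast
    then have Q: "subgroup ?Q (G\<lparr>carrier := M\<rparr>)" by (rule subgroup_incl[OF conj_subgroup[OF P(1) g] M_subgroup])
    have "card ?Q = p ^ multiplicity p (card M)" using card_image[OF conj_inj[OF g Pc]] P(3) by simp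
    then have "\<exists>m\<in>carrier (G\<lparr>carrier := M\<rparr>). \<forall>y\<in>?Q. m \<otimes>\<^bsub>G\<lparr>carrier := M\<rparr>\<^esub> y \<otimes>\<^bsub>G\<lparr>carrier := M\<rparr>\<^esub> inv\<^bsub>G\<lparr>carrier := M\<rparr>\<^esub> m \<in> P"
      using Mg.sylow_conjugate[OF p subgroup_incl[OF P(1) M_subgroup P(2)] P(3) Q] r by (simp add: order_def)
    then obtain m where m: "m \<in> M" "\<forall>y\<in>?Q. m \<otimes> y \<otimes> inv m \<in> P"
      using m_inv_consistent[OF M_subgroup] by auto
    have "m \<otimes> g \<otimes> x \<otimes> inv (m \<otimes> g) \<in> P" if x: "x \<in> P" for x
    proof -
      have "m \<otimes> g \<otimes> x \<otimes> inv (m \<otimes> g) = m \<otimes> (g \<otimes> x \<otimes> inv g) \<otimes> inv m"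
        using x Pc g M_carrier[OF m(1)] by (simp add: subset_iff group_word)
      then show ?thesis using m(2) x by simp
    qed
    then show ?thesis using m(1) M_carrier g by (intro bexI[of _ m]) auto
  qed
  then have "?N = carrier G" by (rule M_normal_cover[OF normalizer_subgroup[OF finP Pc]])
  then show ?thesis using g by blast
qed

end

section \<open>Supplements of small index\<close>

lemma card_le_image_times_fibre:
  assumes "finite S" "\<And>x. x \<in> S \<Longrightarrow> card {y \<in> S. f y = f x} \<le> n"
  shows "card S \<le> card (f ` S) * n"
proof -
  have "card S = (\<Sum>c\<in>f ` S. card {x \<in> S. f x = c})"
    using sum.image_gen[OF assms(1), of "\<lambda>_. 1::nat" f] by simp
  also have "\<dots> \<le> (\<Sum>c\<in>f ` S. n)" using assms(2) by (intro sum_mono) auto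
  finally show ?thesis by simp
qed

lemma Alt_conj_Diff:
  assumes "finite \<Omega>" "E \<subseteq> \<Omega>" "g \<in> Alt \<Omega>" "y \<in> Alt (\<Omega> - g ` E)"
  shows "inv' g \<circ> y \<circ> g \<in> Alt (\<Omega> - E)"
proof -
  have "g ` E \<subseteq> \<Omega>" using assms(2) Alt_in_image[OF assms(3)] by auto
  then have y: "y \<in> Alt \<Omega>" "\<And>x. x \<in> E \<Longrightarrow> y (g x) = g x" using assms(4) by (auto simp: Alt_Diff_iff)
  have "inv' g \<circ> y \<circ> g \<in> Alt \<Omega>" by (intro Alt_comp[OF assms(1)] Alt_inv[OF assms(1)] assms(3) y(1))
  moreover have "(inv' g \<circ> y \<circ> g) x = x" if "x \<in> E" for x
    using y(2)[OF that] Alt_bij[OF assms(3)] by (simp add: bij_is_inj)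
  ultimately show ?thesis using assms(2) by (subst Alt_Diff_iff) auto
qed

context alt_ext
begin

text \<open>The orbit of \<open>z\<close> in \<open>Z\<close> modulo \<open>N\<close> is small, so
  by \<open>small_index_alt\<close> the coset of \<open>z\<close> is fixed by all even permutations
  off some pair \<open>E1\<close>. Take three translates with disjoint pairs. Their product
  \<open>w\<close> has such a pair too, and it misses one of the three, say that of
  \<open>u\<close>. As a product of \<open>w\<close> and inverses of the other two, \<open>u\<close>
  is also fixed by the even permutations off six points disjoint from its own pair. The two groups
  generate everything, so \<open>u\<close>, and with it \<open>z\<close>, is central modulo
  \<open>N\<close>.\<close>

lemma small_quotient_central:
  assumes ab: "a \<in> \<Omega>" "b \<in> \<Omega>" "a \<noteq> b"
    and N: "subgroup N G" and Z: "subgroup Z G" and NZ: "N \<subseteq> Z" and ZM: "Z \<subseteq> M"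
    and Nn: "\<And>g x. g \<in> B {a, b} \<Longrightarrow> x \<in> N \<Longrightarrow> g \<otimes> x \<otimes> inv g \<in> N"
    and Zn: "\<And>g x. g \<in> B {a, b} \<Longrightarrow> x \<in> Z \<Longrightarrow> g \<otimes> x \<otimes> inv g \<in> Z"
    and MZ: "\<And>m z. m \<in> M \<Longrightarrow> z \<in> Z \<Longrightarrow> m \<otimes> z \<otimes> inv m \<otimes> inv z \<in> N"
    and small: "card Z < (card (\<Omega> - {a, b}) choose 3) * card N"
    and g: "g \<in> B {a, b}" and z: "z \<in> Z"
  shows "g \<otimes> z \<otimes> inv g \<otimes> inv z \<in> N"
proof -
  let ?B = "B {a, b}"
  let ?\<Omega> = "\<Omega> - {a, b}"
  have ab\<Omega>: "{a, b} \<subseteq> \<Omega>" using ab by blast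
  have fin: "finite ?\<Omega>" using fin\<Omega> by simp
  have card21: "card ?\<Omega> \<ge> 21" using card_\<Omega> ab fin\<Omega> by simp
  have Zc: "x \<in> carrier G" if "x \<in> Z" for x using subgroup.mem_carrier[OF Z that] .
  have Nc: "x \<in> carrier G" if "x \<in> N" for x using subgroup.mem_carrier[OF N that] .
  have ZB: "x \<in> ?B" if "x \<in> Z" for x using that ZM M_B by blast
  note Nm = subgroup.m_closed[OF N] and Ni = subgroup.m_inv_closed[OF N]
  note Bc = B_carrier[of _ "{a, b}"]
  have Nn': "inv g \<otimes> x \<otimes> g \<in> N" if "g \<in> ?B" "x \<in> N" for g x
    using Nn[OF B_inv[OF that(1)] that(2)] Bc[OF that(1)] by simp
  define Fix where "Fix g z \<longleftrightarrow> g \<otimes> z \<otimes> inv g \<otimes> inv z \<in> N" for g z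
  have Fix_mult: "Fix g (y \<otimes> z)" if gyz: "g \<in> ?B" "y \<in> Z" "z \<in> Z" "Fix g y" "Fix g z" for g y z
  proof -
    have "g \<otimes> (y \<otimes> z) \<otimes> inv g \<otimes> inv (y \<otimes> z) = (g \<otimes> y \<otimes> inv g \<otimes> inv y) \<otimes> (y \<otimes> (g \<otimes> z \<otimes> inv g \<otimes> inv z) \<otimes> inv y)"
      using gyz Zc Bc by (simp add: group_word)
    then show ?thesis using Nm[OF _ Nn[OF ZB[OF gyz(2)]]] gyz(4,5) by (simp add: Fix_def)
  qed
  have Fix_inv: "Fix g (inv z)" if gz: "g \<in> ?B" "z \<in> Z" "Fix g z" for g z
  proof -
    have "g \<otimes> inv z \<otimes> inv g \<otimes> inv (inv z) = inv (inv z \<otimes> (g \<otimes> z \<otimes> inv g \<otimes> inv z) \<otimes> z)"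
      using gz Zc Bc by (simp add: group_word)
    then show ?thesis using Ni[OF Nn'[OF ZB[OF gz(2)]]] gz(3) by (simp add: Fix_def)
  qed
  have Fix_comp: "Fix (g \<otimes> h) z" if gh: "g \<in> ?B" "h \<in> ?B" "z \<in> Z" "Fix g z" "Fix h z" for g h z
  proof -
    have "(g \<otimes> h) \<otimes> z \<otimes> inv (g \<otimes> h) \<otimes> inv z = (g \<otimes> (h \<otimes> z \<otimes> inv h \<otimes> inv z) \<otimes> inv g) \<otimes> (g \<otimes> z \<otimes> inv g \<otimes> inv z)"
      using gh Zc Bc by (simp add: group_word)
    then show ?thesis using Nm[OF Nn[OF gh(1)]] gh(4,5) by (simp add: Fix_def)
  qed
  have Fix_cinv: "Fix (inv g) z" if gh: "g \<in> ?B" "z \<in> Z" "Fix g z" for g z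
  proof -
    have "inv g \<otimes> z \<otimes> inv (inv g) \<otimes> inv z = inv g \<otimes> inv (g \<otimes> z \<otimes> inv g \<otimes> inv z) \<otimes> g"
      using gh Zc Bc by (simp add: group_word)
    then show ?thesis using Nn'[OF gh(1) Ni] gh(3) by (simp add: Fix_def)
  qed
  have Fix_conj: "Fix (h \<otimes> g \<otimes> inv h) (h \<otimes> z \<otimes> inv h)" if gh: "g \<in> ?B" "h \<in> ?B" "z \<in> Z" "Fix g z" for g h z
  proof -
    have "(h \<otimes> g \<otimes> inv h) \<otimes> (h \<otimes> z \<otimes> inv h) \<otimes> inv (h \<otimes> g \<otimes> inv h) \<otimes> inv (h \<otimes> z \<otimes> inv h)
        = h \<otimes> (g \<otimes> z \<otimes> inv g \<otimes> inv z) \<otimes> inv h"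
      using gh Zc Bc by (simp add: group_word)
    then show ?thesis using Nn[OF gh(2)] gh(4) by (simp add: Fix_def)
  qed
  \<comment> \<open>The stabilizer of the coset of \<open>z\<close>. By \<open>FixL\<close> it does
    not matter which lift is tested, since \<open>M\<close> acts trivially on the cosets.\<close>
  define L where "L z = \<pi> ` {g \<in> ?B. Fix g z}" for z
  have LI: "\<pi> g \<in> L z" if "g \<in> ?B" "Fix g z" for g z unfolding L_def using that by blast
  have FixL: "Fix g z" if gz: "g \<in> ?B" "z \<in> Z" "\<pi> g \<in> L z" for g z
  proof -
    obtain h where h: "h \<in> ?B" "Fix h z" "\<pi> g = \<pi> h" using gz(3) by (auto simp: L_def)
    have m: "inv h \<otimes> g \<in> M" using \<pi>_eq_M' Bc gz(1) h by blast
    have "Fix (h \<otimes> (inv h \<otimes> g)) z"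
      using Fix_comp[OF h(1) M_B[OF m] gz(2) h(2)] MZ[OF m gz(2)] by (simp add: Fix_def)
    then show ?thesis using h gz Bc by (simp add: group_word)
  qed
  have Lsub: "alt_subgroup ?\<Omega> (L z)" if z: "z \<in> Z" for z
    unfolding alt_subgroup_def
  proof (intro conjI ballI)
    show "L z \<subseteq> Alt ?\<Omega>" unfolding L_def using \<pi>_B[OF ab\<Omega>] by blast
    have "Fix \<one> z" using Zc[OF z] subgroup.one_closed[OF N] by (simp add: Fix_def)
    then show "id \<in> L z" using LI[OF B_one] \<pi>_one by simp
    fix p assume "p \<in> L z"
    then obtain g where g: "g \<in> ?B" "Fix g z" "p = \<pi> g" by (auto simp: L_def)
    show "inv' p \<in> L z"
      using LI[OF B_inv[OF g(1)] Fix_cinv[OF g(1) z g(2)]] \<pi>_inv[OF Bc[OF g(1)]] g(3) by simp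
    fix q assume "q \<in> L z"
    then obtain h where h: "h \<in> ?B" "Fix h z" "q = \<pi> h" by (auto simp: L_def)
    show "p \<circ> q \<in> L z"
      using LI[OF B_mult[OF g(1) h(1)] Fix_comp[OF g(1) h(1) z g(2) h(2)]] \<pi>_mult[OF Bc[OF g(1)] Bc[OF h(1)]] g(3) h(3)
      by simp
  qed
  have finZ: "finite Z" using ZM finM finite_subset by blast
  have index: "card (Alt ?\<Omega>) < (card ?\<Omega> choose 3) * card (L z)" if z: "z \<in> Z" for z
  proof -
    have "\<exists>g. g \<in> ?B \<and> \<pi> g = s" if "s \<in> Alt ?\<Omega>" for s using B_lift[OF ab\<Omega> that] by blast
    then obtain l where l: "\<And>s. s \<in> Alt ?\<Omega> \<Longrightarrow> l s \<in> ?B \<and> \<pi> (l s) = s" by metis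
    \<comment> \<open>Sends \<open>s\<close> to the corresponding translate of the coset of
      \<open>z\<close>. Its fibres lie in left cosets of \<open>L z\<close>, and it takes at most as
      many values as \<open>N\<close> has cosets in \<open>Z\<close>.\<close>
    define f where "f s = N #> (l s \<otimes> z \<otimes> inv (l s))" for s
    have finL: "finite (L z)" using alt_subgroupD(1)[OF Lsub[OF z]] finite_Alt[OF fin] finite_subset by blast
    have "card {t \<in> Alt ?\<Omega>. f t = f s} \<le> card (L z)" if s: "s \<in> Alt ?\<Omega>" for s
    proof -
      have "{t \<in> Alt ?\<Omega>. f t = f s} \<subseteq> (\<lambda>q. s \<circ> q) ` L z"
      proof clarify
        fix t assume t: "t \<in> Alt ?\<Omega>" "f t = f s"
        have lc: "l s \<in> carrier G" "l t \<in> carrier G" "l s \<in> ?B" "l t \<in> ?B" using l s t Bc by blast+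
        have "l t \<otimes> z \<otimes> inv (l t) \<in> N #> (l t \<otimes> z \<otimes> inv (l t))" using rcos_self[OF _ N] lc Zc[OF z] by simp
        then have "l t \<otimes> z \<otimes> inv (l t) \<in> N #> (l s \<otimes> z \<otimes> inv (l s))" using t(2) by (simp add: f_def)
        then obtain n where n: "n \<in> N" "l t \<otimes> z \<otimes> inv (l t) = n \<otimes> (l s \<otimes> z \<otimes> inv (l s))"
          by (auto simp: r_coset_def)
        have "(l t \<otimes> z \<otimes> inv (l t)) \<otimes> inv (l s \<otimes> z \<otimes> inv (l s)) = n"
          unfolding n(2) using n(1) lc Zc[OF z] Nc by (simp add: group_word)
        then have "inv (l s) \<otimes> ((l t \<otimes> z \<otimes> inv (l t)) \<otimes> inv (l s \<otimes> z \<otimes> inv (l s))) \<otimes> l s \<in> N"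
          using Nn'[OF lc(3) n(1)] by simp
        then have "Fix (inv (l s) \<otimes> l t) z"
          using lc Zc[OF z] by (simp add: Fix_def group_word)
        then have "\<pi> (inv (l s) \<otimes> l t) \<in> L z" unfolding L_def using B_mult[OF B_inv[OF lc(3)] lc(4)] by blast
        moreover have "\<pi> (inv (l s) \<otimes> l t) = inv' s \<circ> t" using lc l s t by (simp add: \<pi>_mult \<pi>_inv)
        moreover have "t = s \<circ> (inv' s \<circ> t)" using Alt_bij[OF s] by (auto simp: fun_eq_iff bij_is_surj surj_f_inv_f)
        ultimately show "t \<in> (\<lambda>q. s \<circ> q) ` L z" by (metis imageI)
      qed
      then have "card {t \<in> Alt ?\<Omega>. f t = f s} \<le> card ((\<lambda>q. s \<circ> q) ` L z)" using finL by (intro card_mono) auto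
      also have "\<dots> \<le> card (L z)" using finL by (rule card_image_le)
      finally show ?thesis .
    qed
    then have 1: "card (Alt ?\<Omega>) \<le> card (f ` Alt ?\<Omega>) * card (L z)"
      by (rule card_le_image_times_fibre[OF finite_Alt[OF fin]])
    interpret Zg: group "G\<lparr>carrier := Z\<rparr>" using subgroup_imp_group[OF Z] .
    have rc: "rcosets\<^bsub>G\<lparr>carrier := Z\<rparr>\<^esub> N = (\<lambda>x. N #> x) ` Z" by (auto simp: RCOSETS_def r_coset_def)
    have "f ` Alt ?\<Omega> \<subseteq> (\<lambda>x. N #> x) ` Z" unfolding f_def using Zn z l by blast
    then have "card (f ` Alt ?\<Omega>) \<le> card ((\<lambda>x. N #> x) ` Z)" using finZ by (intro card_mono) auto
    moreover have "card ((\<lambda>x. N #> x) ` Z) * card N = card Z"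
      using Zg.lagrange[OF subgroup_incl[OF N Z NZ]] by (simp add: rc order_def)
    ultimately have "card (f ` Alt ?\<Omega>) * card N \<le> card Z" by (metis mult_le_mono1)
    then have "card (f ` Alt ?\<Omega>) * card N < (card ?\<Omega> choose 3) * card N" using small by linarith
    then have 2: "card (f ` Alt ?\<Omega>) < (card ?\<Omega> choose 3)" by simp
    have "card (L z) > 0" using finL alt_subgroupD(2)[OF Lsub[OF z]] card_gt_0_iff by blast
    then have "card (f ` Alt ?\<Omega>) * card (L z) < (card ?\<Omega> choose 3) * card (L z)" using 2 by simp
    then show ?thesis using 1 by linarith
  qed
  have support: "\<exists>E. E \<subseteq> ?\<Omega> \<and> card E = 2 \<and> Alt (?\<Omega> - E) \<subseteq> L z" if z: "z \<in> Z" for z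
  proof -
    obtain C where C: "C \<subseteq> ?\<Omega>" "card ?\<Omega> \<le> card C + 2" "Alt C \<subseteq> L z"
      by (rule small_index_alt[OF fin Lsub[OF z] card21 index[OF z]], rule that)
    have "card (?\<Omega> - C) \<le> 2" using C(1,2) fin by (simp add: card_Diff_subset finite_subset)
    then obtain E where E: "?\<Omega> - C \<subseteq> E" "E \<subseteq> ?\<Omega>" "card E = 2"
      using exists_subset_between[of "?\<Omega> - C" 2 ?\<Omega>] fin card21 by auto
    have "?\<Omega> - E \<subseteq> C" using E(1) by blast
    then have "Alt (?\<Omega> - E) \<subseteq> L z" using Alt_mono C(3) by blast
    then show ?thesis using E by blast
  qed
  have move: "Alt (?\<Omega> - \<pi> h ` E) \<subseteq> L (h \<otimes> z \<otimes> inv h)"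
    if h: "h \<in> ?B" and z: "z \<in> Z" and E: "E \<subseteq> ?\<Omega>" "Alt (?\<Omega> - E) \<subseteq> L z" for h z E
  proof
    fix y assume y: "y \<in> Alt (?\<Omega> - \<pi> h ` E)"
    have h\<Omega>: "\<pi> h \<in> Alt ?\<Omega>" using h \<pi>_B[OF ab\<Omega>] by blast
    have "y \<in> Alt ?\<Omega>" using y Alt_mono[of "?\<Omega> - \<pi> h ` E" ?\<Omega>] by blast
    then obtain t where t: "t \<in> ?B" "\<pi> t = y" using B_lift[OF ab\<Omega>] by blast
    have c: "h \<in> carrier G" "t \<in> carrier G" using Bc h t by blast+
    have "\<pi> (inv h \<otimes> t \<otimes> h) = inv' (\<pi> h) \<circ> y \<circ> \<pi> h" using c t by (simp add: \<pi>_mult \<pi>_inv)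
    then have "\<pi> (inv h \<otimes> t \<otimes> h) \<in> L z" using Alt_conj_Diff[OF fin E(1) h\<Omega> y] E(2) by auto
    then have "Fix (inv h \<otimes> t \<otimes> h) z" using FixL[OF _ z] B_mult[OF B_mult[OF B_inv[OF h] t(1)] h] by blast
    then have "Fix (h \<otimes> (inv h \<otimes> t \<otimes> h) \<otimes> inv h) (h \<otimes> z \<otimes> inv h)"
      using Fix_conj[OF _ h z] B_mult[OF B_mult[OF B_inv[OF h] t(1)] h] by blast
    then have "Fix t (h \<otimes> z \<otimes> inv h)" using c by (simp add: group_word)
    then show "y \<in> L (h \<otimes> z \<otimes> inv h)" unfolding L_def using t by blast
  qed
  have join: "Alt ?\<Omega> \<subseteq> L u"
    if u: "u \<in> Z" and E: "E \<subseteq> ?\<Omega>" "card E = 2" "Alt (?\<Omega> - E) \<subseteq> L u" and F: "finite F" "card F \<le> 6" "Alt (?\<Omega> - F) \<subseteq> L u"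
      and EF: "E \<inter> F = {}" for u E F
  proof -
    have finE: "finite E" using E(1) fin finite_subset by blast
    have cE: "card (?\<Omega> - E) = card ?\<Omega> - 2" using E finE by (simp add: card_Diff_subset)
    have cF: "card (?\<Omega> - F) \<ge> card ?\<Omega> - 6" using F(1,2) diff_card_le_card_Diff[of F ?\<Omega>] by linarith
    have "(?\<Omega> - E) \<inter> (?\<Omega> - F) \<noteq> {}"
    proof
      assume "(?\<Omega> - E) \<inter> (?\<Omega> - F) = {}"
      then have "?\<Omega> \<subseteq> E \<union> F" by blast
      then have "card ?\<Omega> \<le> card (E \<union> F)" using finE F(1) by (intro card_mono) auto
      also have "\<dots> \<le> 8" using card_Un_le[of E F] E(2) F(2) by linarith
      finally show False using card21 by linarith
    qed
    then have "Alt ((?\<Omega> - E) \<union> (?\<Omega> - F)) \<subseteq> L u"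
      using Alt_Un_subset[OF fin Lsub[OF u] E(3) F(3)] cE cF card21 by linarith
    moreover have "(?\<Omega> - E) \<union> (?\<Omega> - F) = ?\<Omega>" using EF by blast
    ultimately show ?thesis by simp
  qed
  obtain E1 where E1: "E1 \<subseteq> ?\<Omega>" "card E1 = 2" "Alt (?\<Omega> - E1) \<subseteq> L z" using support[OF z] by blast
  have finE1: "finite E1" using E1(1) fin finite_subset by blast
  have "card (?\<Omega> - E1) \<ge> 2" using card21 E1(1,2) finE1 by (simp add: card_Diff_subset)
  then obtain E2 where E2: "E2 \<subseteq> ?\<Omega> - E1" "card E2 = 2" using obtain_subset_with_card_n by metis
  have finE2: "finite E2" using E2(1) fin finite_subset by blast
  have "card (?\<Omega> - E1 - E2) \<ge> 2" using card21 E1(1,2) E2 finE1 finE2 by (simp add: card_Diff_subset)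
  then obtain E3 where E3: "E3 \<subseteq> ?\<Omega> - E1 - E2" "card E3 = 2" using obtain_subset_with_card_n by metis
  have finE3: "finite E3" using E3(1) fin finite_subset by blast
  have trans: "\<exists>h\<in>?B. \<pi> h ` E1 = E" if E: "E \<subseteq> ?\<Omega>" "card E = 2" for E
  proof -
    obtain s where s: "s \<in> Alt ?\<Omega>" "s ` E1 = E"
      using Alt_homogeneous[OF fin _ E1(1) E(1)] card21 E1(2) E(2) by auto
    then show ?thesis using B_lift[OF ab\<Omega> s(1)] by blast
  qed
  obtain h2 where h2: "h2 \<in> ?B" "\<pi> h2 ` E1 = E2" using trans[of E2] E2 by blast
  obtain h3 where h3: "h3 \<in> ?B" "\<pi> h3 ` E1 = E3" using trans[of E3] E3 by blast
  define z2 where "z2 = h2 \<otimes> z \<otimes> inv h2"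
  define z3 where "z3 = h3 \<otimes> z \<otimes> inv h3"
  have z2: "z2 \<in> Z" "Alt (?\<Omega> - E2) \<subseteq> L z2" using Zn[OF h2(1) z] move[OF h2(1) z E1(1,3)] h2(2) by (simp_all add: z2_def)
  have z3: "z3 \<in> Z" "Alt (?\<Omega> - E3) \<subseteq> L z3" using Zn[OF h3(1) z] move[OF h3(1) z E1(1,3)] h3(2) by (simp_all add: z3_def)
  note Zm = subgroup.m_closed[OF Z] and Zi = subgroup.m_inv_closed[OF Z]
  define w where "w = z \<otimes> (z2 \<otimes> z3)"
  have wZ: "w \<in> Z" unfolding w_def using Zm z z2 z3 by blast
  obtain Ew where Ew: "Ew \<subseteq> ?\<Omega>" "card Ew = 2" "Alt (?\<Omega> - Ew) \<subseteq> L w" using support[OF wZ] by blast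
  have finEw: "finite Ew" using Ew(1) fin finite_subset by blast
  have fixes_prod: "Alt (?\<Omega> - (F1 \<union> F2 \<union> F3)) \<subseteq> L (x1 \<otimes> (x2 \<otimes> x3))"
    if x: "x1 \<in> Z" "x2 \<in> Z" "x3 \<in> Z" and F: "Alt (?\<Omega> - F1) \<subseteq> L x1" "Alt (?\<Omega> - F2) \<subseteq> L x2" "Alt (?\<Omega> - F3) \<subseteq> L x3"
    for x1 x2 x3 F1 F2 F3
  proof
    fix y assume y: "y \<in> Alt (?\<Omega> - (F1 \<union> F2 \<union> F3))"
    have "Alt (?\<Omega> - (F1 \<union> F2 \<union> F3)) \<subseteq> Alt ?\<Omega>" "Alt (?\<Omega> - (F1 \<union> F2 \<union> F3)) \<subseteq> Alt (?\<Omega> - F1)"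
      "Alt (?\<Omega> - (F1 \<union> F2 \<union> F3)) \<subseteq> Alt (?\<Omega> - F2)" "Alt (?\<Omega> - (F1 \<union> F2 \<union> F3)) \<subseteq> Alt (?\<Omega> - F3)"
      by (rule Alt_mono, blast)+
    then have yy: "y \<in> Alt ?\<Omega>" "y \<in> L x1" "y \<in> L x2" "y \<in> L x3" using y F by blast+
    obtain t where t: "t \<in> ?B" "\<pi> t = y" using B_lift[OF ab\<Omega> yy(1)] by blast
    have "Fix t x1" "Fix t x2" "Fix t x3" using FixL[OF t(1)] x yy t(2) by auto
    then have "Fix t (x1 \<otimes> (x2 \<otimes> x3))" using Fix_mult[OF t(1)] x Zm by simp
    then show "y \<in> L (x1 \<otimes> (x2 \<otimes> x3))" unfolding L_def using t by blast
  qed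
  have L_inv: "L x \<subseteq> L (inv x)" if x: "x \<in> Z" for x
    unfolding L_def using Fix_inv[OF _ x] by blast
  have c6: "card (F1 \<union> F2 \<union> F3) \<le> 6" if "card F1 = 2" "card F2 = 2" "card F3 = 2" for F1 F2 F3 :: "'i set"
    using card_Un_le[of "F1 \<union> F2" F3] card_Un_le[of F1 F2] that by linarith
  have zc: "z \<in> carrier G" "z2 \<in> carrier G" "z3 \<in> carrier G" using Zc z z2 z3 by blast+
  have "\<exists>u h. u \<in> Z \<and> h \<in> ?B \<and> u = h \<otimes> z \<otimes> inv h \<and> Alt ?\<Omega> \<subseteq> L u"
  proof -
    \<comment> \<open>Two points cannot meet three disjoint sets.\<close>
    consider "E1 \<inter> Ew = {}" | "E2 \<inter> Ew = {}" | "E3 \<inter> Ew = {}"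
    proof -
      have "E1 \<inter> Ew = {} \<or> E2 \<inter> Ew = {} \<or> E3 \<inter> Ew = {}"
      proof (rule ccontr)
        assume "\<not> ?thesis"
        then obtain e1 e2 e3 where e: "e1 \<in> E1 \<inter> Ew" "e2 \<in> E2 \<inter> Ew" "e3 \<in> E3 \<inter> Ew" by blast
        have "e1 \<noteq> e2" "e1 \<noteq> e3" "e2 \<noteq> e3" using e E2(1) E3(1) by blast+
        then have "card {e1, e2, e3} = 3" by simp
        moreover have "card {e1, e2, e3} \<le> card Ew" using e finEw by (intro card_mono) auto
        ultimately show False using Ew(2) by simp
      qed
      then show thesis using that by blast
    qed
    then show ?thesis
    proof cases
      case 1
      have "Alt (?\<Omega> - (Ew \<union> E3 \<union> E2)) \<subseteq> L (w \<otimes> (inv z3 \<otimes> inv z2))"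
        using fixes_prod[OF wZ Zi[OF z3(1)] Zi[OF z2(1)] Ew(3)] L_inv[OF z3(1)] L_inv[OF z2(1)] z2(2) z3(2) by blast
      moreover have "w \<otimes> (inv z3 \<otimes> inv z2) = z" unfolding w_def using zc by (simp add: group_word)
      ultimately have "Alt ?\<Omega> \<subseteq> L z"
        using join[OF z E1, of "Ew \<union> E3 \<union> E2"] c6[OF Ew(2) E3(2) E2(2)] finEw finE3 finE2 1 E2(1) E3(1) by auto
      then show ?thesis using z zc B_one by (intro exI[of _ z] exI[of _ \<one>]) simp
    next
      case 2
      have "Alt (?\<Omega> - (E1 \<union> Ew \<union> E3)) \<subseteq> L (inv z \<otimes> (w \<otimes> inv z3))"
        using fixes_prod[OF Zi[OF z] wZ Zi[OF z3(1)] _ Ew(3)] L_inv[OF z3(1)] L_inv[OF z] E1(3) z3(2) by blast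
      moreover have "inv z \<otimes> (w \<otimes> inv z3) = z2" unfolding w_def using zc by (simp add: group_word)
      ultimately have "Alt ?\<Omega> \<subseteq> L z2"
        using join[OF z2(1) _ E2(2) z2(2), of "E1 \<union> Ew \<union> E3"] c6[OF E1(2) Ew(2) E3(2)] finEw finE3 finE1 2 E2(1) E3(1) by auto
      then show ?thesis using z2(1) h2(1) z2_def by blast
    next
      case 3
      have "Alt (?\<Omega> - (E2 \<union> E1 \<union> Ew)) \<subseteq> L (inv z2 \<otimes> (inv z \<otimes> w))"
        using fixes_prod[OF Zi[OF z2(1)] Zi[OF z] wZ _ _ Ew(3)] L_inv[OF z2(1)] L_inv[OF z] E1(3) z2(2) by blast
      moreover have "inv z2 \<otimes> (inv z \<otimes> w) = z3" unfolding w_def using zc by (simp add: group_word)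
      ultimately have "Alt ?\<Omega> \<subseteq> L z3"
        using join[OF z3(1) _ E3(2) z3(2), of "E2 \<union> E1 \<union> Ew"] c6[OF E2(2) E1(2) Ew(2)] finEw finE2 finE1 3 E2(1) E3(1) by auto
      then show ?thesis using z3(1) h3(1) z3_def by blast
    qed
  qed
  then obtain u h where u: "u \<in> Z" "h \<in> ?B" "u = h \<otimes> z \<otimes> inv h" "Alt ?\<Omega> \<subseteq> L u" by blast
  have hc: "h \<in> carrier G" "g \<in> carrier G" using Bc u(2) g by blast+
  have hgB: "h \<otimes> g \<otimes> inv h \<in> ?B" using B_mult B_inv u(2) g by blast
  then have "\<pi> (h \<otimes> g \<otimes> inv h) \<in> L u" using \<pi>_B[OF ab\<Omega>] u(4) by blast
  then have "Fix (h \<otimes> g \<otimes> inv h) u" by (rule FixL[OF hgB u(1)])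
  then have "Fix (inv h \<otimes> (h \<otimes> g \<otimes> inv h) \<otimes> inv (inv h)) (inv h \<otimes> u \<otimes> inv (inv h))"
    by (rule Fix_conj[OF hgB B_inv[OF u(2)] u(1)])
  then have "Fix g z" unfolding u(3) using hc zc by (simp add: group_word)
  then show ?thesis by (simp add: Fix_def)
qed

end

lemma (in group) finite_subgroupI:
  assumes "finite S" "S \<subseteq> carrier G" "S \<noteq> {}" and mult: "\<And>x y. x \<in> S \<Longrightarrow> y \<in> S \<Longrightarrow> x \<otimes> y \<in> S"
  shows "subgroup S G"
proof (rule subgroupI)
  have Sc: "x \<in> carrier G" if "x \<in> S" for x using that assms(2) by blast
  have surj: "\<exists>z\<in>S. y = x \<otimes> z" if x: "x \<in> S" "y \<in> S" for x y
  proof -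
    have "(\<lambda>z. x \<otimes> z) ` S = S"
    proof (rule endo_inj_surj[OF assms(1)])
      show "(\<lambda>z. x \<otimes> z) ` S \<subseteq> S" using mult x by blast
      show "inj_on (\<lambda>z. x \<otimes> z) S" by (rule inj_onI) (use Sc x in simp)
    qed
    then show ?thesis using x by blast
  qed
  have one: "\<one> \<in> S"
  proof -
    obtain x where x: "x \<in> S" using assms(3) by blast
    obtain z where z: "z \<in> S" "x = x \<otimes> z" using surj[OF x x] by blast
    have "x \<otimes> z = x \<otimes> \<one>" using z x Sc by simp
    then have "z = \<one>" using x z(1) Sc by (metis l_cancel one_closed)
    then show ?thesis using z by simp
  qed
  show "inv x \<in> S" if x: "x \<in> S" for x
  proof -
    obtain z where z: "z \<in> S" "\<one> = x \<otimes> z" using surj[OF x one] by blast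
    then have "inv x = z" using Sc[OF x] Sc[OF z(1)] by (metis inv_comm inv_equality)
    then show ?thesis using z by simp
  qed
qed (use assms in auto)

context alt_ext
begin

lemma sylow_of_M:
  assumes "Factorial_Ring.prime p"
  shows "\<exists>P. subgroup P G \<and> P \<subseteq> M \<and> card P = p ^ multiplicity p (card M)"
proof -
  interpret Mg: group "G\<lparr>carrier := M\<rparr>" using subgroup_imp_group[OF M_subgroup] .
  obtain P where P: "subgroup P (G\<lparr>carrier := M\<rparr>)" "card P = p ^ multiplicity p (order (G\<lparr>carrier := M\<rparr>))"
    using Mg.sylow_exists[OF assms] finM by auto
  have "subgroup P G" using incl_subgroup[OF M_subgroup P(1)] .
  moreover have "P \<subseteq> M" using subgroup.subset[OF P(1)] by simp
  ultimately show ?thesis using P(2) by (auto simp: order_def)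
qed

text \<open>If \<open>P\<close> is a Sylow subgroup of \<open>M\<close> outside a maximal supplement \<open>V\<close>, and \<open>Z / N\<close> is the centre of
  \<open>P / N\<close> for the largest normal subgroup \<open>N\<close> inside \<open>V \<inter> P\<close>, then \<open>M\<close> centralizes \<open>Z / N\<close>, its Sylow subgroups
  being normal. Thus \<open>Z / N\<close> is a module of the alternating group, and too small to be noncentral.\<close>

lemma normal_supplement:
  assumes ab: "a \<in> \<Omega>" "b \<in> \<Omega>" "a \<noteq> b"
    and Y: "subgroup Y G" "Y \<subseteq> B {a, b}" "\<pi> ` Y = Alt (\<Omega> - {a, b})"
    and small: "card M < (card (\<Omega> - {a, b}) choose 3) * card (M \<inter> Y)"
    and nMY: "\<not> M \<subseteq> Y"
  shows "\<exists>V g. subgroup V G \<and> V \<subseteq> B {a, b} \<and> (\<forall>h\<in>B {a, b}. \<forall>x\<in>V. h \<otimes> x \<otimes> inv h \<in> V) \<and>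
    g \<in> M \<and> g \<notin> V \<and> (\<forall>S. subgroup S G \<longrightarrow> V \<subseteq> S \<longrightarrow> S \<subseteq> B {a, b} \<longrightarrow> g \<in> S \<longrightarrow> S = B {a, b})"
proof -
  let ?B = "B {a, b}"
  let ?\<Omega> = "\<Omega> - {a, b}"
  note Bc = B_carrier[of _ "{a, b}"]
  have finB: "finite ?B" using finG Bc finite_subset[of ?B "carrier G"] by blast
  \<comment> \<open>A subgroup of largest order above \<open>Y\<close> that does not contain
    \<open>M\<close>. Anything properly above it contains \<open>M\<close> as well as
    \<open>Y\<close>, hence is \<open>B {a, b}\<close>.\<close>
  have "\<exists>V. (subgroup V G \<and> Y \<subseteq> V \<and> V \<subseteq> ?B \<and> \<not> M \<subseteq> V) \<and>
     (\<forall>S. subgroup S G \<and> Y \<subseteq> S \<and> S \<subseteq> ?B \<and> \<not> M \<subseteq> S \<longrightarrow> card S \<le> card V)"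
    by (rule ex_has_greatest_nat[where k = Y and b = "Suc (card ?B)"])
       (use Y nMY finB in \<open>auto simp: less_Suc_eq_le intro: card_mono\<close>)
  then obtain V where V: "subgroup V G" "Y \<subseteq> V" "V \<subseteq> ?B" "\<not> M \<subseteq> V"
    and Vmax: "\<And>S. subgroup S G \<Longrightarrow> Y \<subseteq> S \<Longrightarrow> S \<subseteq> ?B \<Longrightarrow> \<not> M \<subseteq> S \<Longrightarrow> card S \<le> card V" by blast
  note Vm = subgroup.m_closed[OF V(1)] and Vi = subgroup.m_inv_closed[OF V(1)]
  have Vc: "x \<in> carrier G" if "x \<in> V" for x using subgroup.mem_carrier[OF V(1) that] .
  have Smax: "S = ?B" if S: "subgroup S G" "V \<subseteq> S" "S \<subseteq> ?B" "S \<noteq> V" for S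
  proof -
    have "card V < card S" using S finB finite_subset by (intro psubset_card_mono) blast+
    then have MS: "M \<subseteq> S" using Vmax[OF S(1) _ S(3)] S(2) V(2) by force
    have "?B \<subseteq> S"
    proof
      fix g assume g: "g \<in> ?B"
      have "\<pi> g \<in> \<pi> ` Y" using g \<pi>_B[of "{a, b}"] ab Y(3) by blast
      then obtain y where y: "y \<in> Y" "\<pi> g = \<pi> y" by blast
      have yc: "y \<in> carrier G" using subgroup.mem_carrier[OF Y(1) y(1)] .
      have "inv y \<otimes> g \<in> S" using \<pi>_eq_M'[OF Bc[OF g] yc y(2)] MS by blast
      moreover have "y \<in> S" using y(1) V(2) S(2) by blast
      ultimately have "y \<otimes> (inv y \<otimes> g) \<in> S" using subgroup.m_closed[OF S(1)] by blast
      then show "g \<in> S" using yc Bc[OF g] by (simp add: group_word)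
    qed
    then show ?thesis using S(3) by blast
  qed
  have "\<exists>p. Factorial_Ring.prime p \<and> (\<forall>P. subgroup P G \<and> P \<subseteq> M \<and> card P = p ^ multiplicity p (card M) \<longrightarrow> \<not> P \<subseteq> V)"
  proof (rule ccontr)
    assume "\<not> ?thesis"
    then have "\<exists>P. subgroup P G \<and> card P = p ^ multiplicity p (card M) \<and> P \<subseteq> V \<inter> M"
      if "Factorial_Ring.prime p" for p using that by blast
    then have "M \<subseteq> V" by (rule subgroup_all_sylows[OF V(1) M_subgroup finM])
    then show False using V(4) by blast
  qed
  then obtain p P where p: "Factorial_Ring.prime p" and P: "subgroup P G" "P \<subseteq> M" "card P = p ^ multiplicity p (card M)" "\<not> P \<subseteq> V"
    using sylow_of_M by meson
  note Pm = subgroup.m_closed[OF P(1)] and Pi = subgroup.m_inv_closed[OF P(1)]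
  have Pc: "x \<in> carrier G" if "x \<in> P" for x using subgroup.mem_carrier[OF P(1) that] .
  have PB: "x \<in> ?B" if "x \<in> P" for x using that P(2) M_B by blast
  have finP: "finite P" using P(2) finM finite_subset by blast
  have Pn: "g \<otimes> x \<otimes> inv g \<in> P" if "g \<in> carrier G" "x \<in> P" for g x
    using sylow_normal[OF p P(1-3) that] .
  define nrm where "nrm S \<longleftrightarrow> subgroup S G \<and> S \<subseteq> V \<inter> P \<and> (\<forall>g\<in>?B. \<forall>x\<in>S. g \<otimes> x \<otimes> inv g \<in> S)" for S
  have "nrm {\<one>}" using Vm Vc subgroup.one_closed[OF V(1)] subgroup.one_closed[OF P(1)] Bc
    by (auto simp: nrm_def triv_subgroup)
  then have "\<exists>N. nrm N \<and> (\<forall>S. nrm S \<longrightarrow> card S \<le> card N)"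
    by (intro ex_has_greatest_nat[where b = "Suc (card P)"])
       (use finP in \<open>auto simp: nrm_def less_Suc_eq_le intro: card_mono\<close>)
  then obtain N where N: "nrm N" and Nmax: "\<And>S. nrm S \<Longrightarrow> card S \<le> card N" by blast
  have Ns: "subgroup N G" and NV: "N \<subseteq> V" and NP: "N \<subseteq> P" and Nn: "\<And>g x. g \<in> ?B \<Longrightarrow> x \<in> N \<Longrightarrow> g \<otimes> x \<otimes> inv g \<in> N"
    using N by (auto simp: nrm_def)
  have Neq: "S = N" if "nrm S" "N \<subseteq> S" for S
  proof -
    have "finite S" using that(1) finP finite_subset by (auto simp: nrm_def)
    then show ?thesis using that Nmax[OF that(1)] card_seteq by metis
  qed
  note Nm = subgroup.m_closed[OF Ns] and Ni = subgroup.m_inv_closed[OF Ns]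
  have Nc: "x \<in> carrier G" if "x \<in> N" for x using subgroup.mem_carrier[OF Ns that] .
  define Z where "Z = {g \<in> P. \<forall>y\<in>P. y \<otimes> g \<otimes> inv y \<otimes> inv g \<in> N}"
  have ZP: "x \<in> P" if "x \<in> Z" for x using that by (simp add: Z_def)
  have Zc: "x \<in> carrier G" if "x \<in> Z" for x using Pc[OF ZP[OF that]] .
  have ZB: "x \<in> ?B" if "x \<in> Z" for x using PB[OF ZP[OF that]] .
  have Zcomm: "y \<otimes> g \<otimes> inv y \<otimes> inv g \<in> N" if "g \<in> Z" "y \<in> P" for g y using that by (simp add: Z_def)
  have Zs: "subgroup Z G"
  proof (rule finite_subgroupI)
    show "finite Z" using finP finite_subset[of Z P] ZP by blast
    show "Z \<noteq> {}" using subgroup.one_closed[OF P(1)] subgroup.one_closed[OF Ns] Pc by (auto simp: Z_def intro!: exI[of _ \<one>])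
    fix g h assume gh: "g \<in> Z" "h \<in> Z"
    have "y \<otimes> (g \<otimes> h) \<otimes> inv y \<otimes> inv (g \<otimes> h) \<in> N" if y: "y \<in> P" for y
    proof -
      have "y \<otimes> (g \<otimes> h) \<otimes> inv y \<otimes> inv (g \<otimes> h) = (y \<otimes> g \<otimes> inv y \<otimes> inv g) \<otimes> (g \<otimes> (y \<otimes> h \<otimes> inv y \<otimes> inv h) \<otimes> inv g)"
        using gh Zc Pc[OF y] by (simp add: group_word)
      then show ?thesis using Nm[OF Zcomm[OF gh(1) y] Nn[OF ZB[OF gh(1)] Zcomm[OF gh(2) y]]] by simp
    qed
    then show "g \<otimes> h \<in> Z" using Pm[OF ZP[OF gh(1)] ZP[OF gh(2)]] by (simp add: Z_def)
  qed (use Zc in blast)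
  note Zm = subgroup.m_closed[OF Zs] and Zi = subgroup.m_inv_closed[OF Zs]
  have Zn: "c \<otimes> g \<otimes> inv c \<in> Z" if c: "c \<in> ?B" and g: "g \<in> Z" for c g
  proof -
    have "y \<otimes> (c \<otimes> g \<otimes> inv c) \<otimes> inv y \<otimes> inv (c \<otimes> g \<otimes> inv c) \<in> N" if y: "y \<in> P" for y
    proof -
      let ?y = "inv c \<otimes> y \<otimes> c"
      have "?y \<in> P" using Pn[OF inv_closed[OF Bc[OF c]] y] Bc[OF c] by simp
      then have "c \<otimes> (?y \<otimes> g \<otimes> inv ?y \<otimes> inv g) \<otimes> inv c \<in> N" using Nn[OF c Zcomm[OF g]] by blast
      moreover have "c \<otimes> (?y \<otimes> g \<otimes> inv ?y \<otimes> inv g) \<otimes> inv c = y \<otimes> (c \<otimes> g \<otimes> inv c) \<otimes> inv y \<otimes> inv (c \<otimes> g \<otimes> inv c)"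
        using Bc[OF c] Zc[OF g] Pc[OF y] by (simp add: group_word)
      ultimately show ?thesis by simp
    qed
    then show ?thesis using Pn[OF Bc[OF c] ZP[OF g]] by (simp add: Z_def)
  qed
  have NZ: "N \<subseteq> Z"
  proof
    fix n assume n: "n \<in> N"
    have "n \<in> P" using n NP by blast
    then show "n \<in> Z" using Nm[OF Nn[OF PB n] Ni[OF n]] by (simp add: Z_def)
  qed
  have "\<exists>z\<in>Z. z \<notin> N"
  proof -
    let ?P = "G\<lparr>carrier := P\<rparr>"
    interpret Pg: group ?P using subgroup_imp_group[OF P(1)] .
    have NsP: "subgroup N ?P" using subgroup_incl[OF Ns P(1) NP] .
    have iP: "inv\<^bsub>?P\<^esub> x = inv x" if "x \<in> P" for x using m_inv_consistent[OF P(1) that] .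
    have "N \<lhd> ?P"
      using NsP Nn[OF PB] iP by (auto simp: Pg.normal_inv_iff)
    then interpret NP: normal N ?P .
    interpret Q: group "?P Mod N" by (rule NP.factorgroup_is_group)
    have card: "card (rcosets\<^bsub>?P\<^esub> N) * card N = p ^ multiplicity p (card M)"
      using Pg.lagrange[OF NsP] P(3) by (simp add: order_def)
    then have "card (rcosets\<^bsub>?P\<^esub> N) dvd p ^ multiplicity p (card M)" by (metis dvd_triv_left)
    then obtain i where i: "card (rcosets\<^bsub>?P\<^esub> N) = p ^ i" using p divides_primepow_nat by blast
    have "i \<noteq> 0"
    proof
      assume "i = 0"
      then have "card N = card P" using i card P(3) by simp
      then have "N = P" using NP finP card_subset_eq by blast
      then show False using NV P(4) by blast
    qed
    then have "\<exists>z\<in>carrier (?P Mod N). z \<noteq> \<one>\<^bsub>?P Mod N\<^esub> \<and> (\<forall>g\<in>carrier (?P Mod N). g \<otimes>\<^bsub>?P Mod N\<^esub> z = z \<otimes>\<^bsub>?P Mod N\<^esub> g)"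
      using i by (intro Q.p_group_center[OF p]) (auto simp: order_def FactGroup_def)
    then obtain C where C: "C \<in> rcosets\<^bsub>?P\<^esub> N" "C \<noteq> N" "\<And>D. D \<in> rcosets\<^bsub>?P\<^esub> N \<Longrightarrow> D <#>\<^bsub>?P\<^esub> C = C <#>\<^bsub>?P\<^esub> D"
      by (auto simp: FactGroup_def)
    obtain g where g: "g \<in> P" "C = N #>\<^bsub>?P\<^esub> g" using C(1) by (auto simp: RCOSETS_def)
    have "g \<notin> N"
    proof
      assume "g \<in> N"
      then have "C = N" using Pg.coset_join2[OF _ NsP] g by simp
      then show False using C(2) by simp
    qed
    moreover have "y \<otimes> g \<otimes> inv y \<otimes> inv g \<in> N" if y: "y \<in> P" for y
    proof -
      have "N #>\<^bsub>?P\<^esub> y \<in> rcosets\<^bsub>?P\<^esub> N" using Pg.rcosetsI[of N y] subgroup.subset[OF NsP] y by simp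
      from C(3)[OF this] have "N #>\<^bsub>?P\<^esub> (y \<otimes> g) = N #>\<^bsub>?P\<^esub> (g \<otimes> y)"
        using NP.rcos_sum[of y g] NP.rcos_sum[of g y] g y by simp
      moreover have "y \<otimes> g \<in> N #>\<^bsub>?P\<^esub> (y \<otimes> g)"
        using Pg.rcos_self[OF _ NsP, of "y \<otimes> g"] Pm[OF y g(1)] by simp
      ultimately obtain n where n: "n \<in> N" "y \<otimes> g = n \<otimes> (g \<otimes> y)" by (auto simp: r_coset_def)
      have "y \<otimes> g \<otimes> inv y \<otimes> inv g = n"
        unfolding n(2) using n(1) Nc Pc g(1) y by (simp add: group_word)
      then show ?thesis using n(1) by simp
    qed
    ultimately show ?thesis using g(1) by (auto simp: Z_def)
  qed
  \<comment> \<open>Otherwise \<open>Z\<close> would compete with \<open>N\<close> among the normal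
    subgroups inside \<open>V \<inter> P\<close>.\<close>
  then have "\<not> Z \<subseteq> V" using Neq[of Z] Zs ZP Zn NZ by (auto simp: nrm_def)
  then obtain g where g: "g \<in> Z" "g \<notin> V" by blast
  define S where "S = {x \<otimes> z |x z. x \<in> V \<and> z \<in> Z}"
  have SI: "x \<otimes> z \<in> S" if "x \<in> V" "z \<in> Z" for x z using that by (auto simp: S_def)
  have SE: "\<exists>x\<in>V. \<exists>z\<in>Z. s = x \<otimes> z" if "s \<in> S" for s using that by (auto simp: S_def)
  have SB: "S \<subseteq> ?B" using V(3) ZB B_mult unfolding S_def by blast
  have Ss: "subgroup S G"
  proof (rule finite_subgroupI)
    show "finite S" using SB finB finite_subset by blast
    show "S \<subseteq> carrier G" using SB Bc by blast
    show "S \<noteq> {}" using SI subgroup.one_closed[OF V(1)] g(1) by blast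
    fix s t assume st: "s \<in> S" "t \<in> S"
    obtain x z where xz: "x \<in> V" "z \<in> Z" "s = x \<otimes> z" using SE[OF st(1)] by blast
    obtain x' z' where xz': "x' \<in> V" "z' \<in> Z" "t = x' \<otimes> z'" using SE[OF st(2)] by blast
    have "inv x' \<in> ?B" using V(3) Vi[OF xz'(1)] by blast
    then have "inv x' \<otimes> z \<otimes> inv (inv x') \<in> Z" using Zn xz(2) by blast
    then have "inv x' \<otimes> z \<otimes> x' \<in> Z" using Vc[OF xz'(1)] by simp
    then have "(x \<otimes> x') \<otimes> ((inv x' \<otimes> z \<otimes> x') \<otimes> z') \<in> S" using SI Vm xz xz' Zm by blast
    moreover have "s \<otimes> t = (x \<otimes> x') \<otimes> ((inv x' \<otimes> z \<otimes> x') \<otimes> z')"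
      using xz xz' Vc Zc by (simp add: group_word)
    ultimately show "s \<otimes> t \<in> S" by simp
  qed
  have VS: "V \<subseteq> S" using SI[OF _ subgroup.one_closed[OF Zs]] Vc by force
  have ZS: "Z \<subseteq> S" using SI[OF subgroup.one_closed[OF V(1)]] Zc by force
  have "S = ?B" by (rule Smax[OF Ss VS SB]) (use ZS g in blast)
  then have Bxz: "\<exists>x\<in>V. \<exists>z\<in>Z. h = x \<otimes> z" if "h \<in> ?B" for h using SE that by blast
  \<comment> \<open>The intersection is normalized by \<open>V\<close>, and by \<open>Z\<close>
    because \<open>Z\<close> is commutative modulo \<open>N\<close>; these two make up
    \<open>B {a, b}\<close>, so maximality of \<open>N\<close> applies.\<close>
  have VZ: "V \<inter> Z = N"
  proof (rule Neq)
    show "N \<subseteq> V \<inter> Z" using NV NZ by blast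
    show "nrm (V \<inter> Z)"
      unfolding nrm_def
    proof (intro conjI ballI)
      show "subgroup (V \<inter> Z) G" by (rule subgroups_Inter_pair[OF V(1) Zs])
      show "V \<inter> Z \<subseteq> V \<inter> P" using ZP by blast
      fix h w assume h: "h \<in> ?B" and w: "w \<in> V \<inter> Z"
      obtain x z where xz: "x \<in> V" "z \<in> Z" "h = x \<otimes> z" using Bxz[OF h] by blast
      have "z \<otimes> w \<otimes> inv z \<otimes> inv w \<in> N" using Zcomm ZP xz(2) w by blast
      then have "(z \<otimes> w \<otimes> inv z \<otimes> inv w) \<otimes> w \<in> V" using NV Vm w by blast
      then have "z \<otimes> w \<otimes> inv z \<in> V" using Zc xz(2) w by (simp add: group_word)
      then have "x \<otimes> (z \<otimes> w \<otimes> inv z) \<otimes> inv x \<in> V" using Vm Vi xz(1) by blast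
      then have "h \<otimes> w \<otimes> inv h \<in> V" using xz Vc Zc w by (simp add: group_word)
      then show "h \<otimes> w \<otimes> inv h \<in> V \<inter> Z" using Zn h w by blast
    qed
  qed
  have ZM: "Z \<subseteq> M" using ZP P(2) by blast
  have finMV: "finite (M \<inter> V)" using finM by simp
  \<comment> \<open>Fibres of the product map have at most as many elements as
    \<open>V \<inter> Z = N\<close>; so the index of \<open>N\<close> in \<open>Z\<close> is at most
    that of \<open>M \<inter> V\<close> in \<open>M\<close>.\<close>
  have "card (Z \<times> (M \<inter> V)) \<le> card ((\<lambda>(z, m). z \<otimes> m) ` (Z \<times> (M \<inter> V))) * card N"
  proof (rule card_le_image_times_fibre)
    show "finite (Z \<times> (M \<inter> V))" using finMV finite_subset[OF ZM finM] by simp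
    fix e assume "e \<in> Z \<times> (M \<inter> V)"
    then obtain z m where e: "e = (z, m)" "z \<in> Z" "m \<in> M" "m \<in> V" by blast
    show "card {e' \<in> Z \<times> (M \<inter> V). (case e' of (z, m) \<Rightarrow> z \<otimes> m) = (case e of (z, m) \<Rightarrow> z \<otimes> m)} \<le> card N"
    proof (rule card_inj_on_le[where f = "\<lambda>(z', m'). inv z \<otimes> z'"])
      have key: "inv z \<otimes> z' = m \<otimes> inv m'" if "z' \<in> Z" "m' \<in> V" "z' \<otimes> m' = z \<otimes> m" for z' m'
      proof -
        have c: "z \<in> carrier G" "m \<in> carrier G" "z' \<in> carrier G" "m' \<in> carrier G" using that(1,2) Zc Vc e by blast+
        have "inv z \<otimes> z' = inv z \<otimes> (z' \<otimes> m') \<otimes> inv m'" using c by (simp add: group_word)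
        also have "\<dots> = inv z \<otimes> (z \<otimes> m) \<otimes> inv m'" using that(3) by simp
        also have "\<dots> = m \<otimes> inv m'" using c by (simp add: group_word)
        finally show ?thesis .
      qed
      show "inj_on (\<lambda>(z', m'). inv z \<otimes> z') {e' \<in> Z \<times> (M \<inter> V). (case e' of (z, m) \<Rightarrow> z \<otimes> m) = (case e of (z, m) \<Rightarrow> z \<otimes> m)}"
      proof (rule inj_onI, clarsimp simp: e)
        fix z1 m1 z2 m2
        assume *: "z1 \<in> Z" "m1 \<in> V" "z1 \<otimes> m1 = z \<otimes> m" "z2 \<in> Z" "m2 \<in> V" "z2 \<otimes> m2 = z \<otimes> m" "inv z \<otimes> z1 = inv z \<otimes> z2"
        then have "z1 = z2" using Zc e by simp
        moreover from this have "m1 = m2" using * Zc Vc by (metis l_cancel)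
        ultimately show "z1 = z2 \<and> m1 = m2" by simp
      qed
      show "(\<lambda>(z', m'). inv z \<otimes> z') ` {e' \<in> Z \<times> (M \<inter> V). (case e' of (z, m) \<Rightarrow> z \<otimes> m) = (case e of (z, m) \<Rightarrow> z \<otimes> m)} \<subseteq> N"
      proof (clarsimp simp: e)
        fix z' m' assume *: "z' \<in> Z" "m' \<in> V" "z' \<otimes> m' = z \<otimes> m"
        have "inv z \<otimes> z' \<in> Z" using * Zm Zi e by blast
        moreover have "inv z \<otimes> z' \<in> V" unfolding key[OF *] using * Vm Vi e by blast
        ultimately show "inv z \<otimes> z' \<in> N" using VZ by blast
      qed
      show "finite N" using NP finP finite_subset by blast
    qed
  qed
  also have "\<dots> \<le> card M * card N"
    using ZM M_mult finM by (intro mult_right_mono card_mono) auto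
  finally have "card Z * card (M \<inter> V) \<le> card M * card N" by (simp add: card_cartesian_product)
  also have "\<dots> < (card ?\<Omega> choose 3) * card (M \<inter> V) * card N"
  proof -
    have "card (M \<inter> Y) \<le> card (M \<inter> V)" using V(2) finMV by (intro card_mono) auto
    then have "(card ?\<Omega> choose 3) * card (M \<inter> Y) \<le> (card ?\<Omega> choose 3) * card (M \<inter> V)" by (rule mult_left_mono) simp
    then have "card M < (card ?\<Omega> choose 3) * card (M \<inter> V)" using small by linarith
    moreover have "card N > 0" using NP finP finite_subset subgroup.one_closed[OF Ns] card_gt_0_iff by blast
    ultimately show ?thesis by simp
  qed
  finally have "card Z * card (M \<inter> V) < (card ?\<Omega> choose 3) * card N * card (M \<inter> V)" by (simp only: mult.commute mult.left_commute)
  then have smallZ: "card Z < (card ?\<Omega> choose 3) * card N" by simp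
  have MZ: "m \<otimes> z \<otimes> inv m \<otimes> inv z \<in> N" if m: "m \<in> M" and z: "z \<in> Z" for m z
  proof -
    \<comment> \<open>The part of \<open>M\<close> centralizing \<open>Z\<close> modulo
      \<open>N\<close>. It contains \<open>P\<close> by choice of \<open>Z\<close>, and a Sylow
      subgroup \<open>Q\<close> for another prime because commutators of \<open>Q\<close> with
      \<open>Z\<close> lie in \<open>P \<inter> Q\<close>, which is trivial.\<close>
    define D where "D = {m \<in> M. \<forall>z\<in>Z. m \<otimes> z \<otimes> inv m \<otimes> inv z \<in> N}"
    have Ds: "subgroup D G"
    proof (rule finite_subgroupI)
      show "finite D" using finM by (simp add: D_def)
      show "D \<subseteq> carrier G" using M_carrier by (auto simp: D_def)
      have "\<one> \<in> D" using M_one Zc subgroup.one_closed[OF Ns] by (simp add: D_def)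
      then show "D \<noteq> {}" by blast
      fix s t assume st: "s \<in> D" "t \<in> D"
      then have stM: "s \<in> M" "t \<in> M" by (auto simp: D_def)
      have "(s \<otimes> t) \<otimes> z \<otimes> inv (s \<otimes> t) \<otimes> inv z \<in> N" if z: "z \<in> Z" for z
      proof -
        have "(s \<otimes> t) \<otimes> z \<otimes> inv (s \<otimes> t) \<otimes> inv z = (s \<otimes> (t \<otimes> z \<otimes> inv t \<otimes> inv z) \<otimes> inv s) \<otimes> (s \<otimes> z \<otimes> inv s \<otimes> inv z)"
          using stM M_carrier Zc[OF z] by (simp add: group_word)
        moreover have "t \<otimes> z \<otimes> inv t \<otimes> inv z \<in> N" "s \<otimes> z \<otimes> inv s \<otimes> inv z \<in> N" using st z by (auto simp: D_def)
        ultimately show ?thesis using Nm[OF Nn[OF M_B[OF stM(1)]]] by simp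
      qed
      then show "s \<otimes> t \<in> D" using stM M_mult by (simp add: D_def)
    qed
    have "M \<subseteq> D"
    proof (rule subgroup_all_sylows[OF Ds M_subgroup finM])
      fix q :: nat assume q: "Factorial_Ring.prime q"
      show "\<exists>Q. subgroup Q G \<and> card Q = q ^ multiplicity q (card M) \<and> Q \<subseteq> D \<inter> M"
      proof (cases "q = p")
        case True
        have "P \<subseteq> D \<inter> M" using P(2) Zcomm by (auto simp: D_def)
        then show ?thesis using True P by blast
      next
        case False
        obtain Q where Q: "subgroup Q G" "Q \<subseteq> M" "card Q = q ^ multiplicity q (card M)" using sylow_of_M[OF q] by blast
        note Qm = subgroup.m_closed[OF Q(1)] and Qi = subgroup.m_inv_closed[OF Q(1)]
        have Qc: "x \<in> carrier G" if "x \<in> Q" for x using subgroup.mem_carrier[OF Q(1) that] .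
        have PQ: "subgroup (P \<inter> Q) G" by (rule subgroups_Inter_pair[OF P(1) Q(1)])
        have "card (P \<inter> Q) dvd card P" "card (P \<inter> Q) dvd card Q"
          using card_subgroup_dvd[OF PQ P(1)] card_subgroup_dvd[OF PQ Q(1)] by auto
        moreover have "coprime (card P) (card Q)" using primes_coprime[OF p q] False P(3) Q(3) by auto
        ultimately have "card (P \<inter> Q) = 1" using coprime_common_divisor_nat by blast
        then obtain e where "P \<inter> Q = {e}" by (auto simp: card_1_singleton_iff)
        then have PQ1: "P \<inter> Q = {\<one>}" using subgroup.one_closed[OF PQ] by simp
        have "m \<otimes> z \<otimes> inv m \<otimes> inv z \<in> N" if m: "m \<in> Q" and z: "z \<in> Z" for m z
        proof -
          have zm: "z \<otimes> inv m \<otimes> inv z \<in> Q" using sylow_normal[OF q Q Zc[OF z] Qi[OF m]] .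
          have "m \<otimes> (z \<otimes> inv m \<otimes> inv z) \<in> Q" using Qm[OF m zm] .
          moreover have "(m \<otimes> z \<otimes> inv m) \<otimes> inv z \<in> P" using Pm[OF Pn[OF Qc[OF m] ZP[OF z]] Pi[OF ZP[OF z]]] .
          moreover have "m \<otimes> (z \<otimes> inv m \<otimes> inv z) = (m \<otimes> z \<otimes> inv m) \<otimes> inv z"
            using Qc[OF m] Zc[OF z] by (simp add: group_word)
          ultimately have "m \<otimes> z \<otimes> inv m \<otimes> inv z \<in> P \<inter> Q" by simp
          then show ?thesis using PQ1 subgroup.one_closed[OF Ns] by simp
        qed
        then have "Q \<subseteq> D \<inter> M" using Q(2) unfolding D_def by blast
        then show ?thesis using Q by blast
      qed
    qed
    then have "m \<in> D" using m by blast
    then show ?thesis using z by (simp add: D_def)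
  qed
  have central: "h \<otimes> z \<otimes> inv h \<otimes> inv z \<in> N" if "h \<in> ?B" "z \<in> Z" for h z
    using small_quotient_central[OF ab Ns Zs NZ ZM Nn Zn MZ smallZ that] .
  have Vn: "h \<otimes> w \<otimes> inv h \<in> V" if h: "h \<in> ?B" and w: "w \<in> V" for h w
  proof -
    obtain x z where xz: "x \<in> V" "z \<in> Z" "h = x \<otimes> z" using Bxz[OF h] by blast
    have "w \<in> ?B" using w V(3) by blast
    \<comment> \<open>Conjugation by \<open>z\<close> changes \<open>w\<close> only by a factor from
      \<open>N\<close>, which lies in \<open>V\<close>.\<close>
    then have "inv (w \<otimes> z \<otimes> inv w \<otimes> inv z) \<in> V" using Ni[OF central[OF _ xz(2)]] NV by blast
    then have "x \<otimes> (inv (w \<otimes> z \<otimes> inv w \<otimes> inv z) \<otimes> w) \<otimes> inv x \<in> V" using Vm Vi xz(1) w by blast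
    then show ?thesis using xz Vc[OF xz(1)] Zc[OF xz(2)] Vc[OF w] by (simp add: group_word)
  qed
  have "\<forall>S. subgroup S G \<longrightarrow> V \<subseteq> S \<longrightarrow> S \<subseteq> ?B \<longrightarrow> g \<in> S \<longrightarrow> S = ?B"
  proof (intro allI impI)
    fix S assume "subgroup S G" "V \<subseteq> S" "S \<subseteq> ?B" "g \<in> S"
    then show "S = ?B" using Smax g(2) by blast
  qed
  moreover have "g \<in> M" using ZM g(1) by blast
  ultimately show ?thesis using V(1,3) Vn g(2) by (intro exI[of _ V] exI[of _ g] conjI ballI)
qed

text \<open>Otherwise \<open>normal_supplement\<close> gives a normal \<open>V\<close> in
  \<open>B {a, b}\<close> and an element \<open>g\<close> of \<open>M\<close> outside it that
  generates the quotient. A character of prime order of this cyclic quotient is nontrivial on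
  \<open>g\<close>, against \<open>pair_hom_vanishes\<close>.\<close>

theorem no_small_supplement:
  assumes cop: "coprime (2 * card \<Omega>) (card M)"
    and ab: "a \<in> \<Omega>" "b \<in> \<Omega>" "a \<noteq> b"
    and Y: "subgroup Y G" "Y \<subseteq> B {a, b}" "\<pi> ` Y = Alt (\<Omega> - {a, b})"
    and small: "card M < (card (\<Omega> - {a, b}) choose 3) * card (M \<inter> Y)"
  shows "M \<subseteq> Y"
proof (rule ccontr)
  let ?B = "B {a, b}"
  assume "\<not> M \<subseteq> Y"
  from normal_supplement[OF ab Y small this] obtain V g
    where Vg: "subgroup V G \<and> V \<subseteq> ?B \<and> (\<forall>h\<in>?B. \<forall>x\<in>V. h \<otimes> x \<otimes> inv h \<in> V) \<and>
      g \<in> M \<and> g \<notin> V \<and> (\<forall>S. subgroup S G \<longrightarrow> V \<subseteq> S \<longrightarrow> S \<subseteq> ?B \<longrightarrow> g \<in> S \<longrightarrow> S = ?B)"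
    by (elim exE)
  then have V: "subgroup V G" "V \<subseteq> ?B" "\<And>h x. h \<in> ?B \<Longrightarrow> x \<in> V \<Longrightarrow> h \<otimes> x \<otimes> inv h \<in> V"
    and g: "g \<in> M" "g \<notin> V" and gen: "\<And>S. subgroup S G \<Longrightarrow> V \<subseteq> S \<Longrightarrow> S \<subseteq> ?B \<Longrightarrow> g \<in> S \<Longrightarrow> S = ?B"
    by simp_all
  note Vm = subgroup.m_closed[OF V(1)] and Vi = subgroup.m_inv_closed[OF V(1)] and V1 = subgroup.one_closed[OF V(1)]
  have Vc: "x \<in> carrier G" if "x \<in> V" for x using subgroup.mem_carrier[OF V(1) that] .
  have gc: "g \<in> carrier G" using g M_carrier by blast
  have gM: "g [^] i \<in> M" for i :: nat by (induction i) (use M_one M_mult g gc in auto)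
  have gB: "g [^] i \<in> ?B" for i :: nat using gM M_B by blast
  have gp: "g [^] i \<in> carrier G" for i :: nat using gc by simp
  have cM: "g [^] card M = \<one>"
  proof -
    interpret Mg: group "G\<lparr>carrier := M\<rparr>" using subgroup_imp_group[OF M_subgroup] .
    have "g [^]\<^bsub>G\<lparr>carrier := M\<rparr>\<^esub> order (G\<lparr>carrier := M\<rparr>) = \<one>\<^bsub>G\<lparr>carrier := M\<rparr>\<^esub>"
      using Mg.pow_order_eq_1[of g] g by simp
    then show ?thesis using nat_pow_consistent[of g "card M" M] by (simp add: order_def)
  qed
  have cM0: "card M > 0" using finM M_one card_gt_0_iff by blast
  \<comment> \<open>The order of \<open>g\<close> modulo \<open>V\<close>. It divides
    \<open>card M\<close>, so any prime divisor of it is odd and does not divide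
    \<open>card \<Omega>\<close>.\<close>
  define r where "r = (LEAST i::nat. 0 < i \<and> g [^] i \<in> V)"
  have "0 < card M \<and> g [^] card M \<in> V" using cM cM0 V1 by simp
  then have "0 < r \<and> g [^] r \<in> V" unfolding r_def by (rule LeastI[of _ "card M"])
  then have r: "0 < r" "g [^] r \<in> V" by simp_all
  have rmin: "r \<le> i" if "0 < i" "g [^] i \<in> V" for i unfolding r_def by (rule Least_le) (use that in simp)
  have rdvd: "r dvd i" if i: "g [^] i \<in> V" for i
  proof (rule ccontr)
    assume n: "\<not> r dvd i"
    have pk: "g [^] (r * k) \<in> V" for k
      by (induction k) (use V1 r(2) Vm gc in \<open>auto simp: nat_pow_mult[symmetric]\<close>)
    have "g [^] i = g [^] (r * (i div r)) \<otimes> g [^] (i mod r)" using gc by (simp add: nat_pow_mult)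
    then have "g [^] (i mod r) = inv (g [^] (r * (i div r))) \<otimes> g [^] i" using gp by (simp add: group_word)
    then have "g [^] (i mod r) \<in> V" using Vm[OF Vi[OF pk] i] by simp
    moreover have "0 < i mod r" using n by (simp add: dvd_eq_mod_eq_0)
    ultimately have "r \<le> i mod r" using rmin by blast
    then show False using mod_less_divisor[OF r(1), of i] by linarith
  qed
  have "r \<noteq> 1" using r(2) g(2) gc by (metis nat_pow_eone)
  then obtain q where q: "Factorial_Ring.prime q" "q dvd r" using prime_factor_nat by blast
  have qM: "q dvd card M" using rdvd[of "card M"] cM V1 q(2) dvd_trans by simp
  have nq: "\<not> q dvd 2 * card \<Omega>"
  proof
    assume "q dvd 2 * card \<Omega>"
    then have "q = 1" using cop qM using coprime_common_divisor_nat by blast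
    then show False using q(1) by (simp add: prime_nat_iff)
  qed
  obtain c :: circle where c: "c \<noteq> 0" "nsm q c = 0" using circle_torsion_exists[OF q(1)] by blast
  define A where "A = {nsm n c |n. True}"
  interpret A: prime_order_subgroup q A unfolding A_def by (rule prime_order_subgroup_multiples[OF q(1) c])
  interpret alt_ext_hom G \<Omega> \<pi> q A
  proof
    show "odd q" using nq by (metis dvd_mult2 q(1) prime_nat_iff two_is_prime_nat primes_dvd_imp_eq dvd_refl)
    show "\<not> q dvd card \<Omega>" using nq dvd_mult by blast
  qed
  define S where "S = {x \<otimes> g [^] (i::nat) |x i. x \<in> V}"
  have SI: "x \<otimes> g [^] i \<in> S" if "x \<in> V" for x and i :: nat using that by (auto simp: S_def)
  have SE: "\<exists>x\<in>V. \<exists>i::nat. s = x \<otimes> g [^] i" if "s \<in> S" for s using that by (auto simp: S_def)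
  have mult: "(x \<otimes> g [^] i) \<otimes> (y \<otimes> g [^] j) = (x \<otimes> (g [^] i \<otimes> y \<otimes> inv (g [^] i))) \<otimes> g [^] (i + j)"
    if "x \<in> V" "y \<in> V" for x y and i j :: nat
    using that Vc gp gc by (simp add: group_word nat_pow_mult[symmetric])
  have mV: "x \<otimes> (g [^] i \<otimes> y \<otimes> inv (g [^] i)) \<in> V" if "x \<in> V" "y \<in> V" for x y and i :: nat
    using Vm[OF that(1) V(3)[OF gB that(2)]] .
  have SB: "S \<subseteq> ?B" using V(2) gB B_mult unfolding S_def by blast
  have "S = ?B"
  proof (rule gen)
    show "subgroup S G"
    proof (rule finite_subgroupI)
      show "S \<subseteq> carrier G" using SB B_carrier by blast
      then show "finite S" using finG finite_subset by blast
      show "S \<noteq> {}" using SI[OF V1] by blast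
      fix s t assume st: "s \<in> S" "t \<in> S"
      obtain x i where xi: "x \<in> V" "s = x \<otimes> g [^] (i::nat)" using SE[OF st(1)] by blast
      obtain y j where yj: "y \<in> V" "t = y \<otimes> g [^] (j::nat)" using SE[OF st(2)] by blast
      show "s \<otimes> t \<in> S" unfolding xi(2) yj(2) mult[OF xi(1) yj(1)] by (rule SI[OF mV[OF xi(1) yj(1)]])
    qed
    show "V \<subseteq> S"
    proof
      fix x assume x: "x \<in> V"
      show "x \<in> S" using SI[OF x, of 0] Vc[OF x] by simp
    qed
    show "g \<in> S" using SI[OF V1, of 1] gc by simp
  qed (rule SB)
  then have BE: "\<exists>x\<in>V. \<exists>i::nat. h = x \<otimes> g [^] i" if "h \<in> ?B" for h using SE that by blast
  \<comment> \<open>Sends \<open>g\<close> to \<open>c\<close>. The exponent is determined modulo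
    \<open>r\<close>, hence modulo \<open>q\<close>, so the choice does not affect the multiple of
    \<open>c\<close>.\<close>
  define \<phi> where "\<phi> h = nsm (SOME i. \<exists>x\<in>V. h = x \<otimes> g [^] i) c" for h
  have unique: "nsm i c = nsm j c" if xy: "x \<in> V" "y \<in> V" "x \<otimes> g [^] i = y \<otimes> g [^] j" and le: "i \<le> j" for x y and i j :: nat
  proof -
    define d where "d = j - i"
    have d: "j = d + i" using le by (simp add: d_def)
    have "y \<otimes> g [^] j = (y \<otimes> g [^] d) \<otimes> g [^] i" using Vc[OF xy(2)] gp gc by (simp add: d nat_pow_mult[symmetric] m_assoc)
    then have "x = y \<otimes> g [^] d" using xy(3) Vc xy(1,2) gp by (metis m_closed r_cancel)
    then have "g [^] d = inv y \<otimes> x" using Vc[OF xy(2)] gp by (simp add: group_word)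
    then have "g [^] d \<in> V" using Vm Vi xy(1,2) by simp
    then have "q dvd d" using rdvd q(2) dvd_trans by blast
    then obtain e where "d = q * e" by blast
    then have "nsm d c = 0" using c(2) by (metis mult.commute nsm_mult nsm_zero)
    then show ?thesis by (simp add: d nsm_add)
  qed
  have \<phi>: "\<phi> (x \<otimes> g [^] i) = nsm i c" if x: "x \<in> V" for x and i :: nat
  proof -
    define j where "j = (SOME j. \<exists>y\<in>V. x \<otimes> g [^] i = y \<otimes> g [^] (j::nat))"
    have "\<exists>y\<in>V. x \<otimes> g [^] i = y \<otimes> g [^] j" unfolding j_def by (rule someI[of _ i]) (use x in blast)
    then obtain y where y: "y \<in> V" "x \<otimes> g [^] i = y \<otimes> g [^] j" by blast
    have "nsm j c = nsm i c"
    proof (cases "i \<le> j")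
      case True
      show ?thesis by (rule unique[OF x y(1,2) True, symmetric])
    next
      case False
      then have "j \<le> i" by simp
      then show ?thesis by (rule unique[OF y(1) x y(2)[symmetric]])
    qed
    then show ?thesis by (simp add: \<phi>_def j_def)
  qed
  have "is_hom ?B \<phi>"
    unfolding is_hom_def
  proof (intro ballI)
    fix s t assume st: "s \<in> ?B" "t \<in> ?B"
    obtain x i where xi: "x \<in> V" "s = x \<otimes> g [^] (i::nat)" using BE[OF st(1)] by blast
    obtain y j where yj: "y \<in> V" "t = y \<otimes> g [^] (j::nat)" using BE[OF st(2)] by blast
    show "\<phi> (s \<otimes> t) = \<phi> s + \<phi> t"
      unfolding xi(2) yj(2) mult[OF xi(1) yj(1)] using \<phi>[OF mV[OF xi(1) yj(1)]] \<phi>[OF xi(1)] \<phi>[OF yj(1)] by (simp add: nsm_add)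
  qed
  moreover have "\<phi> h \<in> A" for h unfolding \<phi>_def A_def by blast
  ultimately have "\<phi> g = 0" using pair_hom_vanishes[OF ab _ _ g(1)] by blast
  moreover have "\<phi> g = c" using \<phi>[OF V1, of 1] gc by simp
  ultimately show False using c(1) by simp
qed

end

section \<open>Faithful permutation representations\<close>

lemma (in group) stabilizer_card:
  assumes "finite (carrier G)" and h: "\<And>x. x \<in> carrier G \<Longrightarrow> h x permutes S"
    and mult: "\<And>x y. x \<in> carrier G \<Longrightarrow> y \<in> carrier G \<Longrightarrow> h (x \<otimes> y) = h x \<circ> h y"
    and "finite S" "s \<in> S"
  shows "card (carrier G) \<le> card S * card {x \<in> carrier G. h x s = s}"
proof -
  have "card (carrier G) \<le> card ((\<lambda>x. h x s) ` carrier G) * card {x \<in> carrier G. h x s = s}"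
  proof (rule card_le_image_times_fibre[OF assms(1)])
    fix x assume x: "x \<in> carrier G"
    show "card {y \<in> carrier G. h y s = h x s} \<le> card {x \<in> carrier G. h x s = s}"
    proof (rule card_inj_on_le[where f = "\<lambda>y. inv x \<otimes> y"])
      show "inj_on (\<lambda>y. inv x \<otimes> y) {y \<in> carrier G. h y s = h x s}" by (rule inj_onI) (use x in simp)
      show "(\<lambda>y. inv x \<otimes> y) ` {y \<in> carrier G. h y s = h x s} \<subseteq> {x \<in> carrier G. h x s = s}"
      proof (rule image_subsetI)
        fix y assume y: "y \<in> {y \<in> carrier G. h y s = h x s}"
        have "h x = h x \<circ> h \<one>" using mult[of x \<one>] x by simp
        then have "h \<one> s = s" using permutes_inj[OF h[OF x]] by (metis comp_apply injD)
        then have "h (inv x \<otimes> x) s = s" using x by simp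
        then have "h (inv x \<otimes> y) s = s" using mult[of "inv x" x] mult[of "inv x" y] x y by simp
        then show "inv x \<otimes> y \<in> {x \<in> carrier G. h x s = s}" using x y by simp
      qed
      show "finite {x \<in> carrier G. h x s = s}" using assms(1) by simp
    qed
  qed
  also have "\<dots> \<le> card S * card {x \<in> carrier G. h x s = s}"
  proof (rule mult_right_mono[OF card_mono[OF assms(4)]])
    show "(\<lambda>x. h x s) ` carrier G \<subseteq> S"
    proof (rule image_subsetI)
      fix x assume x: "x \<in> carrier G"
      show "h x s \<in> S" using permutes_in_image[OF h[OF x]] assms(5) by simp
    qed
  qed simp
  finally show ?thesis .
qed

lemma six_choose_3: "6 * (n + 3 choose 3) = (n + 3) * (n + 2) * (n + 1)"
proof -
  have "2 * (n + 2 choose 2) = (n + 2) * (n + 1)"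
    using Suc_times_binomial_eq[of "n + 1" 1] by (simp add: numeral_2_eq_2)
  moreover have "3 * (n + 3 choose 3) = (n + 3) * (n + 2 choose 2)"
    using Suc_times_binomial_eq[of "n + 2" 2] by (simp add: numeral_3_eq_3 eval_nat_numeral mult.commute)
  ultimately have "2 * (3 * (n + 3 choose 3)) = (n + 3) * ((n + 2) * (n + 1))"
    by (metis mult.left_commute)
  moreover have "6 * (n + 3 choose 3) = 2 * (3 * (n + 3 choose 3))" by simp
  ultimately show ?thesis by (simp only: mult.assoc)
qed

context alt_ext
begin

lemma card_subgroup_image:
  assumes Y: "subgroup Y G" shows "card Y = card (\<pi> ` Y) * card (M \<inter> Y)"
proof -
  have Yc: "x \<in> carrier G" if "x \<in> Y" for x using subgroup.mem_carrier[OF Y that] .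
  have "Y \<subseteq> carrier G" using Yc by blast
  then have finY: "finite Y" using finG finite_subset by blast
  have "card Y = (\<Sum>c\<in>\<pi> ` Y. card {x \<in> Y. \<pi> x = c})"
    using sum.image_gen[OF finY, of "\<lambda>_. 1::nat" \<pi>] by simp
  also have "\<dots> = (\<Sum>c\<in>\<pi> ` Y. card (M \<inter> Y))"
  proof (rule sum.cong[OF refl])
    fix c assume "c \<in> \<pi> ` Y"
    then obtain x where x: "x \<in> Y" "c = \<pi> x" by blast
    have "{y \<in> Y. \<pi> y = c} = (\<lambda>m. x \<otimes> m) ` (M \<inter> Y)"
    proof (intro equalityI subsetI)
      fix y assume "y \<in> {y \<in> Y. \<pi> y = c}"
      then have y: "y \<in> Y" "\<pi> y = \<pi> x" using x by auto
      have "inv x \<otimes> y \<in> M" using \<pi>_eq_M'[OF Yc[OF y(1)] Yc[OF x(1)] y(2)] .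
      moreover have "inv x \<otimes> y \<in> Y"
        using subgroup.m_closed[OF Y subgroup.m_inv_closed[OF Y x(1)] y(1)] .
      moreover have "y = x \<otimes> (inv x \<otimes> y)" using Yc x(1) y(1) by (simp add: group_word)
      ultimately show "y \<in> (\<lambda>m. x \<otimes> m) ` (M \<inter> Y)" by blast
    next
      fix y assume "y \<in> (\<lambda>m. x \<otimes> m) ` (M \<inter> Y)"
      then obtain m where m: "m \<in> M" "m \<in> Y" "y = x \<otimes> m" by blast
      have "y \<in> Y" using subgroup.m_closed[OF Y x(1) m(2)] m(3) by simp
      moreover have "\<pi> y = c" using \<pi>_mult[OF Yc[OF x(1)] Yc[OF m(2)]] \<pi>_M[OF m(1)] m(3) x(2) by simp
      ultimately show "y \<in> {y \<in> Y. \<pi> y = c}" by simp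
    qed
    moreover have "inj_on (\<lambda>m. x \<otimes> m) (M \<inter> Y)" by (rule inj_onI) (use Yc x(1) in simp)
    ultimately show "card {y \<in> Y. \<pi> y = c} = card (M \<inter> Y)" by (simp add: card_image)
  qed
  finally show ?thesis by simp
qed

lemma alt_subgroup_image:
  assumes Y: "subgroup Y G" shows "alt_subgroup \<Omega> (\<pi> ` Y)"
  unfolding alt_subgroup_def
proof (intro conjI ballI)
  have Yc: "x \<in> carrier G" if "x \<in> Y" for x using subgroup.mem_carrier[OF Y that] .
  show "\<pi> ` Y \<subseteq> Alt \<Omega>" using Yc \<pi>_Alt by blast
  show "id \<in> \<pi> ` Y" using subgroup.one_closed[OF Y] \<pi>_one by (metis imageI)
  fix p assume "p \<in> \<pi> ` Y"
  then obtain x where x: "x \<in> Y" "p = \<pi> x" by blast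
  show "inv' p \<in> \<pi> ` Y" using subgroup.m_inv_closed[OF Y x(1)] \<pi>_inv[OF Yc[OF x(1)]] x(2) by (metis imageI)
  fix q assume "q \<in> \<pi> ` Y"
  then obtain y where y: "y \<in> Y" "q = \<pi> y" by blast
  show "p \<circ> q \<in> \<pi> ` Y"
    using subgroup.m_closed[OF Y x(1) y(1)] \<pi>_mult[OF Yc[OF x(1)] Yc[OF y(1)]] x(2) y(2) by (metis imageI)
qed

theorem faithful_degree:
  assumes cop: "coprime (2 * card \<Omega>) (card M)" and M1: "M \<noteq> {\<one>}"
    and h: "h \<in> hom G (sym_group n)" and inj: "inj_on h (carrier G)"
  shows "3 * (card \<Omega> choose 3) \<le> n"
proof (rule ccontr)
  assume "\<not> ?thesis"
  then have n: "n < 3 * (card \<Omega> choose 3)" by simp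
  have hperm: "h x permutes {1..n}" if "x \<in> carrier G" for x
    using h that by (auto simp: hom_def sym_group_def)
  have hmult: "h (x \<otimes> y) = h x \<circ> h y" if "x \<in> carrier G" "y \<in> carrier G" for x y
    using h that by (auto simp: hom_def sym_group_def)
  define Y where "Y \<omega> = {x \<in> carrier G. h x \<omega> = \<omega>}" for \<omega>
  have h1: "h \<one> = id"
  proof -
    have "h \<one> \<circ> h \<one> = h \<one>" using hmult[of \<one> \<one>] by simp
    then show ?thesis using permutes_inj[OF hperm[OF one_closed]] by (metis comp_apply eq_id_iff injD)
  qed
  have Ys: "subgroup (Y \<omega>) G" for \<omega>
  proof (rule finite_subgroupI)
    show "Y \<omega> \<noteq> {}" using h1 by (auto simp: Y_def)
  qed (use finG hmult in \<open>auto simp: Y_def\<close>)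
  have "\<exists>\<omega>\<in>{1..n}. \<not> M \<subseteq> Y \<omega>"
  proof (rule ccontr)
    assume "\<not> ?thesis"
    then have fixes_all: "h m \<omega> = \<omega>" if "m \<in> M" "\<omega> \<in> {1..n}" for m \<omega> using that by (auto simp: Y_def)
    have "m = \<one>" if m: "m \<in> M" for m
    proof -
      have "h m \<omega> = \<omega>" for \<omega>
        using fixes_all[OF m, of \<omega>] permutes_not_in[OF hperm[OF M_carrier[OF m]], of \<omega>] by (cases "\<omega> \<in> {1..n}") auto
      then have "h m = h \<one>" using h1 by auto
      then show ?thesis using inj M_carrier[OF m] by (auto dest: inj_onD)
    qed
    then show False using M1 M_one by blast
  qed
  then obtain \<omega> where \<omega>: "\<omega> \<in> {1..n}" and nM: "\<not> M \<subseteq> Y \<omega>" by blast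
  define L where "L = \<pi> ` Y \<omega>"
  have L: "alt_subgroup \<Omega> L" unfolding L_def by (rule alt_subgroup_image[OF Ys])
  have finL: "finite L" using alt_subgroupD(1)[OF L] finite_Alt[OF fin\<Omega>] finite_subset by blast
  have L0: "card L > 0" using finL alt_subgroupD(2)[OF L] card_gt_0_iff by blast
  have MY: "subgroup (M \<inter> Y \<omega>) G" by (rule subgroups_Inter_pair[OF M_subgroup Ys])
  define l where "l = card (M \<inter> Y \<omega>)"
  have l0: "l > 0" unfolding l_def using subgroup.one_closed[OF MY] finM card_gt_0_iff by blast
  have "l dvd card M" unfolding l_def by (rule card_subgroup_dvd[OF MY M_subgroup]) simp
  then obtain e where e: "card M = l * e" by blast
  have "e \<noteq> 1"
  proof
    assume "e = 1"
    then have "M \<inter> Y \<omega> = M" using e finM by (intro card_subset_eq) (auto simp: l_def)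
    then show False using nM by blast
  qed
  moreover have "odd e"
  proof
    assume "even e"
    then have "even (card M)" using e by simp
    then show False using cop by simp
  qed
  \<comment> \<open>Source of the factor 3 in the bound.\<close>
  ultimately have "3 \<le> e" using odd_pos[of e] by presburger
  then have e3: "3 * l \<le> card M" using e by simp
  have "card (carrier G) \<le> n * card (Y \<omega>)"
    using stabilizer_card[OF finG hperm hmult _ \<omega>] by (simp add: Y_def)
  then have main: "card (Alt \<Omega>) * card M \<le> n * (card L * l)"
    using card_subgroup_image[OF Ys, of \<omega>] card_subgroup_image[OF subgroup_self] \<pi>_image M_carrier
    by (simp add: L_def l_def Int_absorb2 subsetI)
  have "3 * card (Alt \<Omega>) * l \<le> card (Alt \<Omega>) * card M" using e3 by (simp add: mult.assoc mult.left_commute)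
  also note main
  finally have "3 * card (Alt \<Omega>) * l \<le> (n * card L) * l" by (simp add: mult.assoc)
  then have "3 * card (Alt \<Omega>) \<le> n * card L" using l0 by simp
  also have "\<dots> < 3 * (card \<Omega> choose 3) * card L" using n L0 by simp
  finally have "card (Alt \<Omega>) < (card \<Omega> choose 3) * card L" by simp
  moreover have "21 \<le> card \<Omega>" using card_\<Omega> by simp
  ultimately obtain C where C: "C \<subseteq> \<Omega>" "card \<Omega> \<le> card C + 2" "Alt C \<subseteq> L" "\<And>p. p \<in> L \<Longrightarrow> p ` C = C"
    using small_index_alt[OF fin\<Omega> L] by metis
  have "C \<noteq> \<Omega>"
  proof
    assume "C = \<Omega>"
    then have "\<pi> ` Y \<omega> = Alt \<Omega>" using C(3) alt_subgroupD(1)[OF L] by (auto simp: L_def)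
    then have "Y \<omega> = carrier G" by (rule frattini[OF Ys])
    then show False using nM M_carrier by blast
  qed
  then obtain a where a: "a \<in> \<Omega>" "a \<notin> C" using C(1) by blast
  have "card C < card \<Omega>" using a C(1) fin\<Omega> by (intro psubset_card_mono) auto
  then have "card \<Omega> = card C + 1 \<or> card \<Omega> = card C + 2" using C(2) by linarith
  \<comment> \<open>\<open>L\<close> preserves \<open>C\<close>, so its index is at least
    \<open>card \<Omega>\<close>. This lowers the bound on the index of
    \<open>M \<inter> Y \<omega>\<close> in \<open>M\<close> by that factor.\<close>
  then have "card \<Omega> \<le> card \<Omega> choose card C"
  proof
    assume k: "card \<Omega> = card C + 2"
    have "card \<Omega> choose card C = card \<Omega> choose 2" using binomial_symmetric[of "card C" "card \<Omega>"] k by simp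
    moreover have "card \<Omega> * 2 \<le> card \<Omega> * (card \<Omega> - 1)" using card_\<Omega> by simp
    then have "card \<Omega> \<le> card \<Omega> * (card \<Omega> - 1) div 2" using div_le_mono[of "card \<Omega> * 2" _ 2] by simp
    ultimately show ?thesis by (simp add: choose_two)
  qed simp
  then have "card \<Omega> * card L \<le> (card \<Omega> choose card C) * card L" by simp
  also have "\<dots> \<le> card (Alt \<Omega>)"
    using invariant_set_card[OF fin\<Omega> L subset_refl C(1)] C(4) card_\<Omega> by simp
  finally have "card \<Omega> * card L * card M \<le> card (Alt \<Omega>) * card M" by simp
  also note main
  finally have "(card \<Omega> * card M) * card L \<le> (n * l) * card L" by (simp add: mult.assoc mult.left_commute mult.commute)
  then have "card \<Omega> * card M \<le> n * l" using L0 by simp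
  also have "\<dots> < 3 * (card \<Omega> choose 3) * l" using n l0 by simp
  finally have km: "card \<Omega> * card M < 3 * (card \<Omega> choose 3) * l" .
  \<comment> \<open>That index is now below (k-1)(k-2)/2, which is at most the binomial since 3(k-1)
    \<le> (k-3)(k-4). Writing k as j + 23 avoids truncated subtraction.\<close>
  have small: "card M < (card \<Omega> - 2 choose 3) * l"
  proof -
    obtain j where j: "card \<Omega> = j + 23" using card_\<Omega> le_Suc_ex add.commute by metis
    have "6 * (card \<Omega> choose 3) = (j + 23) * (j + 22) * (j + 21)" using six_choose_3[of "j + 20"] by (simp add: j add.commute)
    then have "2 * (3 * (card \<Omega> choose 3)) * l = (j + 23) * ((j + 22) * (j + 21) * l)" by (simp add: mult.assoc)
    then have "(j + 23) * (2 * card M) < (j + 23) * ((j + 22) * (j + 21) * l)" using km unfolding j by linarith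
    then have "2 * card M < (j + 22) * (j + 21) * l" by (rule mult_less_cancel1[THEN iffD1, THEN conjunct2])
    then have "6 * card M < 3 * ((j + 22) * (j + 21) * l)" by linarith
    also have "\<dots> = 3 * (j + 22) * (j + 21) * l" by (simp only: mult.assoc)
    also have "\<dots> \<le> (j + 21) * (j + 20) * (j + 19) * l" by (intro mult_right_mono) (auto simp: algebra_simps)
    also have "\<dots> = 6 * (card \<Omega> - 2 choose 3) * l" using six_choose_3[of "j + 18"] by (simp add: j add.commute)
    finally show ?thesis by simp
  qed
  \<comment> \<open>If \<open>C\<close> misses only \<open>a\<close>, any further point serves as
    \<open>b\<close>.\<close>
  have "\<exists>b\<in>\<Omega>. b \<noteq> a \<and> \<Omega> - {a, b} \<subseteq> C"
  proof (cases "\<Omega> - {a} \<subseteq> C")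
    case True
    have "card (\<Omega> - {a}) > 0" using a fin\<Omega> card_\<Omega> by simp
    then obtain b where "b \<in> \<Omega> - {a}" by (metis card_gt_0_iff ex_in_conv)
    then show ?thesis using True by blast
  next
    case False
    then obtain b where b: "b \<in> \<Omega>" "b \<noteq> a" "b \<notin> C" by blast
    have "C \<subseteq> \<Omega> - {a, b}" using a b C(1) by blast
    moreover have "card (\<Omega> - {a, b}) \<le> card C" using C(2) a b fin\<Omega> by simp
    ultimately have "C = \<Omega> - {a, b}" using fin\<Omega> by (intro card_seteq) auto
    then show ?thesis using b by blast
  qed
  then obtain b where b: "b \<in> \<Omega>" "b \<noteq> a" "\<Omega> - {a, b} \<subseteq> C" by blast
  let ?Y = "Y \<omega> \<inter> B {a, b}"
  have ab: "{a, b} \<subseteq> \<Omega>" using a(1) b(1) by blast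
  have im: "\<pi> ` ?Y = Alt (\<Omega> - {a, b})"
  proof (intro equalityI subsetI)
    fix p assume "p \<in> \<pi> ` ?Y"
    then show "p \<in> Alt (\<Omega> - {a, b})" using \<pi>_B[OF ab] by blast
  next
    fix p assume p: "p \<in> Alt (\<Omega> - {a, b})"
    then have "p \<in> L" using Alt_mono[OF b(3)] C(3) by blast
    then obtain y where y: "y \<in> Y \<omega>" "p = \<pi> y" by (auto simp: L_def)
    have "\<pi> y i = i" if "i \<in> {a, b}" for i using Alt_outside[OF p, of i] that y(2) by simp
    then have "y \<in> B {a, b}" using subgroup.mem_carrier[OF Ys y(1)] by (simp add: B_def)
    then show "p \<in> \<pi> ` ?Y" using y by blast
  qed
  have "M \<inter> ?Y = M \<inter> Y \<omega>" using M_B by blast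
  moreover have "card (\<Omega> - {a, b}) = card \<Omega> - 2" using a b fin\<Omega> by simp
  ultimately have "card M < (card (\<Omega> - {a, b}) choose 3) * card (M \<inter> ?Y)" using small by (simp add: l_def)
  then have "M \<subseteq> ?Y"
    using no_small_supplement[OF cop a(1) b(1) b(2)[symmetric] subgroups_Inter_pair[OF Ys B_subgroup] _ im] by blast
  then show False using nM by blast
qed

end

text \<open>Ensures that some degree occurs at all, so that the \<open>LEAST\<close> in
  \<open>min_perm_degree\<close> is attained.\<close>

lemma (in group) cayley:
  assumes fin: "finite (carrier G)"
  shows "\<exists>h. h \<in> hom G (sym_group (card (carrier G))) \<and> inj_on h (carrier G)"
proof -
  let ?N = "{1..card (carrier G)}"
  obtain f where f: "bij_betw f ?N (carrier G)" using ex_bij_betw_nat_finite_1[OF fin] by blast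
  define g where "g = inv_into ?N f"
  have fc: "f i \<in> carrier G" if "i \<in> ?N" for i using bij_betwE[OF f] that by blast
  have gN: "g x \<in> ?N" if "x \<in> carrier G" for x
    using that f inv_into_into[of x f ?N] by (simp add: g_def bij_betw_def)
  have fg: "f (g x) = x" if "x \<in> carrier G" for x
    using that f f_inv_into_f[of x f ?N] by (simp add: g_def bij_betw_def)
  have gf: "g (f i) = i" if "i \<in> ?N" for i
    using that f inv_into_f_f[of f ?N i] by (simp add: g_def bij_betw_def)
  define h where "h x i = (if i \<in> ?N then g (x \<otimes> f i) else i)" for x i
  have hN: "h x i \<in> ?N" if "x \<in> carrier G" "i \<in> ?N" for x i
    using gN[OF m_closed[OF that(1) fc[OF that(2)]]] that(2) by (simp add: h_def)
  have hmult: "h (x \<otimes> y) = h x \<circ> h y" if "x \<in> carrier G" "y \<in> carrier G" for x y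
  proof
    fix i
    show "h (x \<otimes> y) i = (h x \<circ> h y) i"
    proof (cases "i \<in> ?N")
      case True
      have "f (h y i) = y \<otimes> f i" using fg[OF m_closed[OF that(2) fc[OF True]]] True by (simp add: h_def)
      moreover have "h x (h y i) = g (x \<otimes> f (h y i))" using hN[OF that(2) True] by (simp add: h_def)
      moreover have "h (x \<otimes> y) i = g (x \<otimes> y \<otimes> f i)" using True by (simp add: h_def)
      ultimately show ?thesis using that fc[OF True] by (simp add: m_assoc)
    next
      case False
      then show ?thesis by (auto simp: h_def)
    qed
  qed
  have h1: "h \<one> i = i" for i using gf[of i] fc[of i] by (cases "i \<in> ?N") (simp_all add: h_def)
  have "h x permutes ?N" if x: "x \<in> carrier G" for x
  proof (rule bij_imp_permutes)
    have inv: "h (inv x) (h x i) = i" for i using hmult[of "inv x" x] x h1[of i] by (metis comp_apply inv_closed l_inv)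
    have "inj_on (h x) ?N" by (rule inj_onI) (metis inv)
    moreover have "h x ` ?N \<subseteq> ?N" using hN[OF x] by blast
    ultimately show "bij_betw (h x) ?N ?N" using endo_inj_surj[of ?N "h x"] by (simp add: bij_betw_def)
    show "h x i = i" if "i \<notin> ?N" for i using that by (auto simp: h_def)
  qed
  then have "h \<in> hom G (sym_group (card (carrier G)))"
    using hmult by (auto simp: hom_def sym_group_def)
  moreover have "inj_on h (carrier G)"
  proof (rule inj_onI)
    fix x y assume xy: "x \<in> carrier G" "y \<in> carrier G" "h x = h y"
    have i: "g \<one> \<in> ?N" "f (g \<one>) = \<one>" using gN fg by auto
    have "h z (g \<one>) = g z" if "z \<in> carrier G" for z
      using i that by (simp add: h_def del: atLeastAtMost_iff)
    then have "g x = g y" using xy by metis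
    then show "x = y" using fg xy by metis
  qed
  ultimately show ?thesis by blast
qed

theorem theorem2p2:
  fixes H :: "('a, 'b) monoid_scheme" and M :: "'a set" and k :: nat
  assumes "k > 22"
    and "group H" and "finite (carrier H)"
    and "M \<lhd> H" and "M \<noteq> {\<one>\<^bsub>H\<^esub>}"
    and "H Mod M \<cong> alt_group k"
    and "\<not> has_complement H M"
    and "gcd (2 * k) (card M) = 1"
  shows "real (min_perm_degree H) \<ge> (1/2) * real k * (real k - 1) * (real k - 2)"
proof -
  interpret H: group H by fact
  interpret N: normal M H by fact
  have Ms: "subgroup M H" by (rule N.subgroup_axioms)
  let ?\<Omega> = "{1..k}"
  have "\<exists>h. h \<in> hom H (sym_group (min_perm_degree H)) \<and> inj_on h (carrier H)"
    unfolding min_perm_degree_def by (rule LeastI) (rule H.cayley[OF assms(3)])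
  then obtain h where h: "h \<in> hom H (sym_group (min_perm_degree H))" "inj_on h (carrier H)" by blast
  obtain \<phi> where \<phi>: "\<phi> \<in> iso (H Mod M) (alt_group k)" using assms(6) by (auto simp: is_iso_def)
  have altc: "carrier (alt_group k) = Alt ?\<Omega>" by (auto simp: alt_group_def Alt_def)
  have \<phi>hom: "\<phi> \<in> hom (H Mod M) (alt_group k)" and \<phi>bij: "bij_betw \<phi> (rcosets\<^bsub>H\<^esub> M) (Alt ?\<Omega>)"
    using \<phi> altc by (auto simp: iso_def FactGroup_def)
  define \<pi> where "\<pi> x = \<phi> (M #>\<^bsub>H\<^esub> x)" for x
  have rc: "M #>\<^bsub>H\<^esub> x \<in> rcosets\<^bsub>H\<^esub> M" if "x \<in> carrier H" for x using that by (auto simp: RCOSETS_def)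
  have \<pi>_mult: "\<pi> (x \<otimes>\<^bsub>H\<^esub> y) = \<pi> x \<circ> \<pi> y" if "x \<in> carrier H" "y \<in> carrier H" for x y
  proof -
    have "\<phi> ((M #>\<^bsub>H\<^esub> x) \<otimes>\<^bsub>H Mod M\<^esub> (M #>\<^bsub>H\<^esub> y)) = \<phi> (M #>\<^bsub>H\<^esub> x) \<otimes>\<^bsub>alt_group k\<^esub> \<phi> (M #>\<^bsub>H\<^esub> y)"
      using rc that by (intro hom_mult[OF \<phi>hom]) (auto simp: FactGroup_def)
    then show ?thesis using N.rcos_sum[OF that] by (simp add: \<pi>_def FactGroup_def alt_group_mult)
  qed
  have \<pi>_image: "\<pi> ` carrier H = Alt ?\<Omega>"
  proof -
    have "\<pi> ` carrier H = \<phi> ` (rcosets\<^bsub>H\<^esub> M)" by (auto simp: \<pi>_def RCOSETS_def)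
    then show ?thesis using \<phi>bij by (simp add: bij_betw_def)
  qed
  have \<pi>_one: "\<pi> \<one>\<^bsub>H\<^esub> = id"
  proof -
    have "bij (\<pi> \<one>\<^bsub>H\<^esub>)" using \<pi>_image Alt_bij by blast
    moreover have "\<pi> \<one>\<^bsub>H\<^esub> \<circ> \<pi> \<one>\<^bsub>H\<^esub> = \<pi> \<one>\<^bsub>H\<^esub>" using \<pi>_mult[of "\<one>\<^bsub>H\<^esub>" "\<one>\<^bsub>H\<^esub>"] by simp
    ultimately show ?thesis by (metis bij_is_inj comp_apply eq_id_iff injD)
  qed
  have \<pi>_M: "\<pi> x = id \<longleftrightarrow> x \<in> M" if x: "x \<in> carrier H" for x
  proof
    assume "\<pi> x = id"
    then have "\<phi> (M #>\<^bsub>H\<^esub> x) = \<phi> (M #>\<^bsub>H\<^esub> \<one>\<^bsub>H\<^esub>)" using \<pi>_one by (simp add: \<pi>_def)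
    then have "M #>\<^bsub>H\<^esub> x = M #>\<^bsub>H\<^esub> \<one>\<^bsub>H\<^esub>" using \<phi>bij rc[OF x] rc[OF H.one_closed] by (auto simp: bij_betw_def dest: inj_onD)
    then have "M #>\<^bsub>H\<^esub> x = M" using H.coset_mult_one[OF N.subset] by simp
    then show "x \<in> M" using H.rcos_self[OF x Ms] by simp
  next
    assume "x \<in> M"
    then have "M #>\<^bsub>H\<^esub> x = M #>\<^bsub>H\<^esub> \<one>\<^bsub>H\<^esub>" using H.coset_join2[OF x Ms] H.coset_mult_one[OF N.subset] by simp
    then show "\<pi> x = id" using \<pi>_one by (simp add: \<pi>_def)
  qed
  \<comment> \<open>Minimal order turns into assumption \<open>frattini\<close> for
    \<open>K\<close>; a faithful action of \<open>H\<close> stays faithful on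
    \<open>K\<close>.\<close>
  have "\<exists>K. (subgroup K H \<and> \<pi> ` K = Alt ?\<Omega>) \<and> (\<forall>S. subgroup S H \<and> \<pi> ` S = Alt ?\<Omega> \<longrightarrow> card K \<le> card S)"
    by (rule ex_has_least_nat[of _ "carrier H"]) (use H.subgroup_self \<pi>_image in blast)
  then obtain K where K: "subgroup K H" "\<pi> ` K = Alt ?\<Omega>"
    and Kmin: "\<And>S. subgroup S H \<Longrightarrow> \<pi> ` S = Alt ?\<Omega> \<Longrightarrow> card K \<le> card S" by blast
  have Kc: "x \<in> carrier H" if "x \<in> K" for x using subgroup.mem_carrier[OF K(1) that] .
  have finK: "finite K" using finite_subset[OF subgroup.subset[OF K(1)] assms(3)] .
  let ?K = "H\<lparr>carrier := K\<rparr>"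
  interpret K: alt_ext ?K ?\<Omega> \<pi>
  proof (intro alt_ext.intro alt_ext_axioms.intro)
    show "group ?K" using H.subgroup_imp_group[OF K(1)] .
    show "finite (carrier ?K)" using finK by simp
    show "\<pi> (x \<otimes>\<^bsub>?K\<^esub> y) = \<pi> x \<circ> \<pi> y" if "x \<in> carrier ?K" "y \<in> carrier ?K" for x y
      using \<pi>_mult[of x y] Kc that by simp
    show "S = carrier ?K" if S: "subgroup S ?K" "\<pi> ` S = Alt ?\<Omega>" for S
    proof -
      have "S \<subseteq> K" using subgroup.subset[OF S(1)] by simp
      then have "S = K" using Kmin[OF H.incl_subgroup[OF K(1) S(1)] S(2)] finK by (intro card_seteq) auto
      then show ?thesis by simp
    qed
  qed (use assms(1) K(2) in simp_all)
  have KM: "K.M = K \<inter> M" using \<pi>_M Kc by (auto simp: K.M_def)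
  have "K \<inter> M \<noteq> {\<one>\<^bsub>H\<^esub>}"
  proof
    assume triv: "K \<inter> M = {\<one>\<^bsub>H\<^esub>}"
    have "carrier H \<subseteq> K <#>\<^bsub>H\<^esub> M"
    proof
      fix x assume x: "x \<in> carrier H"
      then have "\<pi> x \<in> \<pi> ` K" using \<pi>_image K(2) by blast
      then obtain y where y: "y \<in> K" "\<pi> x = \<pi> y" by blast
      have yc: "y \<in> carrier H" using Kc[OF y(1)] .
      let ?m = "inv\<^bsub>H\<^esub> y \<otimes>\<^bsub>H\<^esub> x"
      have "\<pi> ?m = \<pi> (inv\<^bsub>H\<^esub> y \<otimes>\<^bsub>H\<^esub> y)" using \<pi>_mult[of _ x] \<pi>_mult[of _ y] x yc y(2) by (metis H.inv_closed)
      then have "?m \<in> M" using \<pi>_M[of ?m] x yc \<pi>_one by simp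
      moreover have "x = y \<otimes>\<^bsub>H\<^esub> ?m" using x yc by (simp add: H.m_assoc[symmetric])
      ultimately show "x \<in> K <#>\<^bsub>H\<^esub> M" using y(1) unfolding set_mult_def by blast
    qed
    moreover have "K <#>\<^bsub>H\<^esub> M \<subseteq> carrier H" using H.setmult_subset_G[OF subgroup.subset[OF K(1)] N.subset] .
    ultimately have "has_complement H M" using K(1) triv by (auto simp: has_complement_def)
    then show False using assms(7) by simp
  qed
  moreover have "coprime (2 * card ?\<Omega>) (card K.M)"
  proof -
    have "card K.M dvd card M"
      unfolding KM by (rule H.card_subgroup_dvd[OF H.subgroups_Inter_pair[OF K(1) Ms] Ms]) simp
    moreover have "coprime (2 * k) (card M)" using assms(8) by (simp add: coprime_iff_gcd_eq_1)
    ultimately show ?thesis using coprime_divisors[of "2 * k" "2 * k" "card K.M" "card M"] by simp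
  qed
  moreover have "h \<in> hom ?K (sym_group (min_perm_degree H))"
    using h(1) Kc by (auto simp: hom_def)
  moreover have "inj_on h (carrier ?K)"
    using inj_on_subset[OF h(2) subgroup.subset[OF K(1)]] by simp
  ultimately have deg: "3 * (k choose 3) \<le> min_perm_degree H"
    using K.faithful_degree[of h "min_perm_degree H"] KM by simp
  obtain j where j: "k = j + 3" using assms(1) le_Suc_ex[of 3 k] by (auto simp: add.commute)
  have "(j + 3) * (j + 2) * (j + 1) \<le> 2 * min_perm_degree H" using deg six_choose_3[of j] unfolding j by linarith
  then have "real ((j + 3) * (j + 2) * (j + 1)) \<le> real (2 * min_perm_degree H)" by (rule of_nat_mono)
  moreover have "real ((j + 3) * (j + 2) * (j + 1)) = real k * (real k - 1) * (real k - 2)" by (simp add: j algebra_simps)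
  ultimately show ?thesis by simp
qed

end
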